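(* Let $H\in(\frac34,1)$ and let $B^H=Z^{1,H}$ be a fractional Brownian motion of Hurst index $H$. Let $x:[0,\infty)\to\mathbb{R}$ be an integrable function such that $$\int_{\mathbb{R}_+^2}|x(u)||x(v)||u-v|^{2H-2}\,du\,dv<\infty .$$ Define the fractional Volterra process $X_t=\int_0^t x(t-u)\,dB^H_u$ for $t\ge0$, and $$G_T(t)=\frac{1}{T^{2H-1}}\int_0^{Tt}\big(X_s^2-E[X_s^2]\big)ds,\qquad t\ge0,\ T>0 .$$ Then, as $T\to\infty$, the family of processes $(G_T(t))_{t\ge0}$ converges in the sense of finite-dimensional distributions to $(b\,R^{H''}_t)_{t\ge0}$, where $R^{H''}$ is the Rosenblatt process of parameter $H''=2H-1$ and $$b=\frac{H(2H-1)}{\sqrt{(H-\frac12)(4H-3)}}\int_{\mathbb{R}_+^2}x(u)x(v)\,du\,dv .$$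
   Context: Let $(B_t)_{t\in\mathbb{R}}$ be a two-sided standard Brownian motion. The Hermite process of order $q\ge1$ and self-similarity parameter $H\in(\frac12,1)$ is the multiple Wiener-Itô integral $$Z^{q,H}_t=c(H,q)\int_{\mathbb{R}^q}\Big(\int_0^t\prod_{j=1}^q(s-\xi_j)_+^{H_0-\frac32}ds\Big)dB_{\xi_1}\cdots dB_{\xi_q},\quad t\ge 0,$$ with $c(H,q)=\sqrt{\frac{H(2H-1)}{q!\,\beta(H_0-\frac12,2-2H_0)^q}}$, $H_0=1+\frac{H-1}{q}$, where $\beta$ is the Beta function. For $q=1$ it is the fractional Brownian motion of index $H$; for $q=2$ it is the Rosenblatt process $R^H=Z^{2,H}$ of parameter $H$. For $f:\mathbb{R}\to\mathbb{R}$ with $\int\int|f(u)||f(v)||u-v|^{2H-2}du\,dv<\infty$, $$\int_{\mathbb{R}}f(u)\,dZ^{q,H}_u=c(H,q)\int_{\mathbb{R}^q}\Big(\int_{\mathbb{R}}f(u)\prod_{j=1}^q(u-\xi_j)_+^{H_0-\frac32}du\Big)dB_{\xi_1}\cdots dB_{\xi_q},$$ and $\int_0^t f\,dZ^{q,H}=\int_{\mathbb{R}}\mathbf{1}_{[0,t]}f\,dZ^{q,H}$. *)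

theory Defs
  imports "HOL-Probability.Probability"
begin

definition two_sided_brownian_motion :: "'a measure \<Rightarrow> (real \<Rightarrow> 'a \<Rightarrow> real) \<Rightarrow> bool" where
  "two_sided_brownian_motion M B \<longleftrightarrow>
     prob_space M \<and>
     (\<forall>t. B t \<in> borel_measurable M) \<and>
     (AE \<omega> in M. B 0 \<omega> = 0) \<and>
     (\<forall>s t. s < t \<longrightarrow>
        distributed M lborel (\<lambda>\<omega>. B t \<omega> - B s \<omega>) (normal_density 0 (sqrt (t - s)))) \<and>
     (\<forall>(n::nat) p. strict_mono_on {..n} p \<longrightarrow>
        prob_space.indep_vars M (\<lambda>_. borel) (\<lambda>i \<omega>. B (p (Suc i)) \<omega> - B (p i) \<omega>) {..<n}) \<and>
     (AE \<omega> in M. continuous_on UNIV (\<lambda>t. B t \<omega>))"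

text \<open>
  Multiple Wiener-Ito integral of order \<open>q\<close>. A point of \<open>\<real>\<^sup>q\<close> is a function
  \<open>\<xi> :: nat \<Rightarrow> real\<close> on the index set \<open>{..<q}\<close>. The step functions have cells that are
  products of \<open>q\<close> intervals of the partition \<open>p 0 < \<dots> < p n\<close>, the cell with multi-index
  \<open>i\<close> being the product of the intervals \<open>(p (i j), p (Suc (i j))]\<close>. Only injective \<open>i\<close>
  contribute, so that the step functions vanish on all diagonals \<open>\<xi> j = \<xi> j'\<close>.
\<close>

definition offdiag_indices :: "nat \<Rightarrow> nat \<Rightarrow> (nat \<Rightarrow> nat) set" where
  "offdiag_indices q n = {i \<in> {..<q} \<rightarrow>\<^sub>E {..<n}. inj_on i {..<q}}"

definition offdiag_step ::
    "nat \<Rightarrow> nat \<Rightarrow> (nat \<Rightarrow> real) \<Rightarrow> ((nat \<Rightarrow> nat) \<Rightarrow> real) \<Rightarrow> (nat \<Rightarrow> real) \<Rightarrow> real" where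
  "offdiag_step q n p a \<xi> =
     (\<Sum>i\<in>offdiag_indices q n. a i * (\<Prod>j<q. indicator {p (i j)<..p (Suc (i j))} (\<xi> j)))"

definition offdiag_step_integral ::
    "(real \<Rightarrow> 'a \<Rightarrow> real) \<Rightarrow> nat \<Rightarrow> nat \<Rightarrow> (nat \<Rightarrow> real) \<Rightarrow> ((nat \<Rightarrow> nat) \<Rightarrow> real) \<Rightarrow> 'a \<Rightarrow> real" where
  "offdiag_step_integral B q n p a \<omega> =
     (\<Sum>i\<in>offdiag_indices q n. a i * (\<Prod>j<q. B (p (Suc (i j))) \<omega> - B (p (i j)) \<omega>))"

text \<open>
  The integral is the continuous extension from step functions to \<open>L\<^sup>2\<close>. It is determined only
  up to almost sure equality, so it is a relation: \<open>Y\<close> is a version of the integral of \<open>f\<close>.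
  The measurability of \<open>f\<close> is required explicitly because \<open>nn_integral\<close> of a
  non-measurable function is only a lower integral.
\<close>

definition has_multiple_wiener_integral ::
    "'a measure \<Rightarrow> (real \<Rightarrow> 'a \<Rightarrow> real) \<Rightarrow> nat \<Rightarrow> ((nat \<Rightarrow> real) \<Rightarrow> real) \<Rightarrow> ('a \<Rightarrow> real) \<Rightarrow> bool" where
  "has_multiple_wiener_integral M B q f Y \<longleftrightarrow>
     f \<in> borel_measurable (\<Pi>\<^sub>M j\<in>{..<q}. lborel) \<and>
     Y \<in> borel_measurable M \<and>
     (\<exists>n p a.
        (\<forall>k. strict_mono_on {..n k} (p k)) \<and>
        (\<lambda>k. \<integral>\<^sup>+\<xi>. ennreal ((f \<xi> - offdiag_step q (n k) (p k) (a k) \<xi>)\<^sup>2)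
               \<partial>(\<Pi>\<^sub>M j\<in>{..<q}. lborel)) \<longlonglongrightarrow> 0 \<and>
        (\<lambda>k. \<integral>\<^sup>+\<omega>. ennreal ((Y \<omega> - offdiag_step_integral B q (n k) (p k) (a k) \<omega>)\<^sup>2)
               \<partial>M) \<longlonglongrightarrow> 0)"

definition hermite_H0 :: "nat \<Rightarrow> real \<Rightarrow> real" where
  "hermite_H0 q H = 1 + (H - 1) / real q"

definition hermite_const :: "nat \<Rightarrow> real \<Rightarrow> real" where
  "hermite_const q H =
     sqrt (H * (2 * H - 1) /
       (fact q * Beta (hermite_H0 q H - 1 / 2) (2 - 2 * hermite_H0 q H) ^ q))"

text \<open>
  The exponent below is negative; since \<open>0 powr a = 0\<close>, the factor
  \<open>max 0 (u - \<xi> j) powr a\<close> is \<open>0\<close> for \<open>u \<le> \<xi> j\<close>, as it should be.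
\<close>

definition hermite_kernel :: "nat \<Rightarrow> real \<Rightarrow> (real \<Rightarrow> real) \<Rightarrow> (nat \<Rightarrow> real) \<Rightarrow> real" where
  "hermite_kernel q H f \<xi> =
     hermite_const q H *
       (LINT u|lebesgue. f u * (\<Prod>j<q. max 0 (u - \<xi> j) powr (hermite_H0 q H - 3 / 2)))"

definition hermite_integrand :: "real \<Rightarrow> (real \<Rightarrow> real) \<Rightarrow> bool" where
  "hermite_integrand H f \<longleftrightarrow>
     f \<in> borel_measurable lebesgue \<and>
     integrable (lebesgue :: (real \<times> real) measure)
       (\<lambda>(u, v). \<bar>f u\<bar> * \<bar>f v\<bar> * \<bar>u - v\<bar> powr (2 * H - 2))"

text \<open>
  \<open>Y\<close> is a version of the Wiener integral of \<open>f\<close> over the whole line with respect to the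
  Hermite process of order \<open>q\<close> and parameter \<open>H\<close> driven by the Brownian motion \<open>B\<close>. The
  constant is part of the kernel. The process itself is the case of the indicator of \<open>[0, t]\<close>;
  it is fractional Brownian motion for \<open>q = 1\<close> and the Rosenblatt process for \<open>q = 2\<close>.
\<close>

definition has_hermite_integral ::
    "'a measure \<Rightarrow> (real \<Rightarrow> 'a \<Rightarrow> real) \<Rightarrow> nat \<Rightarrow> real \<Rightarrow> (real \<Rightarrow> real) \<Rightarrow> ('a \<Rightarrow> real) \<Rightarrow> bool" where
  "has_hermite_integral M B q H f Y \<longleftrightarrow>
     hermite_integrand H f \<and> has_multiple_wiener_integral M B q (hermite_kernel q H f) Y"

definition hermite_process ::
    "'a measure \<Rightarrow> (real \<Rightarrow> 'a \<Rightarrow> real) \<Rightarrow> nat \<Rightarrow> real \<Rightarrow> (real \<Rightarrow> 'a \<Rightarrow> real) \<Rightarrow> bool" where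
  "hermite_process M B q H Z \<longleftrightarrow>
     (\<forall>t\<ge>0. has_hermite_integral M B q H (indicator {0..t}) (Z t))"

abbreviation rosenblatt_process ::
    "'a measure \<Rightarrow> (real \<Rightarrow> 'a \<Rightarrow> real) \<Rightarrow> real \<Rightarrow> (real \<Rightarrow> 'a \<Rightarrow> real) \<Rightarrow> bool" where
  "rosenblatt_process M B H R \<equiv> hermite_process M B 2 H R"

text \<open>
  Each \<open>X t\<close> is determined only up to a null set depending on \<open>t\<close>. Joint measurability
  selects a measurable version of the process, for which time integrals along
  paths make sense.
\<close>

definition fractional_volterra_process ::
    "'a measure \<Rightarrow> (real \<Rightarrow> 'a \<Rightarrow> real) \<Rightarrow> real \<Rightarrow> (real \<Rightarrow> real) \<Rightarrow> (real \<Rightarrow> 'a \<Rightarrow> real) \<Rightarrow> bool" where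
  "fractional_volterra_process M B H x X \<longleftrightarrow>
     (\<lambda>(t, \<omega>). X t \<omega>) \<in> borel_measurable (restrict_space borel {0..} \<Otimes>\<^sub>M M) \<and>
     (\<forall>t\<ge>0. has_hermite_integral M B 1 H (\<lambda>u. indicator {0..t} u * x (t - u)) (X t))"

definition quadratic_functional ::
    "'a measure \<Rightarrow> real \<Rightarrow> (real \<Rightarrow> 'a \<Rightarrow> real) \<Rightarrow> real \<Rightarrow> real \<Rightarrow> 'a \<Rightarrow> real" where
  "quadratic_functional M H X T t \<omega> =
     1 / T powr (2 * H - 1) *
       (LINT s:{0..T * t}|lborel. (X s \<omega>)\<^sup>2 - (LINT \<omega>'|M. (X s \<omega>')\<^sup>2))"

text \<open>
  Convergence of finite-dimensional distributions of processes indexed by \<open>[0, \<infinity>)\<close>: for each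
  finite set \<open>J\<close> of times, the restriction to \<open>J\<close> converges in law in \<open>\<real>\<^sup>J\<close>, tested against
  bounded continuous functions. The limit may live on another probability space.
\<close>

definition fdd_converges ::
    "'a measure \<Rightarrow> ('i \<Rightarrow> real \<Rightarrow> 'a \<Rightarrow> real) \<Rightarrow> 'b measure \<Rightarrow> (real \<Rightarrow> 'b \<Rightarrow> real) \<Rightarrow> 'i filter \<Rightarrow> bool" where
  "fdd_converges M G N Z F \<longleftrightarrow>
     (\<forall>i. \<forall>t\<ge>0. G i t \<in> borel_measurable M) \<and>
     (\<forall>t\<ge>0. Z t \<in> borel_measurable N) \<and>
     (\<forall>J \<phi>. finite J \<and> J \<subseteq> {0..} \<and>
        continuous_map (powertop_real J) euclideanreal \<phi> \<and> bounded (\<phi> ` (J \<rightarrow>\<^sub>E UNIV)) \<longrightarrow>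
        ((\<lambda>i. LINT \<omega>|M. \<phi> (\<lambda>t\<in>J. G i t \<omega>)) \<longlongrightarrow> (LINT \<omega>|N. \<phi> (\<lambda>t\<in>J. Z t \<omega>))) F)"

end

theory Submission
  imports Defs
begin

text \<open>
  Every \<open>X\<^sub>s\<close> is the Wiener integral of a kernel \<open>k\<^sub>s\<close>, so \<open>X\<^sub>s\<^sup>2 - E[X\<^sub>s\<^sup>2]\<close> belongs to the second
  chaos with kernel \<open>k\<^sub>s \<otimes> k\<^sub>s\<close>. By Isserlis' formula, the squared \<open>L\<^sup>2\<close> distance of
  \<open>\<integral>\<^sub>0\<^sup>\<tau> (X\<^sub>s\<^sup>2 - E[X\<^sub>s\<^sup>2]) ds\<close> to the double integral of an off-diagonal step function \<open>S\<close> is at most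
  \<open>2 \<parallel>\<integral>\<^sub>0\<^sup>\<tau> k\<^sub>s \<otimes> k\<^sub>s ds - S\<parallel>\<^sup>2\<close>. After Brownian scaling this kernel is an average, with weights
  \<open>x(v) x(w) dv dw\<close>, of the functions
  \<open>(\<xi>, \<eta>) \<mapsto> \<integral> (s - v/T - \<xi>)\<^sub>+\<^sup>a (s - w/T - \<eta>)\<^sub>+\<^sup>a ds\<close> with \<open>a = H - 3/2\<close> and \<open>s \<in> [0, t]\<close>, \<open>s \<ge> v/T\<close>,
  \<open>s \<ge> w/T\<close>. These converge in \<open>L\<^sup>2\<close>, as \<open>T \<rightarrow> \<infinity>\<close>, to the kernel of the Rosenblatt process, up to a
  constant. Hence the step functions that approximate the Rosenblatt kernel also
  approximate \<open>G\<^sub>T\<close>, and the law of their integrals does not depend on the Brownian motion.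
\<close>

text \<open>The limit lives on another probability space, so nothing can converge to it in L2 on
  \<open>M\<close>. The link is the definition of the multiple integral itself: it supplies, for
  every \<open>R t\<close>, off-diagonal step functions whose integrals tend to \<open>R t\<close>.
  The same step functions, stretched by the factor T, are integrated against \<open>B\<close>, and
  both families of integrals are the same quadratic polynomial in Gaussian vectors of equal law.
  Thus double integrals against \<open>B\<close> are formed for step kernels only, and no rates have
  to be matched, because the kernel error is split at the Rosenblatt kernel. The two kernels can be
  compared since \<open>hermite_H0 1 H\<close> and \<open>hermite_H0 2 (2 * H - 1)\<close> both
  equal H: the exponent a and the Beta value in the constants agree. So b is the ratio of the square
  of \<open>hermite_const 1 H\<close> to \<open>hermite_const 2 (2 * H - 1)\<close>, times the
  squared integral of x. The normalisation balances: the time integral of the kernels scales like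
  T^(1 + 2a), Brownian scaling of a double integral contributes T, and 2 + 2a = 2H - 1.\<close>

section \<open>Convergence in law on finite products\<close>

text \<open>A modulus of continuity adapted to second moments. If every A failed, there would be a
  sequence of counterexamples; as \<open>\<phi>\<close> is bounded, the term with
  \<open>\<epsilon>\<close> keeps the z bounded, and the growing A forces y - z to 0. A subsequence
  of both then has a common limit, where continuity contradicts a gap above
  \<open>\<epsilon>\<close>. The term in z^2 does the work of tightness: bounded second moments
  absorb it.\<close>

lemma powertop_bounded_modulus:
  fixes \<phi> :: "('j \<Rightarrow> real) \<Rightarrow> real"
  assumes J: "finite J" and cont: "continuous_map (powertop_real J) euclideanreal \<phi>"
    and bd: "\<And>y. y \<in> J \<rightarrow>\<^sub>E UNIV \<Longrightarrow> \<bar>\<phi> y\<bar> \<le> C" and \<epsilon>: "0 < \<epsilon>"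
  shows "\<exists>A. 0 < A \<and> (\<forall>y\<in>J \<rightarrow>\<^sub>E UNIV. \<forall>z\<in>J \<rightarrow>\<^sub>E UNIV.
    \<bar>\<phi> y - \<phi> z\<bar> \<le> \<epsilon> + \<epsilon> * (\<Sum>t\<in>J. (z t)\<^sup>2) + A * (\<Sum>t\<in>J. (y t - z t)\<^sup>2))"
proof (rule ccontr)
  assume contra: "\<not> ?thesis"
  define ub where "ub n y z \<longleftrightarrow> \<bar>\<phi> y - \<phi> z\<bar> \<le>
    \<epsilon> + \<epsilon> * (\<Sum>t\<in>J. (z t)\<^sup>2) + real (Suc n) * (\<Sum>t\<in>J. (y t - z t)\<^sup>2)" for n y z
  have ex: "\<exists>y\<in>J \<rightarrow>\<^sub>E UNIV. \<exists>z\<in>J \<rightarrow>\<^sub>E UNIV. \<not> ub n y z" for n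
  proof (rule ccontr)
    assume "\<not> ?thesis"
    then have "\<forall>y\<in>J \<rightarrow>\<^sub>E UNIV. \<forall>z\<in>J \<rightarrow>\<^sub>E UNIV. ub n y z" by blast
    then have "0 < real (Suc n) \<and> (\<forall>y\<in>J \<rightarrow>\<^sub>E UNIV. \<forall>z\<in>J \<rightarrow>\<^sub>E UNIV. \<bar>\<phi> y - \<phi> z\<bar> \<le>
        \<epsilon> + \<epsilon> * (\<Sum>t\<in>J. (z t)\<^sup>2) + real (Suc n) * (\<Sum>t\<in>J. (y t - z t)\<^sup>2))"
      unfolding ub_def by (intro conjI of_nat_0_less_iff[THEN iffD2] zero_less_Suc)
    then show False by (rule notE[OF contra exI])
  qed
  have "\<forall>n. \<exists>yz. fst yz \<in> J \<rightarrow>\<^sub>E UNIV \<and> snd yz \<in> J \<rightarrow>\<^sub>E UNIV \<and> \<not> ub n (fst yz) (snd yz)"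
  proof
    fix n
    obtain y z where "y \<in> J \<rightarrow>\<^sub>E UNIV" "z \<in> J \<rightarrow>\<^sub>E UNIV" "\<not> ub n y z"
      using ex[of n] by (elim bexE)
    then show "\<exists>yz. fst yz \<in> J \<rightarrow>\<^sub>E UNIV \<and> snd yz \<in> J \<rightarrow>\<^sub>E UNIV \<and> \<not> ub n (fst yz) (snd yz)"
      by (intro exI[of _ "(y, z)"]) (simp only: fst_conv snd_conv simp_thms)
  qed
  from choice[OF this] obtain yz where
    yz: "\<And>n. fst (yz n) \<in> J \<rightarrow>\<^sub>E UNIV \<and> snd (yz n) \<in> J \<rightarrow>\<^sub>E UNIV \<and> \<not> ub n (fst (yz n)) (snd (yz n))"
    by blast
  define Y Z where "Y n = fst (yz n)" and "Z n = snd (yz n)" for n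
  have Y: "Y n \<in> J \<rightarrow>\<^sub>E UNIV" and Z: "Z n \<in> J \<rightarrow>\<^sub>E UNIV" and "\<not> ub n (Y n) (Z n)" for n
    unfolding Y_def Z_def using yz[of n] by blast+
  then have YZ: "\<bar>\<phi> (Y n) - \<phi> (Z n)\<bar> >
      \<epsilon> + \<epsilon> * (\<Sum>t\<in>J. (Z n t)\<^sup>2) + real (Suc n) * (\<Sum>t\<in>J. (Y n t - Z n t)\<^sup>2)" for n
    unfolding ub_def not_le by blast
  have le: "\<bar>\<phi> (Y n) - \<phi> (Z n)\<bar> \<le> 2 * C" for n
    using bd[OF Y, of n] bd[OF Z, of n] by linarith
  have nn: "0 \<le> (\<Sum>t\<in>J. (Z n t)\<^sup>2)" "0 \<le> (\<Sum>t\<in>J. (Y n t - Z n t)\<^sup>2)" for n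
    by (auto intro: sum_nonneg)
  have Zb: "(Z n t)\<^sup>2 \<le> 2 * C / \<epsilon>" if "t \<in> J" for n t
  proof -
    have "(Z n t)\<^sup>2 \<le> (\<Sum>t\<in>J. (Z n t)\<^sup>2)"
      using that J by (intro member_le_sum) auto
    moreover have "\<epsilon> * (\<Sum>t\<in>J. (Z n t)\<^sup>2) \<le> 2 * C"
      using YZ[of n] le[of n] nn[of n] \<epsilon> mult_nonneg_nonneg[of "real (Suc n)" "\<Sum>t\<in>J. (Y n t - Z n t)\<^sup>2"]
      by linarith
    ultimately have "\<epsilon> * (Z n t)\<^sup>2 \<le> 2 * C"
      using \<epsilon> mult_left_mono[of "(Z n t)\<^sup>2" "\<Sum>t\<in>J. (Z n t)\<^sup>2" \<epsilon>] by linarith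
    then show ?thesis
      using \<epsilon> by (simp add: pos_le_divide_eq mult.commute)
  qed
  have YZb: "(Y n t - Z n t)\<^sup>2 \<le> 2 * C / real (Suc n)" if "t \<in> J" for n t
  proof -
    have "(Y n t - Z n t)\<^sup>2 \<le> (\<Sum>t\<in>J. (Y n t - Z n t)\<^sup>2)"
      using that J by (intro member_le_sum) auto
    moreover have "real (Suc n) * (\<Sum>t\<in>J. (Y n t - Z n t)\<^sup>2) \<le> 2 * C"
      using YZ[of n] le[of n] nn[of n] \<epsilon> mult_nonneg_nonneg[of \<epsilon> "\<Sum>t\<in>J. (Z n t)\<^sup>2"]
      by linarith
    ultimately have "real (Suc n) * (Y n t - Z n t)\<^sup>2 \<le> 2 * C"
      using mult_left_mono[of "(Y n t - Z n t)\<^sup>2" "\<Sum>t\<in>J. (Y n t - Z n t)\<^sup>2" "real (Suc n)"]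
      by linarith
    then show ?thesis by (simp add: pos_le_divide_eq mult.commute del: of_nat_Suc)
  qed
  have "bounded ((\<lambda>x. x t) ` range Z)" if "t \<in> J" for t
  proof (rule boundedI[of _ "sqrt (2 * C / \<epsilon>)"])
    fix w assume "w \<in> (\<lambda>x. x t) ` range Z"
    then obtain n where "w = Z n t" by auto
    then show "norm w \<le> sqrt (2 * C / \<epsilon>)"
      using Zb[OF that, of n] by (simp add: real_le_rsqrt)
  qed
  \<comment> \<open>Bolzano-Weierstrass in all coordinates at once, as \<open>J\<close> is
    finite.\<close>
  from compact_lemma_general[where proj = "\<lambda>f t. f t" and unproj = "\<lambda>f. f", OF J this]
  have "\<exists>l r. strict_mono (r::nat\<Rightarrow>nat) \<and>
      (\<forall>e>0. eventually (\<lambda>n. \<forall>i\<in>J. dist (Z (r n) i) (l i) < e) sequentially)"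
    by (simp only: subset_refl simp_thms)
  then obtain l r where r: "strict_mono (r::nat\<Rightarrow>nat)"
    and l: "\<And>e. e > 0 \<Longrightarrow> eventually (\<lambda>n. \<forall>i\<in>J. dist (Z (r n) i) (l i) < e) sequentially"
    by (elim exE conjE) blast
  have Zl: "(\<lambda>n. Z (r n) t) \<longlonglongrightarrow> l t" if "t \<in> J" for t
    unfolding tendsto_iff
  proof safe
    fix e :: real assume "0 < e"
    from l[OF this] show "eventually (\<lambda>n. dist (Z (r n) t) (l t) < e) sequentially"
      by (rule eventually_mono) (use that in blast)
  qed
  have d0: "(\<lambda>n. Y (r n) t - Z (r n) t) \<longlonglongrightarrow> 0" if "t \<in> J" for t
  proof -
    have "(\<lambda>n. 2 * C / real (Suc n)) \<longlonglongrightarrow> 0"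
      using LIMSEQ_Suc[OF lim_const_over_n[of "2 * C"]] by simp
    from LIMSEQ_subseq_LIMSEQ[OF this r]
    have lim: "(\<lambda>n. 2 * C / real (Suc (r n))) \<longlonglongrightarrow> 0" by (simp add: o_def)
    have "(\<lambda>n. (Y (r n) t - Z (r n) t)\<^sup>2) \<longlonglongrightarrow> 0"
      by (rule tendsto_sandwich[OF _ _ tendsto_const lim]) (use YZb[OF that] in auto)
    from tendsto_real_sqrt[OF this] show ?thesis
      by (simp add: tendsto_rabs_zero_iff)
  qed
  have Yl: "(\<lambda>n. Y (r n) t) \<longlonglongrightarrow> l t" if "t \<in> J" for t
    using tendsto_add[OF d0[OF that] Zl[OF that]] by simp
  have lim: "(\<lambda>n. \<phi> (f n)) \<longlonglongrightarrow> \<phi> (restrict l J)"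
    if "\<And>n. f n \<in> J \<rightarrow>\<^sub>E UNIV" "\<And>t. t \<in> J \<Longrightarrow> (\<lambda>n. f n t) \<longlonglongrightarrow> l t" for f
  proof -
    have "limitin (powertop_real J) f (restrict l J) sequentially"
      using that by (auto simp: limitin_componentwise)
    from continuous_map_limit[OF cont this] show ?thesis by (simp add: o_def)
  qed
  have "(\<lambda>n. \<bar>\<phi> (Y (r n)) - \<phi> (Z (r n))\<bar>) \<longlonglongrightarrow> \<bar>\<phi> (restrict l J) - \<phi> (restrict l J)\<bar>"
    by (intro tendsto_intros lim Y Z Yl Zl)
  then have "eventually (\<lambda>n. \<bar>\<phi> (Y (r n)) - \<phi> (Z (r n))\<bar> < \<epsilon>) sequentially"
    using \<epsilon> by (intro order_tendstoD) auto
  then obtain n where "\<bar>\<phi> (Y (r n)) - \<phi> (Z (r n))\<bar> < \<epsilon>"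
    by (auto simp: eventually_sequentially)
  then show False
    using YZ[of "r n"] nn[of "r n"] \<epsilon>
      mult_nonneg_nonneg[of \<epsilon> "\<Sum>t\<in>J. (Z (r n) t)\<^sup>2"]
      mult_nonneg_nonneg[of "real (Suc (r n))" "\<Sum>t\<in>J. (Y (r n) t - Z (r n) t)\<^sup>2"]
    by linarith
qed

text \<open>The product and Borel sigma-algebras are identified on
  \<open>nat \<Rightarrow> real\<close>. So \<open>J\<close> is enumerated, \<open>\<phi>\<close> is
  pulled back to functions of a natural argument, and a point of the finite product is padded with 0
  beyond \<open>card J\<close>.\<close>

lemma continuous_map_powertop_measurable:
  fixes \<phi> :: "('j \<Rightarrow> real) \<Rightarrow> real"
  assumes J: "finite J" and cont: "continuous_map (powertop_real J) euclideanreal \<phi>"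
  shows "\<phi> \<in> borel_measurable (\<Pi>\<^sub>M t\<in>J. borel)"
proof -
  obtain e :: "nat \<Rightarrow> 'j" where e: "bij_betw e {..<card J} J"
    using ex_bij_betw_nat_finite[OF J] by (auto simp: atLeast0LessThan)
  define i where "i = the_inv_into {..<card J} e"
  have i: "i t < card J" "e (i t) = t" if "t \<in> J" for t
    using e that f_the_inv_into_f_bij_betw[OF e that] the_inv_into_into[of e "{..<card J}" t]
    by (auto simp: i_def bij_betw_def)
  define \<psi> where "\<psi> y = \<phi> (\<lambda>t\<in>J. y (i t))" for y :: "nat \<Rightarrow> real"
  have "continuous_map (powertop_real UNIV) (powertop_real J) (\<lambda>y. \<lambda>t\<in>J. y (i t))"
    by (auto simp: continuous_map_componentwise intro!: continuous_map_product_projection)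
  from continuous_map_compose[OF this cont]
  have "continuous_map euclidean euclideanreal \<psi>"
    unfolding o_def \<psi>_def[abs_def] euclidean_product_topology .
  then have "continuous_on UNIV \<psi>"
    by (simp only: continuous_map_iff_continuous2)
  then have "\<psi> \<in> borel_measurable borel"
    by (rule borel_measurable_continuous_onI)
  then have [measurable]: "\<psi> \<in> borel_measurable (\<Pi>\<^sub>M i\<in>UNIV. borel)"
    unfolding measurable_cong_sets[OF sets_PiM_equal_borel refl] .
  have "(\<lambda>y k. if k < card J then y (e k) else 0) \<in> measurable (\<Pi>\<^sub>M t\<in>J. borel) (\<Pi>\<^sub>M k\<in>UNIV. borel)"
  proof (rule measurable_PiM_single')
    fix k
    show "(\<lambda>y. if k < card J then y (e k) else 0) \<in> borel_measurable (\<Pi>\<^sub>M t\<in>J. borel)"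
    proof (cases "k < card J")
      case True
      then have "e k \<in> J" using e by (auto simp: bij_betw_def)
      with True show ?thesis by (simp add: measurable_component_singleton)
    qed simp
  qed auto
  from measurable_compose[OF this \<open>\<psi> \<in> borel_measurable (\<Pi>\<^sub>M i\<in>UNIV. borel)\<close>]
  have "(\<lambda>y. \<psi> (\<lambda>k. if k < card J then y (e k) else 0)) \<in> borel_measurable (\<Pi>\<^sub>M t\<in>J. borel)" .
  moreover have "\<psi> (\<lambda>k. if k < card J then y (e k) else 0) = \<phi> y"
    if "y \<in> space (\<Pi>\<^sub>M t\<in>J. borel)" for y
  proof -
    have "(\<lambda>t\<in>J. if i t < card J then y (e (i t)) else 0) = y"
      using that i by (auto simp: space_PiM PiE_def extensional_def fun_eq_iff)
    then show ?thesis by (simp add: \<psi>_def)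
  qed
  ultimately show ?thesis
    by (subst measurable_cong[where g = "\<lambda>y. \<psi> (\<lambda>k. if k < card J then y (e k) else 0)"]) auto
qed

text \<open>Integrates the modulus of continuity. In \<open>ennreal\<close> the bound makes sense
  also when the second moments on the right are infinite.\<close>

lemma expectation_gap_bound:
  fixes Y Z :: "'j \<Rightarrow> 'a \<Rightarrow> real"
  assumes M: "prob_space M" and J: "finite J"
    and cont: "continuous_map (powertop_real J) euclideanreal \<phi>"
    and bd: "\<And>y. y \<in> J \<rightarrow>\<^sub>E UNIV \<Longrightarrow> \<bar>\<phi> y\<bar> \<le> C"
    and Y: "\<And>t. t \<in> J \<Longrightarrow> Y t \<in> borel_measurable M"
    and Z: "\<And>t. t \<in> J \<Longrightarrow> Z t \<in> borel_measurable M"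
    and le: "\<And>y z. y \<in> J \<rightarrow>\<^sub>E UNIV \<Longrightarrow> z \<in> J \<rightarrow>\<^sub>E UNIV \<Longrightarrow>
      \<bar>\<phi> y - \<phi> z\<bar> \<le> \<epsilon> + \<epsilon> * (\<Sum>t\<in>J. (z t)\<^sup>2) + A * (\<Sum>t\<in>J. (y t - z t)\<^sup>2)"
    and pos: "0 \<le> \<epsilon>" "0 \<le> A"
  shows "ennreal \<bar>(LINT \<omega>|M. \<phi> (\<lambda>t\<in>J. Y t \<omega>)) - (LINT \<omega>|M. \<phi> (\<lambda>t\<in>J. Z t \<omega>))\<bar> \<le>
    ennreal \<epsilon> + ennreal \<epsilon> * (\<Sum>t\<in>J. \<integral>\<^sup>+\<omega>. ennreal ((Z t \<omega>)\<^sup>2) \<partial>M)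
      + ennreal A * (\<Sum>t\<in>J. \<integral>\<^sup>+\<omega>. ennreal ((Y t \<omega> - Z t \<omega>)\<^sup>2) \<partial>M)"
proof -
  interpret prob_space M by fact
  note [measurable] = continuous_map_powertop_measurable[OF J cont]
  have vec: "(\<lambda>\<omega>. \<lambda>t\<in>J. W t \<omega>) \<in> measurable M (\<Pi>\<^sub>M t\<in>J. borel)"
    if "\<And>t. t \<in> J \<Longrightarrow> W t \<in> borel_measurable M" for W :: "'j \<Rightarrow> 'a \<Rightarrow> real"
    using that by (intro measurable_restrict)
  note [measurable] = vec[OF Y] vec[OF Z]
  have int: "integrable M (\<lambda>\<omega>. \<phi> (\<lambda>t\<in>J. W t \<omega>))"
    if "(\<lambda>\<omega>. \<lambda>t\<in>J. W t \<omega>) \<in> measurable M (\<Pi>\<^sub>M t\<in>J. borel)" for W :: "'j \<Rightarrow> 'a \<Rightarrow> real"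
  proof (rule integrable_const_bound[where B = C])
    show "(\<lambda>\<omega>. \<phi> (\<lambda>t\<in>J. W t \<omega>)) \<in> borel_measurable M"
      by (rule measurable_compose[OF that continuous_map_powertop_measurable[OF J cont]])
    show "AE \<omega> in M. norm (\<phi> (\<lambda>t\<in>J. W t \<omega>)) \<le> C"
      by (intro AE_I2) (simp add: bd)
  qed
  have "\<bar>(LINT \<omega>|M. \<phi> (\<lambda>t\<in>J. Y t \<omega>)) - (LINT \<omega>|M. \<phi> (\<lambda>t\<in>J. Z t \<omega>))\<bar> =
      norm (LINT \<omega>|M. \<phi> (\<lambda>t\<in>J. Y t \<omega>) - \<phi> (\<lambda>t\<in>J. Z t \<omega>))"
    using int[OF vec[OF Y]] int[OF vec[OF Z]] by simp
  then have "ennreal \<bar>(LINT \<omega>|M. \<phi> (\<lambda>t\<in>J. Y t \<omega>)) - (LINT \<omega>|M. \<phi> (\<lambda>t\<in>J. Z t \<omega>))\<bar> \<le>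
      (\<integral>\<^sup>+\<omega>. norm (\<phi> (\<lambda>t\<in>J. Y t \<omega>) - \<phi> (\<lambda>t\<in>J. Z t \<omega>)) \<partial>M)"
    by (simp only:) (intro integral_norm_bound_ennreal Bochner_Integration.integrable_diff int vec Y Z)
  also have "\<dots> \<le> (\<integral>\<^sup>+\<omega>. ennreal \<epsilon> + ennreal \<epsilon> * (\<Sum>t\<in>J. ennreal ((Z t \<omega>)\<^sup>2))
      + ennreal A * (\<Sum>t\<in>J. ennreal ((Y t \<omega> - Z t \<omega>)\<^sup>2)) \<partial>M)"
  proof (rule nn_integral_mono)
    fix \<omega>
    have "norm (\<phi> (\<lambda>t\<in>J. Y t \<omega>) - \<phi> (\<lambda>t\<in>J. Z t \<omega>)) \<le>
        \<epsilon> + \<epsilon> * (\<Sum>t\<in>J. (Z t \<omega>)\<^sup>2) + A * (\<Sum>t\<in>J. (Y t \<omega> - Z t \<omega>)\<^sup>2)"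
      using le[of "\<lambda>t\<in>J. Y t \<omega>" "\<lambda>t\<in>J. Z t \<omega>"] by simp
    then show "ennreal (norm (\<phi> (\<lambda>t\<in>J. Y t \<omega>) - \<phi> (\<lambda>t\<in>J. Z t \<omega>))) \<le>
        ennreal \<epsilon> + ennreal \<epsilon> * (\<Sum>t\<in>J. ennreal ((Z t \<omega>)\<^sup>2))
        + ennreal A * (\<Sum>t\<in>J. ennreal ((Y t \<omega> - Z t \<omega>)\<^sup>2))"
      using pos
      by (simp add: ennreal_leI sum_nonneg flip: ennreal_mult ennreal_plus)
  qed
  also have "\<dots> = ennreal \<epsilon> + ennreal \<epsilon> * (\<Sum>t\<in>J. \<integral>\<^sup>+\<omega>. ennreal ((Z t \<omega>)\<^sup>2) \<partial>M)
      + ennreal A * (\<Sum>t\<in>J. \<integral>\<^sup>+\<omega>. ennreal ((Y t \<omega> - Z t \<omega>)\<^sup>2) \<partial>M)"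
  proof -
    have s: "(\<lambda>\<omega>. \<Sum>t\<in>J. ennreal ((Z t \<omega>)\<^sup>2)) \<in> borel_measurable M"
      "(\<lambda>\<omega>. \<Sum>t\<in>J. ennreal ((Y t \<omega> - Z t \<omega>)\<^sup>2)) \<in> borel_measurable M"
      using Y Z by (auto intro!: borel_measurable_sum)
    have "(\<integral>\<^sup>+\<omega>. (\<Sum>t\<in>J. ennreal ((Z t \<omega>)\<^sup>2)) \<partial>M) = (\<Sum>t\<in>J. \<integral>\<^sup>+\<omega>. ennreal ((Z t \<omega>)\<^sup>2) \<partial>M)"
      "(\<integral>\<^sup>+\<omega>. (\<Sum>t\<in>J. ennreal ((Y t \<omega> - Z t \<omega>)\<^sup>2)) \<partial>M) =
        (\<Sum>t\<in>J. \<integral>\<^sup>+\<omega>. ennreal ((Y t \<omega> - Z t \<omega>)\<^sup>2) \<partial>M)"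
      by (rule nn_integral_sum; use Y Z in measurable)+
    then show ?thesis
      using s by (simp add: nn_integral_add nn_integral_cmult emeasure_space_1)
  qed
  finally show ?thesis .
qed

lemma square_le_twice: "ennreal ((a + b :: real)\<^sup>2) \<le> 2 * ennreal (a\<^sup>2) + 2 * ennreal (b\<^sup>2)"
proof -
  have "(a + b)\<^sup>2 \<le> 2 * a\<^sup>2 + 2 * b\<^sup>2"
    using sum_squares_bound[of a b] by (simp add: power2_sum)
  then have "ennreal ((a + b)\<^sup>2) \<le> ennreal (2 * a\<^sup>2 + 2 * b\<^sup>2)" by (rule ennreal_leI)
  then show ?thesis by (simp add: ennreal_plus ennreal_mult)
qed

text \<open>
  A form of Slutsky's theorem in which the approximants of the given variables and of the
  limit live on different probability spaces and are only coupled through their law.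
\<close>

lemma expectation_tendsto_of_equal_laws:
  fixes G Z :: "nat \<Rightarrow> 'j \<Rightarrow> 'a \<Rightarrow> real" and Z' :: "nat \<Rightarrow> 'j \<Rightarrow> 'b \<Rightarrow> real" and L :: "'j \<Rightarrow> 'b \<Rightarrow> real"
  assumes M: "prob_space M" and N: "prob_space N" and J: "finite J"
    and cont: "continuous_map (powertop_real J) euclideanreal \<phi>"
    and bdd: "bounded (\<phi> ` (J \<rightarrow>\<^sub>E UNIV))"
    and G: "\<And>n t. t \<in> J \<Longrightarrow> G n t \<in> borel_measurable M"
    and Z: "\<And>n t. t \<in> J \<Longrightarrow> Z n t \<in> borel_measurable M"
    and Z': "\<And>n t. t \<in> J \<Longrightarrow> Z' n t \<in> borel_measurable N"
    and L: "\<And>t. t \<in> J \<Longrightarrow> L t \<in> borel_measurable N"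
    and L2: "\<And>t. t \<in> J \<Longrightarrow> (\<integral>\<^sup>+\<omega>. ennreal ((L t \<omega>)\<^sup>2) \<partial>N) < \<infinity>"
    and GZ: "\<And>t. t \<in> J \<Longrightarrow> (\<lambda>n. \<integral>\<^sup>+\<omega>. ennreal ((G n t \<omega> - Z n t \<omega>)\<^sup>2) \<partial>M) \<longlonglongrightarrow> 0"
    and ZL: "\<And>t. t \<in> J \<Longrightarrow> (\<lambda>n. \<integral>\<^sup>+\<omega>. ennreal ((Z' n t \<omega> - L t \<omega>)\<^sup>2) \<partial>N) \<longlonglongrightarrow> 0"
    and law: "\<And>n. distr M (\<Pi>\<^sub>M t\<in>J. borel) (\<lambda>\<omega>. \<lambda>t\<in>J. Z n t \<omega>) =
      distr N (\<Pi>\<^sub>M t\<in>J. borel) (\<lambda>\<omega>. \<lambda>t\<in>J. Z' n t \<omega>)"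
  shows "(\<lambda>n. LINT \<omega>|M. \<phi> (\<lambda>t\<in>J. G n t \<omega>)) \<longlonglongrightarrow> (LINT \<omega>|N. \<phi> (\<lambda>t\<in>J. L t \<omega>))"
proof -
  obtain C where "\<forall>w\<in>\<phi> ` (J \<rightarrow>\<^sub>E UNIV). norm w \<le> C"
    using bdd by (auto simp: bounded_iff)
  then have bd: "\<bar>\<phi> y\<bar> \<le> C" if "y \<in> J \<rightarrow>\<^sub>E UNIV" for y
    using that by auto
  define S where "S = (\<Sum>t\<in>J. \<integral>\<^sup>+\<omega>. ennreal ((L t \<omega>)\<^sup>2) \<partial>N)"
  define d where "d n = (\<Sum>t\<in>J. \<integral>\<^sup>+\<omega>. ennreal ((G n t \<omega> - Z n t \<omega>)\<^sup>2) \<partial>M)" for n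
  define d' where "d' n = (\<Sum>t\<in>J. \<integral>\<^sup>+\<omega>. ennreal ((Z' n t \<omega> - L t \<omega>)\<^sup>2) \<partial>N)" for n
  have "S < top" using L2 J by (auto simp: S_def)
  then obtain s where s: "S = ennreal s" "0 \<le> s" by (cases S) auto
  have d: "d \<longlonglongrightarrow> 0"
    using tendsto_sum[of J "\<lambda>t n. \<integral>\<^sup>+\<omega>. ennreal ((G n t \<omega> - Z n t \<omega>)\<^sup>2) \<partial>M" "\<lambda>_. 0"] GZ
    by (simp add: d_def[abs_def])
  have d': "d' \<longlonglongrightarrow> 0"
    using tendsto_sum[of J "\<lambda>t n. \<integral>\<^sup>+\<omega>. ennreal ((Z' n t \<omega> - L t \<omega>)\<^sup>2) \<partial>N" "\<lambda>_. 0"] ZL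
    by (simp add: d'_def[abs_def])
  note mphi = continuous_map_powertop_measurable[OF J cont]
  have eqE: "(LINT \<omega>|M. \<phi> (\<lambda>t\<in>J. Z n t \<omega>)) = (LINT \<omega>|N. \<phi> (\<lambda>t\<in>J. Z' n t \<omega>))" for n
  proof -
    have "(LINT \<omega>|M. \<phi> (\<lambda>t\<in>J. Z n t \<omega>)) =
        integral\<^sup>L (distr M (\<Pi>\<^sub>M t\<in>J. borel) (\<lambda>\<omega>. \<lambda>t\<in>J. Z n t \<omega>)) \<phi>"
      by (rule integral_distr[OF measurable_restrict[OF Z] mphi, symmetric])
    also have "\<dots> = (LINT \<omega>|N. \<phi> (\<lambda>t\<in>J. Z' n t \<omega>))"
      unfolding law by (rule integral_distr[OF measurable_restrict[OF Z'] mphi])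
    finally show ?thesis .
  qed
  have eqS: "(\<integral>\<^sup>+\<omega>. ennreal ((Z n t \<omega>)\<^sup>2) \<partial>M) = (\<integral>\<^sup>+\<omega>. ennreal ((Z' n t \<omega>)\<^sup>2) \<partial>N)" if t: "t \<in> J" for n t
  proof -
    have m: "(\<lambda>y. ennreal ((y t)\<^sup>2)) \<in> borel_measurable (\<Pi>\<^sub>M t\<in>J. borel)"
      using measurable_component_singleton[OF t, of "\<lambda>_. borel"] by measurable
    have "(\<integral>\<^sup>+\<omega>. ennreal ((Z n t \<omega>)\<^sup>2) \<partial>M) =
        (\<integral>\<^sup>+y. ennreal ((y t)\<^sup>2) \<partial>distr M (\<Pi>\<^sub>M t\<in>J. borel) (\<lambda>\<omega>. \<lambda>t\<in>J. Z n t \<omega>))"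
      using t m measurable_restrict[of J "Z n" M "\<lambda>_. borel", OF Z]
      by (subst nn_integral_distr) auto
    also have "\<dots> = (\<integral>\<^sup>+\<omega>. ennreal ((Z' n t \<omega>)\<^sup>2) \<partial>N)"
      unfolding law using t m measurable_restrict[of J "Z' n" N "\<lambda>_. borel", OF Z']
      by (subst nn_integral_distr) auto
    finally show ?thesis .
  qed
  \<comment> \<open>Second moments of \<open>Z n\<close> are computed on \<open>N\<close> through
    the common law, where the distance to \<open>L\<close> controls them.\<close>
  have Zb: "(\<Sum>t\<in>J. \<integral>\<^sup>+\<omega>. ennreal ((Z n t \<omega>)\<^sup>2) \<partial>M) \<le> 2 * d' n + 2 * S" for n
  proof -
    have "(\<integral>\<^sup>+\<omega>. ennreal ((Z' n t \<omega>)\<^sup>2) \<partial>N) \<le>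
        2 * (\<integral>\<^sup>+\<omega>. ennreal ((Z' n t \<omega> - L t \<omega>)\<^sup>2) \<partial>N) + 2 * (\<integral>\<^sup>+\<omega>. ennreal ((L t \<omega>)\<^sup>2) \<partial>N)"
      if t: "t \<in> J" for t
    proof -
      note [measurable] = Z'[OF t] L[OF t]
      have "(\<integral>\<^sup>+\<omega>. ennreal ((Z' n t \<omega>)\<^sup>2) \<partial>N) \<le>
          (\<integral>\<^sup>+\<omega>. 2 * ennreal ((Z' n t \<omega> - L t \<omega>)\<^sup>2) + 2 * ennreal ((L t \<omega>)\<^sup>2) \<partial>N)"
      proof (rule nn_integral_mono)
        show "ennreal ((Z' n t \<omega>)\<^sup>2) \<le> 2 * ennreal ((Z' n t \<omega> - L t \<omega>)\<^sup>2) + 2 * ennreal ((L t \<omega>)\<^sup>2)" for \<omega>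
          using square_le_twice[of "Z' n t \<omega> - L t \<omega>" "L t \<omega>"] by simp
      qed
      also have "\<dots> = 2 * (\<integral>\<^sup>+\<omega>. ennreal ((Z' n t \<omega> - L t \<omega>)\<^sup>2) \<partial>N)
          + 2 * (\<integral>\<^sup>+\<omega>. ennreal ((L t \<omega>)\<^sup>2) \<partial>N)"
        by (simp add: nn_integral_add nn_integral_cmult)
      finally show ?thesis .
    qed
    then have "(\<Sum>t\<in>J. \<integral>\<^sup>+\<omega>. ennreal ((Z' n t \<omega>)\<^sup>2) \<partial>N) \<le>
      (\<Sum>t\<in>J. 2 * (\<integral>\<^sup>+\<omega>. ennreal ((Z' n t \<omega> - L t \<omega>)\<^sup>2) \<partial>N) + 2 * (\<integral>\<^sup>+\<omega>. ennreal ((L t \<omega>)\<^sup>2) \<partial>N))"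
      by (rule sum_mono)
    then show ?thesis
      by (simp add: eqS S_def d'_def sum.distrib sum_distrib_left)
  qed
  show ?thesis
  proof (rule LIMSEQ_I)
    fix e :: real assume e: "0 < e"
    \<comment> \<open>The two gap bounds contribute 2 \<open>\<epsilon>\<close>, and their
      second-moment terms tend to \<open>\<epsilon>\<close> times 2 S + S; this choice makes the
      total e / 2.\<close>
    define \<epsilon> where "\<epsilon> = e / (2 * (2 + 3 * s))"
    have \<epsilon>: "0 < \<epsilon>" using e s by (simp add: \<epsilon>_def)
    from powertop_bounded_modulus[OF J cont bd \<epsilon>] obtain A where A: "0 < A"
      and le: "\<And>y z. y \<in> J \<rightarrow>\<^sub>E UNIV \<Longrightarrow> z \<in> J \<rightarrow>\<^sub>E UNIV \<Longrightarrow>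
      \<bar>\<phi> y - \<phi> z\<bar> \<le> \<epsilon> + \<epsilon> * (\<Sum>t\<in>J. (z t)\<^sup>2) + A * (\<Sum>t\<in>J. (y t - z t)\<^sup>2)"
      by blast
    let ?b = "\<lambda>n. (ennreal \<epsilon> + ennreal \<epsilon> * (2 * d' n + 2 * S) + ennreal A * d n)
        + (ennreal \<epsilon> + ennreal \<epsilon> * S + ennreal A * d' n)"
    have "?b \<longlonglongrightarrow> (ennreal \<epsilon> + ennreal \<epsilon> * (2 * 0 + 2 * S) + ennreal A * 0)
        + (ennreal \<epsilon> + ennreal \<epsilon> * S + ennreal A * 0)"
      by (intro tendsto_add tendsto_const ennreal_tendsto_cmult d d') auto
    also have "(ennreal \<epsilon> + ennreal \<epsilon> * (2 * 0 + 2 * S) + ennreal A * 0)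
        + (ennreal \<epsilon> + ennreal \<epsilon> * S + ennreal A * 0) = ennreal (\<epsilon> * (2 + 3 * s))"
    proof -
      have "2 * S = ennreal (2 * s)" using s by (simp add: ennreal_mult)
      then show ?thesis
        using s \<epsilon> by (simp add: algebra_simps flip: ennreal_mult ennreal_plus)
    qed
    also have "\<epsilon> * (2 + 3 * s) = e / 2"
      using s by (simp add: \<epsilon>_def field_simps)
    finally have lim: "?b \<longlonglongrightarrow> ennreal (e / 2)" .
    have "ennreal (e / 2) < ennreal e" using e by (simp add: ennreal_lessI)
    from order_tendstoD(2)[OF lim this]
    obtain n0 where n0: "\<And>n. n \<ge> n0 \<Longrightarrow> ?b n < ennreal e"
      by (auto simp: eventually_sequentially)
    show "\<exists>no. \<forall>n\<ge>no. norm ((LINT \<omega>|M. \<phi> (\<lambda>t\<in>J. G n t \<omega>)) - (LINT \<omega>|N. \<phi> (\<lambda>t\<in>J. L t \<omega>))) < e"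
    proof (intro exI allI impI)
      fix n assume n: "n \<ge> n0"
      let ?a = "LINT \<omega>|M. \<phi> (\<lambda>t\<in>J. G n t \<omega>)" and ?c = "LINT \<omega>|N. \<phi> (\<lambda>t\<in>J. L t \<omega>)"
      let ?z = "LINT \<omega>|M. \<phi> (\<lambda>t\<in>J. Z n t \<omega>)"
      have "ennreal \<bar>?a - ?z\<bar> \<le> ennreal \<epsilon> + ennreal \<epsilon> * (\<Sum>t\<in>J. \<integral>\<^sup>+\<omega>. ennreal ((Z n t \<omega>)\<^sup>2) \<partial>M)
          + ennreal A * d n"
        unfolding d_def using \<epsilon> A
        by (intro expectation_gap_bound[OF M J cont bd G Z le]) auto
      also have "\<dots> \<le> ennreal \<epsilon> + ennreal \<epsilon> * (2 * d' n + 2 * S) + ennreal A * d n"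
        by (intro add_mono mult_left_mono Zb) auto
      finally have 1: "ennreal \<bar>?a - ?z\<bar> \<le> \<dots>" .
      have 2: "ennreal \<bar>?z - ?c\<bar> \<le> ennreal \<epsilon> + ennreal \<epsilon> * S + ennreal A * d' n"
        unfolding d'_def S_def eqE using \<epsilon> A
        by (intro expectation_gap_bound[OF N J cont bd Z' L le]) auto
      have "ennreal \<bar>?a - ?c\<bar> \<le> ennreal (\<bar>?a - ?z\<bar> + \<bar>?z - ?c\<bar>)"
        by (intro ennreal_leI) simp
      also have "\<dots> = ennreal \<bar>?a - ?z\<bar> + ennreal \<bar>?z - ?c\<bar>" by simp
      also have "\<dots> \<le> ?b n" by (rule add_mono[OF 1 2])
      also have "\<dots> < ennreal e" by (rule n0[OF n])
      finally show "norm (?a - ?c) < e"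
        using e by (simp add: ennreal_less_iff)
    qed
  qed
qed

section \<open>Moments of Brownian increments\<close>

lemma (in prob_space) centered_normal_moments:
  assumes X: "distributed M lborel X (normal_density 0 \<sigma>)" and \<sigma>: "0 < \<sigma>"
  shows "integrable M (\<lambda>\<omega>. X \<omega> ^ 2)" "expectation (\<lambda>\<omega>. X \<omega> ^ 2) = \<sigma>\<^sup>2"
    "integrable M (\<lambda>\<omega>. X \<omega> ^ 4)" "expectation (\<lambda>\<omega>. X \<omega> ^ 4) = 3 * (\<sigma>\<^sup>2)\<^sup>2"
proof -
  have m: "integrable M (\<lambda>\<omega>. X \<omega> ^ (2 * k)) \<and>
      expectation (\<lambda>\<omega>. X \<omega> ^ (2 * k)) = fact (2 * k) / ((2 / \<sigma>\<^sup>2) ^ k * fact k)" for k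
  proof -
    have "has_bochner_integral lborel (\<lambda>x. normal_density 0 \<sigma> x * x ^ (2 * k))
        (fact (2 * k) / ((2 / \<sigma>\<^sup>2) ^ k * fact k))"
      using normal_moment_even[OF \<sigma>, of 0 k] by simp
    then have "integrable lborel (\<lambda>x. normal_density 0 \<sigma> x * x ^ (2 * k))"
      and "(LINT x|lborel. normal_density 0 \<sigma> x * x ^ (2 * k)) =
        fact (2 * k) / ((2 / \<sigma>\<^sup>2) ^ k * fact k)"
      by (auto simp: has_bochner_integral_iff)
    moreover have "(\<lambda>x::real. x ^ (2 * k)) \<in> borel_measurable lborel" by simp
    ultimately show ?thesis
      using distributed_integrable[OF X, of "\<lambda>x. x ^ (2 * k)"]
        distributed_integral[OF X, of "\<lambda>x. x ^ (2 * k)"] by simp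
  qed
  show "integrable M (\<lambda>\<omega>. X \<omega> ^ 2)" "expectation (\<lambda>\<omega>. X \<omega> ^ 2) = \<sigma>\<^sup>2"
    using m[of 1] by auto
  show "integrable M (\<lambda>\<omega>. X \<omega> ^ 4)" "expectation (\<lambda>\<omega>. X \<omega> ^ 4) = 3 * (\<sigma>\<^sup>2)\<^sup>2"
    using m[of 2] by (auto simp: fact_numeral power_divide)
qed

lemma finite_grid:
  fixes P :: "real set"
  assumes "finite P" "P \<noteq> {}"
  obtains n p where "strict_mono_on {..n::nat} p" "P = p ` {..n}"
proof
  let ?l = "sorted_list_of_set P"
  have len: "length ?l = card P" "card P > 0"
    using assms by (auto simp: card_gt_0_iff)
  show "strict_mono_on {..card P - 1} ((!) ?l)"
    using strict_sorted_list_of_set[of P] len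
    by (auto simp: strict_mono_on_def sorted_wrt_nth_less)
  have "{..card P - 1} = {..<length ?l}" using len by auto
  then show "P = (!) ?l ` {..card P - 1}"
    using assms set_conv_nth[of ?l] by (auto simp: image_def)
qed

text \<open>Both orders of the two grid points are covered: the difference of the
  \<open>of_bool\<close> terms is the signed indicator of the indices between them.\<close>

lemma grid_telescope:
  fixes f :: "nat \<Rightarrow> 'a::ring_1"
  assumes "k \<le> n" "m \<le> n"
  shows "f k - f m = (\<Sum>i<n. (of_bool (i < k) - of_bool (i < m)) * (f (Suc i) - f i))"
proof -
  have s: "(\<Sum>i<n. of_bool (i < k) * (f (Suc i) - f i)) = f k - f 0" if "k \<le> n" for k
  proof -
    have "(\<Sum>i<n. of_bool (i < k) * (f (Suc i) - f i)) = (\<Sum>i<k. f (Suc i) - f i)"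
      using that by (intro sum.mono_neutral_cong_right) auto
    then show ?thesis by (simp add: sum_lessThan_telescope)
  qed
  show ?thesis
    using s[OF assms(1)] s[OF assms(2)] by (simp add: left_diff_distrib sum_subtractf)
qed

section \<open>Increments of a two-sided Brownian motion\<close>

locale two_sided_bm = prob_space M for M :: "'a measure" and B :: "real \<Rightarrow> 'a \<Rightarrow> real" +
  assumes bm: "two_sided_brownian_motion M B"
begin

lemma B_measurable [measurable]: "B t \<in> borel_measurable M"
  using bm by (auto simp: two_sided_brownian_motion_def)

lemma increment_normal:
  "s < t \<Longrightarrow> distributed M lborel (\<lambda>\<omega>. B t \<omega> - B s \<omega>) (normal_density 0 (sqrt (t - s)))"
  using bm by (auto simp: two_sided_brownian_motion_def)

lemma increments_indep:
  "strict_mono_on {..n::nat} p \<Longrightarrow>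
    indep_vars (\<lambda>_. borel) (\<lambda>i \<omega>. B (p (Suc i)) \<omega> - B (p i) \<omega>) {..<n}"
  using bm by (auto simp: two_sided_brownian_motion_def)

lemma increment_second_moment:
  "integrable M (\<lambda>\<omega>. (B t \<omega> - B s \<omega>)\<^sup>2)" "expectation (\<lambda>\<omega>. (B t \<omega> - B s \<omega>)\<^sup>2) = \<bar>t - s\<bar>"
proof -
  have *: "integrable M (\<lambda>\<omega>. (B t \<omega> - B s \<omega>)\<^sup>2) \<and> expectation (\<lambda>\<omega>. (B t \<omega> - B s \<omega>)\<^sup>2) = t - s"
    if "s < t" for s t
    using centered_normal_moments(1,2)[OF increment_normal[OF that]] that by auto
  have "integrable M (\<lambda>\<omega>. (B t \<omega> - B s \<omega>)\<^sup>2) \<and> expectation (\<lambda>\<omega>. (B t \<omega> - B s \<omega>)\<^sup>2) = \<bar>t - s\<bar>"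
    using *[of s t] *[of t s]
    by (cases s t rule: linorder_cases) (auto simp: power2_commute[of "B s _"])
  then show "integrable M (\<lambda>\<omega>. (B t \<omega> - B s \<omega>)\<^sup>2)"
    "expectation (\<lambda>\<omega>. (B t \<omega> - B s \<omega>)\<^sup>2) = \<bar>t - s\<bar>" by auto
qed

text \<open>Independent normal increments sum to a centred normal variable, whose fourth moment is
  three times its squared variance. The variance stays an expectation here;
  \<open>bm_combination_isometry\<close> evaluates it later.\<close>

lemma increment_combination_moments:
  fixes d :: "nat \<Rightarrow> real"
  assumes p: "strict_mono_on {..n::nat} p"
  defines "X \<equiv> \<lambda>\<omega>. \<Sum>i<n. d i * (B (p (Suc i)) \<omega> - B (p i) \<omega>)"
  shows "integrable M (\<lambda>\<omega>. X \<omega> ^ 4)"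
    "expectation (\<lambda>\<omega>. X \<omega> ^ 4) = 3 * (expectation (\<lambda>\<omega>. X \<omega> ^ 2))\<^sup>2"
proof -
  \<comment> \<open>Zero coefficients are dropped because the normal laws that are added must have
    positive standard deviation. If no index remains, both moments vanish.\<close>
  define I where "I = {i\<in>{..<n}. d i \<noteq> 0}"
  have XI: "X = (\<lambda>\<omega>. \<Sum>i\<in>I. d i * (B (p (Suc i)) \<omega> - B (p i) \<omega>))"
    unfolding X_def I_def by (intro ext sum.mono_neutral_cong_right) auto
  have "integrable M (\<lambda>\<omega>. X \<omega> ^ 4) \<and>
    expectation (\<lambda>\<omega>. X \<omega> ^ 4) = 3 * (expectation (\<lambda>\<omega>. X \<omega> ^ 2))\<^sup>2"
  proof (cases "I = {}")
    case True
    then show ?thesis by (simp add: XI)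
  next
    case False
    have less: "p i < p (Suc i)" if "i \<in> I" for i
      using that p by (auto simp: strict_mono_on_def I_def)
    let ?\<sigma> = "\<lambda>i. \<bar>d i\<bar> * sqrt (p (Suc i) - p i)"
    have \<sigma>: "0 < ?\<sigma> i" if "i \<in> I" for i
      using less[OF that] that by (auto simp: I_def)
    have "indep_vars (\<lambda>_. borel) (\<lambda>i \<omega>. B (p (Suc i)) \<omega> - B (p i) \<omega>) I"
      using increments_indep[OF p] by (rule indep_vars_subset) (auto simp: I_def)
    from indep_vars_compose2[OF this, of "\<lambda>i x. d i * x" "\<lambda>_. borel"]
    have ind: "indep_vars (\<lambda>_. borel) (\<lambda>i \<omega>. d i * (B (p (Suc i)) \<omega> - B (p i) \<omega>)) I"
      by simp
    have "distributed M lborel X (normal_density (\<Sum>i\<in>I. 0) (sqrt (\<Sum>i\<in>I. (?\<sigma> i)\<^sup>2)))"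
      unfolding XI
    proof (rule sum_indep_normal[OF _ False ind \<sigma>])
      fix i assume i: "i \<in> I"
      show "distributed M lborel (\<lambda>\<omega>. d i * (B (p (Suc i)) \<omega> - B (p i) \<omega>))
          (normal_density 0 (?\<sigma> i))"
        using normal_density_affine[OF increment_normal[OF less[OF i]], of "d i" 0] less[OF i] i
        by (simp add: I_def)
    qed (simp add: I_def)
    moreover have "0 < (\<Sum>i\<in>I. (?\<sigma> i)\<^sup>2)"
    proof (rule sum_pos)
      show "0 < (?\<sigma> i)\<^sup>2" if "i \<in> I" for i
        by (rule zero_less_power[OF \<sigma>[OF that]])
    qed (use False in \<open>auto simp: I_def\<close>)
    ultimately show ?thesis
      using centered_normal_moments[of X "sqrt (\<Sum>i\<in>I. (?\<sigma> i)\<^sup>2)"] by simp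
  qed
  then show "integrable M (\<lambda>\<omega>. X \<omega> ^ 4)"
    "expectation (\<lambda>\<omega>. X \<omega> ^ 4) = 3 * (expectation (\<lambda>\<omega>. X \<omega> ^ 2))\<^sup>2" by auto
qed

end

text \<open>Combinations are indexed by times rather than by a grid, so that a sum of two only needs
  the union of two finite sets. Increments from time 0 replace \<open>B t\<close>, since
  \<open>B 0\<close> vanishes only almost surely.\<close>

definition bm_combination ::
    "(real \<Rightarrow> 'a \<Rightarrow> real) \<Rightarrow> real set \<Rightarrow> (real \<Rightarrow> real) \<Rightarrow> 'a \<Rightarrow> real" where
  "bm_combination B F c \<omega> = (\<Sum>t\<in>F. c t * (B t \<omega> - B 0 \<omega>))"

text \<open>The deterministic integrand of \<open>B t - B 0\<close>: the interval between 0 and t,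
  with a minus sign for negative t.\<close>

definition signed_interval :: "real \<Rightarrow> real \<Rightarrow> real" where
  "signed_interval t x = indicator {0<..t} x - indicator {t<..0} x"

definition step_combination :: "real set \<Rightarrow> (real \<Rightarrow> real) \<Rightarrow> real \<Rightarrow> real" where
  "step_combination F c x = (\<Sum>t\<in>F. c t * signed_interval t x)"

lemma signed_interval_measurable [measurable]: "signed_interval t \<in> borel_measurable borel"
  unfolding signed_interval_def[abs_def] by simp

lemma step_combination_measurable [measurable]: "step_combination F c \<in> borel_measurable borel"
  unfolding step_combination_def[abs_def] by simp

lemma signed_interval_diff: "s \<le> t \<Longrightarrow> signed_interval t x - signed_interval s x = indicator {s<..t} x"
  by (auto simp: signed_interval_def indicator_def)

lemma emeasure_lborel_Ioc_max: "emeasure lborel {a<..b} = ennreal (max 0 (b - a))"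
  by (cases "a \<le> b") auto

text \<open>Signed intervals overlap only for times of the same sign, and then in the shorter
  interval. Its length is the covariance of a two-sided Brownian motion.\<close>

lemma signed_interval_inner:
  "integrable lborel (\<lambda>x. signed_interval t x * signed_interval u x)"
  "(LINT x|lborel. signed_interval t x * signed_interval u x) = (\<bar>t\<bar> + \<bar>u\<bar> - \<bar>t - u\<bar>) / 2"
proof -
  have eq: "signed_interval t x * signed_interval u x =
      indicator {0<..min t u} x + indicator {max t u<..0} x" for x
    by (auto simp: signed_interval_def indicator_def)
  show "integrable lborel (\<lambda>x. signed_interval t x * signed_interval u x)"
    unfolding eq by (intro Bochner_Integration.integrable_add) (auto simp: emeasure_lborel_Ioc_max)
  have "(LINT x|lborel. signed_interval t x * signed_interval u x) =
      measure lborel {0<..min t u} + measure lborel {max t u<..0}"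
    unfolding eq by (subst Bochner_Integration.integral_add) (auto simp: emeasure_lborel_Ioc_max)
  also have "\<dots> = (\<bar>t\<bar> + \<bar>u\<bar> - \<bar>t - u\<bar>) / 2"
    by (auto simp: measure_def emeasure_lborel_Ioc_max min_def max_def)
  finally show "(LINT x|lborel. signed_interval t x * signed_interval u x) =
      (\<bar>t\<bar> + \<bar>u\<bar> - \<bar>t - u\<bar>) / 2" .
qed

context two_sided_bm
begin

lemma bm_combination_measurable [measurable]: "bm_combination B F c \<in> borel_measurable M"
  unfolding bm_combination_def[abs_def] by simp

text \<open>All times and 0 are placed on one grid, which rewrites the combination in independent
  increments.\<close>

lemma bm_combination_fourth_moment:
  assumes "finite F"
  shows "integrable M (\<lambda>\<omega>. bm_combination B F c \<omega> ^ 4)"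
    "expectation (\<lambda>\<omega>. bm_combination B F c \<omega> ^ 4) =
      3 * (expectation (\<lambda>\<omega>. bm_combination B F c \<omega> ^ 2))\<^sup>2"
proof -
  obtain n p where p: "strict_mono_on {..n::nat} p" and P: "insert 0 F = p ` {..n}"
    using finite_grid[of "insert 0 F"] assms by auto
  have "\<forall>t\<in>insert 0 F. \<exists>i\<le>n. p i = t" unfolding P by auto
  then obtain k where k: "\<And>t. t \<in> insert 0 F \<Longrightarrow> k t \<le> n \<and> p (k t) = t" by metis
  define d where "d i = (\<Sum>t\<in>F. c t * (of_bool (i < k t) - of_bool (i < k 0)))" for i
  have eq: "bm_combination B F c = (\<lambda>\<omega>. \<Sum>i<n. d i * (B (p (Suc i)) \<omega> - B (p i) \<omega>))"
  proof
    fix \<omega>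
    have "bm_combination B F c \<omega> = (\<Sum>t\<in>F. c t * (B (p (k t)) \<omega> - B (p (k 0)) \<omega>))"
      unfolding bm_combination_def using k by (intro sum.cong) auto
    also have "\<dots> = (\<Sum>t\<in>F. \<Sum>i<n. c t * (of_bool (i < k t) - of_bool (i < k 0)) *
        (B (p (Suc i)) \<omega> - B (p i) \<omega>))"
    proof (rule sum.cong)
      fix t assume "t \<in> F"
      then show "c t * (B (p (k t)) \<omega> - B (p (k 0)) \<omega>) =
          (\<Sum>i<n. c t * (of_bool (i < k t) - of_bool (i < k 0)) * (B (p (Suc i)) \<omega> - B (p i) \<omega>))"
        using k[of t] k[of 0] grid_telescope[of "k t" n "k 0" "\<lambda>i. B (p i) \<omega>"]
        by (simp add: sum_distrib_left mult.assoc)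
    qed simp
    also have "\<dots> = (\<Sum>i<n. d i * (B (p (Suc i)) \<omega> - B (p i) \<omega>))"
      by (subst sum.swap) (simp add: d_def sum_distrib_right)
    finally show "bm_combination B F c \<omega> = (\<Sum>i<n. d i * (B (p (Suc i)) \<omega> - B (p i) \<omega>))" .
  qed
  show "integrable M (\<lambda>\<omega>. bm_combination B F c \<omega> ^ 4)"
    "expectation (\<lambda>\<omega>. bm_combination B F c \<omega> ^ 4) =
      3 * (expectation (\<lambda>\<omega>. bm_combination B F c \<omega> ^ 2))\<^sup>2"
    unfolding eq by (rule increment_combination_moments[OF p])+
qed

text \<open>Polarization through the increment between u and t reduces the covariance to variances
  of single increments, whatever the order and the signs of t and u.\<close>

lemma bm_covariance:
  "integrable M (\<lambda>\<omega>. (B t \<omega> - B 0 \<omega>) * (B u \<omega> - B 0 \<omega>))"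
  "expectation (\<lambda>\<omega>. (B t \<omega> - B 0 \<omega>) * (B u \<omega> - B 0 \<omega>)) = (\<bar>t\<bar> + \<bar>u\<bar> - \<bar>t - u\<bar>) / 2"
proof -
  have eq: "(B t \<omega> - B 0 \<omega>) * (B u \<omega> - B 0 \<omega>) =
      ((B t \<omega> - B 0 \<omega>)\<^sup>2 + (B u \<omega> - B 0 \<omega>)\<^sup>2 - (B t \<omega> - B u \<omega>)\<^sup>2) / 2" for \<omega>
    by (simp add: power2_eq_square algebra_simps)
  show "integrable M (\<lambda>\<omega>. (B t \<omega> - B 0 \<omega>) * (B u \<omega> - B 0 \<omega>))"
    unfolding eq by (intro integrable_divide Bochner_Integration.integrable_diff
      Bochner_Integration.integrable_add increment_second_moment)
  show "expectation (\<lambda>\<omega>. (B t \<omega> - B 0 \<omega>) * (B u \<omega> - B 0 \<omega>)) = (\<bar>t\<bar> + \<bar>u\<bar> - \<bar>t - u\<bar>) / 2"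
    unfolding eq by (simp add: increment_second_moment)
qed

lemma bm_combination_isometry:
  "integrable M (\<lambda>\<omega>. (bm_combination B F c \<omega>)\<^sup>2)"
  "integrable lborel (\<lambda>x. (step_combination F c x)\<^sup>2)"
  "expectation (\<lambda>\<omega>. (bm_combination B F c \<omega>)\<^sup>2) = (LINT x|lborel. (step_combination F c x)\<^sup>2)"
proof -
  have e1: "(bm_combination B F c \<omega>)\<^sup>2 =
      (\<Sum>t\<in>F. \<Sum>u\<in>F. c t * c u * ((B t \<omega> - B 0 \<omega>) * (B u \<omega> - B 0 \<omega>)))" for \<omega>
    by (simp add: bm_combination_def power2_eq_square sum_product ac_simps)
  have e2: "(step_combination F c x)\<^sup>2 =
      (\<Sum>t\<in>F. \<Sum>u\<in>F. c t * c u * (signed_interval t x * signed_interval u x))" for x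
    by (simp add: step_combination_def power2_eq_square sum_product ac_simps)
  show "integrable M (\<lambda>\<omega>. (bm_combination B F c \<omega>)\<^sup>2)"
    unfolding e1 by (intro Bochner_Integration.integrable_sum integrable_mult_right bm_covariance)
  show "integrable lborel (\<lambda>x. (step_combination F c x)\<^sup>2)"
    unfolding e2
    by (intro Bochner_Integration.integrable_sum integrable_mult_right signed_interval_inner)
  show "expectation (\<lambda>\<omega>. (bm_combination B F c \<omega>)\<^sup>2) = (LINT x|lborel. (step_combination F c x)\<^sup>2)"
    unfolding e1 e2
    by (simp add: Bochner_Integration.integral_sum Bochner_Integration.integrable_sum
        bm_covariance signed_interval_inner)
qed

end

section \<open>Wiener integrals\<close>

lemma integrable_mult_of_squares:
  fixes f g :: "'a \<Rightarrow> real"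
  assumes [measurable]: "f \<in> borel_measurable M" "g \<in> borel_measurable M"
    and "integrable M (\<lambda>x. (f x)\<^sup>2)" "integrable M (\<lambda>x. (g x)\<^sup>2)"
  shows "integrable M (\<lambda>x. f x * g x)"
proof (rule Bochner_Integration.integrable_bound)
  show "integrable M (\<lambda>x. (f x)\<^sup>2 + (g x)\<^sup>2)" using assms by simp
  have "\<bar>f x * g x\<bar> \<le> (f x)\<^sup>2 + (g x)\<^sup>2" for x
  proof -
    have "2 * (\<bar>f x\<bar> * \<bar>g x\<bar>) \<le> (f x)\<^sup>2 + (g x)\<^sup>2"
      using sum_squares_bound[of "\<bar>f x\<bar>" "\<bar>g x\<bar>"] by (simp add: mult.assoc)
    moreover have "0 \<le> \<bar>f x\<bar> * \<bar>g x\<bar>" by simp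
    ultimately show ?thesis unfolding abs_mult by linarith
  qed
  then show "AE x in M. norm (f x * g x) \<le> norm ((f x)\<^sup>2 + (g x)\<^sup>2)" by simp
qed measurable

lemma integral_Cauchy_Schwarz:
  fixes f g :: "'a \<Rightarrow> real"
  assumes [measurable]: "f \<in> borel_measurable M" "g \<in> borel_measurable M"
    and f2: "integrable M (\<lambda>x. (f x)\<^sup>2)" and g2: "integrable M (\<lambda>x. (g x)\<^sup>2)"
  shows "(LINT x|M. f x * g x)\<^sup>2 \<le> (LINT x|M. (f x)\<^sup>2) * (LINT x|M. (g x)\<^sup>2)"
proof -
  have fg: "integrable M (\<lambda>x. f x * g x)" by (rule integrable_mult_of_squares) fact+
  have "ennreal \<bar>LINT x|M. f x * g x\<bar> \<le> (\<integral>\<^sup>+x. norm (f x * g x) \<partial>M)"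
    using integral_norm_bound_ennreal[OF fg] by simp
  also have "\<dots> = (\<integral>\<^sup>+x. ennreal \<bar>f x\<bar> * ennreal \<bar>g x\<bar> \<partial>M)"
    by (intro nn_integral_cong) (simp add: abs_mult ennreal_mult)
  finally have "(ennreal \<bar>LINT x|M. f x * g x\<bar>)\<^sup>2 \<le> (\<integral>\<^sup>+x. ennreal \<bar>f x\<bar> * ennreal \<bar>g x\<bar> \<partial>M)\<^sup>2"
    by (rule power_mono) simp
  also have "\<dots> \<le> (\<integral>\<^sup>+x. (ennreal \<bar>f x\<bar>)\<^sup>2 \<partial>M) * (\<integral>\<^sup>+x. (ennreal \<bar>g x\<bar>)\<^sup>2 \<partial>M)"
    by (rule Cauchy_Schwarz_nn_integral) measurable
  also have "\<dots> = ennreal ((LINT x|M. (f x)\<^sup>2) * (LINT x|M. (g x)\<^sup>2))"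
    using nn_integral_eq_integral[OF f2] nn_integral_eq_integral[OF g2]
    by (simp add: ennreal_power ennreal_mult)
  finally show ?thesis
    by (simp add: ennreal_power)
qed

text \<open>One approximant at squared distance below 1 gives square integrability of f. The squared
  norms converge because Cauchy-Schwarz bounds the mixed term with f.\<close>

lemma L2_limit:
  fixes f :: "'a \<Rightarrow> real"
  assumes [measurable]: "f \<in> borel_measurable M" "\<And>n. F n \<in> borel_measurable M"
    and F2: "\<And>n. integrable M (\<lambda>x. (F n x)\<^sup>2)"
    and lim: "(\<lambda>n. \<integral>\<^sup>+x. ennreal ((f x - F n x)\<^sup>2) \<partial>M) \<longlonglongrightarrow> 0"
  shows "integrable M (\<lambda>x. (f x)\<^sup>2)"
    and "integrable M (\<lambda>x. (f x - F n x)\<^sup>2)"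
    and "(\<lambda>n. LINT x|M. (f x - F n x)\<^sup>2) \<longlonglongrightarrow> 0"
    and "(\<lambda>n. LINT x|M. (F n x)\<^sup>2) \<longlonglongrightarrow> (LINT x|M. (f x)\<^sup>2)"
proof -
  have "eventually (\<lambda>n. (\<integral>\<^sup>+x. ennreal ((f x - F n x)\<^sup>2) \<partial>M) < 1) sequentially"
    using order_tendstoD(2)[OF lim, of 1] by simp
  then obtain m where m: "(\<integral>\<^sup>+x. ennreal ((f x - F m x)\<^sup>2) \<partial>M) < 1"
    by (auto simp: eventually_sequentially)
  then have "(\<integral>\<^sup>+x. ennreal (norm ((f x - F m x)\<^sup>2)) \<partial>M) < \<infinity>"
    by (simp add: less_trans[OF _ ennreal_one_less_top])
  then have im: "integrable M (\<lambda>x. (f x - F m x)\<^sup>2)"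
    by (intro integrableI_bounded) auto
  show f2: "integrable M (\<lambda>x. (f x)\<^sup>2)"
  proof (rule Bochner_Integration.integrable_bound)
    show "integrable M (\<lambda>x. 2 * (f x - F m x)\<^sup>2 + 2 * (F m x)\<^sup>2)" using im F2 by simp
    have "(f x)\<^sup>2 \<le> 2 * (f x - F m x)\<^sup>2 + 2 * (F m x)\<^sup>2" for x
      using sum_squares_bound[of "f x - F m x" "F m x"] power2_sum[of "f x - F m x" "F m x"] by simp
    then show "AE x in M. norm ((f x)\<^sup>2) \<le> norm (2 * (f x - F m x)\<^sup>2 + 2 * (F m x)\<^sup>2)"
      by (simp add: order_trans[OF _ abs_ge_self])
  qed measurable
  have fF: "integrable M (\<lambda>x. f x * F n x)" for n
    by (rule integrable_mult_of_squares) (auto simp: f2 F2)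
  have d: "integrable M (\<lambda>x. (f x - F n x)\<^sup>2)" for n
    unfolding power2_diff using f2 F2 fF by (simp add: mult.assoc)
  then show "integrable M (\<lambda>x. (f x - F n x)\<^sup>2)" .
  have "(\<lambda>n. ennreal (LINT x|M. (f x - F n x)\<^sup>2)) \<longlonglongrightarrow> ennreal 0"
    using lim by (simp add: nn_integral_eq_integral[OF d])
  then show d0: "(\<lambda>n. LINT x|M. (f x - F n x)\<^sup>2) \<longlonglongrightarrow> 0"
    by (subst (asm) tendsto_ennreal_iff) auto
  have eq: "(LINT x|M. (F n x)\<^sup>2) =
      (LINT x|M. (f x)\<^sup>2) - 2 * (LINT x|M. f x * (f x - F n x)) + (LINT x|M. (f x - F n x)\<^sup>2)" for n
  proof -
    have i: "integrable M (\<lambda>x. f x * (f x - F n x))"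
      by (rule integrable_mult_of_squares) (auto simp: f2 d)
    have "(LINT x|M. (F n x)\<^sup>2) = (LINT x|M. (f x)\<^sup>2 - 2 * (f x * (f x - F n x)) + (f x - F n x)\<^sup>2)"
      by (intro Bochner_Integration.integral_cong) (auto simp: power2_eq_square algebra_simps)
    then show ?thesis using f2 i d by simp
  qed
  have "(\<lambda>n. (LINT x|M. f x * (f x - F n x))\<^sup>2) \<longlonglongrightarrow> 0"
  proof (rule tendsto_sandwich[OF _ _ tendsto_const])
    show "(\<lambda>n. (LINT x|M. (f x)\<^sup>2) * (LINT x|M. (f x - F n x)\<^sup>2)) \<longlonglongrightarrow> 0"
      using tendsto_mult_right_zero[OF d0] by simp
    show "\<forall>\<^sub>F n in sequentially. (LINT x|M. f x * (f x - F n x))\<^sup>2 \<le>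
        (LINT x|M. (f x)\<^sup>2) * (LINT x|M. (f x - F n x)\<^sup>2)"
      by (intro always_eventually allI integral_Cauchy_Schwarz) (auto simp: f2 d)
  qed auto
  from tendsto_real_sqrt[OF this] have "(\<lambda>n. LINT x|M. f x * (f x - F n x)) \<longlonglongrightarrow> 0"
    by (simp add: tendsto_rabs_zero_iff)
  then have "(\<lambda>n. (LINT x|M. (f x)\<^sup>2) - 2 * (LINT x|M. f x * (f x - F n x)) + (LINT x|M. (f x - F n x)\<^sup>2))
      \<longlonglongrightarrow> (LINT x|M. (f x)\<^sup>2) - 2 * 0 + 0"
    by (intro tendsto_intros d0)
  then show "(\<lambda>n. LINT x|M. (F n x)\<^sup>2) \<longlonglongrightarrow> (LINT x|M. (f x)\<^sup>2)"
    by (simp add: eq)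
qed

lemma L2_limit_linear:
  fixes f g :: "'a \<Rightarrow> real"
  assumes [measurable]: "f \<in> borel_measurable M" "\<And>n. F n \<in> borel_measurable M"
    "g \<in> borel_measurable M" "\<And>n. G n \<in> borel_measurable M"
    and f: "(\<lambda>n. \<integral>\<^sup>+x. ennreal ((f x - F n x)\<^sup>2) \<partial>M) \<longlonglongrightarrow> 0"
    and g: "(\<lambda>n. \<integral>\<^sup>+x. ennreal ((g x - G n x)\<^sup>2) \<partial>M) \<longlonglongrightarrow> 0"
  shows "(\<lambda>n. \<integral>\<^sup>+x. ennreal ((a * f x + b * g x - (a * F n x + b * G n x))\<^sup>2) \<partial>M) \<longlonglongrightarrow> 0"
proof (rule tendsto_sandwich[OF _ _ tendsto_const])
  let ?u = "\<lambda>n. ennreal (2 * a\<^sup>2) * (\<integral>\<^sup>+x. ennreal ((f x - F n x)\<^sup>2) \<partial>M)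
      + ennreal (2 * b\<^sup>2) * (\<integral>\<^sup>+x. ennreal ((g x - G n x)\<^sup>2) \<partial>M)"
  have "?u \<longlonglongrightarrow> ennreal (2 * a\<^sup>2) * 0 + ennreal (2 * b\<^sup>2) * 0"
    by (intro tendsto_add ennreal_tendsto_cmult f g) auto
  then show "?u \<longlonglongrightarrow> 0" by simp
  have "(\<integral>\<^sup>+x. ennreal ((a * f x + b * g x - (a * F n x + b * G n x))\<^sup>2) \<partial>M) \<le> ?u n" for n
  proof -
    have "(\<integral>\<^sup>+x. ennreal ((a * f x + b * g x - (a * F n x + b * G n x))\<^sup>2) \<partial>M) \<le>
      (\<integral>\<^sup>+x. ennreal (2 * a\<^sup>2) * ennreal ((f x - F n x)\<^sup>2) + ennreal (2 * b\<^sup>2) * ennreal ((g x - G n x)\<^sup>2) \<partial>M)"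
    proof (rule nn_integral_mono)
      fix x
      have "(a * f x + b * g x - (a * F n x + b * G n x))\<^sup>2 =
          (a * (f x - F n x) + b * (g x - G n x))\<^sup>2" by (simp add: algebra_simps)
      also have "\<dots> \<le> 2 * (a * (f x - F n x))\<^sup>2 + 2 * (b * (g x - G n x))\<^sup>2"
        using sum_squares_bound[of "a * (f x - F n x)" "b * (g x - G n x)"]
          power2_sum[of "a * (f x - F n x)" "b * (g x - G n x)"] by simp
      finally show "ennreal ((a * f x + b * g x - (a * F n x + b * G n x))\<^sup>2) \<le>
          ennreal (2 * a\<^sup>2) * ennreal ((f x - F n x)\<^sup>2) + ennreal (2 * b\<^sup>2) * ennreal ((g x - G n x)\<^sup>2)"
        by (simp add: power_mult_distrib mult.assoc ennreal_leI flip: ennreal_mult ennreal_plus)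
    qed
    also have "\<dots> = ?u n" by (simp add: nn_integral_add nn_integral_cmult)
    finally show ?thesis .
  qed
  then show "\<forall>\<^sub>F n in sequentially.
      (\<integral>\<^sup>+x. ennreal ((a * f x + b * g x - (a * F n x + b * G n x))\<^sup>2) \<partial>M) \<le> ?u n" by simp
qed auto

lemma L2_limit_AE_subseq:
  fixes f :: "'a \<Rightarrow> real"
  assumes [measurable]: "f \<in> borel_measurable M" "\<And>n. F n \<in> borel_measurable M"
    and F2: "\<And>n. integrable M (\<lambda>x. (F n x)\<^sup>2)"
    and lim: "(\<lambda>n. \<integral>\<^sup>+x. ennreal ((f x - F n x)\<^sup>2) \<partial>M) \<longlonglongrightarrow> 0"
  obtains r where "strict_mono (r :: nat \<Rightarrow> nat)" "AE x in M. (\<lambda>n. F (r n) x) \<longlonglongrightarrow> f x"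
proof -
  note L = L2_limit[OF assms]
  have "(\<lambda>n. LINT x|M. norm ((f x - F n x)\<^sup>2)) \<longlonglongrightarrow> 0" using L(3) by simp
  from tendsto_L1_AE_subseq[OF L(2) this] obtain r where r: "strict_mono (r :: nat \<Rightarrow> nat)"
    and *: "AE x in M. (\<lambda>n. (f x - F (r n) x)\<^sup>2) \<longlonglongrightarrow> 0" by blast
  from * have "AE x in M. (\<lambda>n. F (r n) x) \<longlonglongrightarrow> f x"
  proof eventually_elim
    case (elim x)
    from tendsto_real_sqrt[OF this] have "(\<lambda>n. f x - F (r n) x) \<longlonglongrightarrow> 0"
      by (simp add: tendsto_rabs_zero_iff)
    from tendsto_diff[OF tendsto_const[of "f x"] this] show ?case by simp
  qed
  with r that show ?thesis by blast
qed

lemma bm_combination_linear: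
  assumes "finite F" "finite G"
  shows "a * bm_combination B F c \<omega> + b * bm_combination B G d \<omega> =
    bm_combination B (F \<union> G) (\<lambda>t. a * (if t \<in> F then c t else 0) + b * (if t \<in> G then d t else 0)) \<omega>"
proof -
  have 1: "bm_combination B F c \<omega> = bm_combination B (F \<union> G) (\<lambda>t. if t \<in> F then c t else 0) \<omega>"
    unfolding bm_combination_def using assms by (intro sum.mono_neutral_cong_left) auto
  have 2: "bm_combination B G d \<omega> = bm_combination B (F \<union> G) (\<lambda>t. if t \<in> G then d t else 0) \<omega>"
    unfolding bm_combination_def using assms by (intro sum.mono_neutral_cong_left) auto
  show ?thesis
    unfolding 1 2 unfolding bm_combination_def
    by (simp add: sum_distrib_left distrib_right sum.distrib mult.assoc)
qed

lemma step_combination_linear: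
  assumes "finite F" "finite G"
  shows "a * step_combination F c x + b * step_combination G d x =
    step_combination (F \<union> G) (\<lambda>t. a * (if t \<in> F then c t else 0) + b * (if t \<in> G then d t else 0)) x"
proof -
  have 1: "step_combination F c x = step_combination (F \<union> G) (\<lambda>t. if t \<in> F then c t else 0) x"
    unfolding step_combination_def using assms by (intro sum.mono_neutral_cong_left) auto
  have 2: "step_combination G d x = step_combination (F \<union> G) (\<lambda>t. if t \<in> G then d t else 0) x"
    unfolding step_combination_def using assms by (intro sum.mono_neutral_cong_left) auto
  show ?thesis
    unfolding 1 2 unfolding step_combination_def
    by (simp add: sum_distrib_left distrib_right sum.distrib mult.assoc)
qed

context two_sided_bm
begin

text \<open>
  \<open>wiener f X\<close>: \<open>X\<close> is a version of the Wiener integral of \<open>f\<close>. It is the closure of the pairs that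
  match \<open>B t - B 0\<close> with the signed indicator of the interval between \<open>0\<close> and \<open>t\<close>.
\<close>

definition wiener :: "(real \<Rightarrow> real) \<Rightarrow> ('a \<Rightarrow> real) \<Rightarrow> bool" where
  "wiener f X \<longleftrightarrow> f \<in> borel_measurable borel \<and> X \<in> borel_measurable M \<and>
     (\<exists>F c. (\<forall>n::nat. finite (F n)) \<and>
       (\<lambda>n. \<integral>\<^sup>+x. ennreal ((f x - step_combination (F n) (c n) x)\<^sup>2) \<partial>lborel) \<longlonglongrightarrow> 0 \<and>
       (\<lambda>n. \<integral>\<^sup>+\<omega>. ennreal ((X \<omega> - bm_combination B (F n) (c n) \<omega>)\<^sup>2) \<partial>M) \<longlonglongrightarrow> 0)"

lemma wienerE:
  assumes "wiener f X"
  obtains F c where "f \<in> borel_measurable borel" "X \<in> borel_measurable M" "\<forall>n::nat. finite (F n)"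
    "(\<lambda>n. \<integral>\<^sup>+x. ennreal ((f x - step_combination (F n) (c n) x)\<^sup>2) \<partial>lborel) \<longlonglongrightarrow> 0"
    "(\<lambda>n. \<integral>\<^sup>+\<omega>. ennreal ((X \<omega> - bm_combination B (F n) (c n) \<omega>)\<^sup>2) \<partial>M) \<longlonglongrightarrow> 0"
  using assms unfolding wiener_def by blast

lemma wiener_measurable:
  "wiener f X \<Longrightarrow> f \<in> borel_measurable borel" "wiener f X \<Longrightarrow> X \<in> borel_measurable M"
  unfolding wiener_def by auto

lemma wiener_step: "finite F \<Longrightarrow> wiener (step_combination F c) (bm_combination B F c)"
  unfolding wiener_def
  by (auto intro!: exI[of _ "\<lambda>_. F"] exI[of _ "\<lambda>_. c"])

lemma wiener_linear:
  assumes "wiener f X" "wiener g Y"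
  shows "wiener (\<lambda>x. a * f x + b * g x) (\<lambda>\<omega>. a * X \<omega> + b * Y \<omega>)"
proof -
  obtain F c where [measurable]: "f \<in> borel_measurable borel" "X \<in> borel_measurable M"
    and F0: "\<forall>n::nat. finite (F n)"
    and f: "(\<lambda>n. \<integral>\<^sup>+x. ennreal ((f x - step_combination (F n) (c n) x)\<^sup>2) \<partial>lborel) \<longlonglongrightarrow> 0"
    and X: "(\<lambda>n. \<integral>\<^sup>+\<omega>. ennreal ((X \<omega> - bm_combination B (F n) (c n) \<omega>)\<^sup>2) \<partial>M) \<longlonglongrightarrow> 0"
    by (rule wienerE[OF assms(1)])
  note F = spec[OF F0]
  obtain G d where [measurable]: "g \<in> borel_measurable borel" "Y \<in> borel_measurable M"
    and G0: "\<forall>n::nat. finite (G n)"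
    and g: "(\<lambda>n. \<integral>\<^sup>+x. ennreal ((g x - step_combination (G n) (d n) x)\<^sup>2) \<partial>lborel) \<longlonglongrightarrow> 0"
    and Y: "(\<lambda>n. \<integral>\<^sup>+\<omega>. ennreal ((Y \<omega> - bm_combination B (G n) (d n) \<omega>)\<^sup>2) \<partial>M) \<longlonglongrightarrow> 0"
    by (rule wienerE[OF assms(2)])
  note G = spec[OF G0]
  have "(\<lambda>n. \<integral>\<^sup>+x. ennreal ((a * f x + b * g x
      - (a * step_combination (F n) (c n) x + b * step_combination (G n) (d n) x))\<^sup>2) \<partial>lborel) \<longlonglongrightarrow> 0"
    by (rule L2_limit_linear[OF _ _ _ _ f g]) auto
  moreover have "(\<lambda>n. \<integral>\<^sup>+\<omega>. ennreal ((a * X \<omega> + b * Y \<omega>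
      - (a * bm_combination B (F n) (c n) \<omega> + b * bm_combination B (G n) (d n) \<omega>))\<^sup>2) \<partial>M) \<longlonglongrightarrow> 0"
    by (rule L2_limit_linear[OF _ _ _ _ X Y]) auto
  ultimately show ?thesis
    unfolding wiener_def bm_combination_linear[OF F G] step_combination_linear[OF F G]
    using F G
    by (intro conjI exI[of _ "\<lambda>n. F n \<union> G n"]
        exI[of _ "\<lambda>n t. a * (if t \<in> F n then c n t else 0) + b * (if t \<in> G n then d n t else 0)"]) auto
qed

lemma wiener_add: "wiener f X \<Longrightarrow> wiener g Y \<Longrightarrow> wiener (\<lambda>x. f x + g x) (\<lambda>\<omega>. X \<omega> + Y \<omega>)"
  using wiener_linear[of f X g Y 1 1] by simp

lemma wiener_diff: "wiener f X \<Longrightarrow> wiener g Y \<Longrightarrow> wiener (\<lambda>x. f x - g x) (\<lambda>\<omega>. X \<omega> - Y \<omega>)"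
  using wiener_linear[of f X g Y 1 "- 1"] by simp

lemma wiener_isometry:
  assumes "wiener f X"
  shows "integrable lborel (\<lambda>x. (f x)\<^sup>2)" "integrable M (\<lambda>\<omega>. (X \<omega>)\<^sup>2)"
    "expectation (\<lambda>\<omega>. (X \<omega>)\<^sup>2) = (LINT x|lborel. (f x)\<^sup>2)"
proof -
  obtain F c where [measurable]: "f \<in> borel_measurable borel" "X \<in> borel_measurable M"
    and F0: "\<forall>n::nat. finite (F n)"
    and f: "(\<lambda>n. \<integral>\<^sup>+x. ennreal ((f x - step_combination (F n) (c n) x)\<^sup>2) \<partial>lborel) \<longlonglongrightarrow> 0"
    and X: "(\<lambda>n. \<integral>\<^sup>+\<omega>. ennreal ((X \<omega> - bm_combination B (F n) (c n) \<omega>)\<^sup>2) \<partial>M) \<longlonglongrightarrow> 0"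
    by (rule wienerE[OF assms(1)])
  note F = spec[OF F0]
  have a: "(\<lambda>n. LINT x|lborel. (step_combination (F n) (c n) x)\<^sup>2) \<longlonglongrightarrow> (LINT x|lborel. (f x)\<^sup>2)"
    and "integrable lborel (\<lambda>x. (f x)\<^sup>2)"
    using L2_limit(1,4)[OF _ _ _ f] bm_combination_isometry(2) by auto
  have b: "(\<lambda>n. expectation (\<lambda>\<omega>. (bm_combination B (F n) (c n) \<omega>)\<^sup>2)) \<longlonglongrightarrow> expectation (\<lambda>\<omega>. (X \<omega>)\<^sup>2)"
    and "integrable M (\<lambda>\<omega>. (X \<omega>)\<^sup>2)"
    using L2_limit(1,4)[OF _ _ _ X] bm_combination_isometry(1) by auto
  show "integrable lborel (\<lambda>x. (f x)\<^sup>2)" "integrable M (\<lambda>\<omega>. (X \<omega>)\<^sup>2)" by fact+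
  show "expectation (\<lambda>\<omega>. (X \<omega>)\<^sup>2) = (LINT x|lborel. (f x)\<^sup>2)"
    using b LIMSEQ_unique[OF _ a] by (simp add: bm_combination_isometry(3))
qed

text \<open>Fatou's lemma along an almost surely convergent subsequence. This one-sided bound
  supplies the control from which the exact fourth moment is then derived.\<close>

lemma wiener_fourth_moment_le:
  assumes "wiener f X"
  shows "integrable M (\<lambda>\<omega>. (X \<omega>) ^ 4)"
    "expectation (\<lambda>\<omega>. (X \<omega>) ^ 4) \<le> 3 * (expectation (\<lambda>\<omega>. (X \<omega>)\<^sup>2))\<^sup>2"
proof -
  obtain F c where [measurable]: "f \<in> borel_measurable borel" "X \<in> borel_measurable M"
    and F0: "\<forall>n::nat. finite (F n)"
    and "(\<lambda>n. \<integral>\<^sup>+x. ennreal ((f x - step_combination (F n) (c n) x)\<^sup>2) \<partial>lborel) \<longlonglongrightarrow> 0"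
    and X: "(\<lambda>n. \<integral>\<^sup>+\<omega>. ennreal ((X \<omega> - bm_combination B (F n) (c n) \<omega>)\<^sup>2) \<partial>M) \<longlonglongrightarrow> 0"
    by (rule wienerE[OF assms(1)])
  note F = spec[OF F0]
  define Y where "Y n = bm_combination B (F n) (c n)" for n
  have [measurable]: "Y n \<in> borel_measurable M" for n by (simp add: Y_def)
  have Y2: "integrable M (\<lambda>\<omega>. (Y n \<omega>)\<^sup>2)" for n
    unfolding Y_def by (rule bm_combination_isometry)
  obtain r where r: "strict_mono (r :: nat \<Rightarrow> nat)" "AE \<omega> in M. (\<lambda>n. Y (r n) \<omega>) \<longlonglongrightarrow> X \<omega>"
    using L2_limit_AE_subseq[OF _ _ Y2 X[folded Y_def]] by auto
  have lim: "(\<lambda>n. expectation (\<lambda>\<omega>. (Y n \<omega>)\<^sup>2)) \<longlonglongrightarrow> expectation (\<lambda>\<omega>. (X \<omega>)\<^sup>2)"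
    using L2_limit(4)[OF _ _ Y2 X[folded Y_def]] by auto
  have "(\<lambda>n. expectation (\<lambda>\<omega>. (Y (r n) \<omega>)\<^sup>2)) \<longlonglongrightarrow> expectation (\<lambda>\<omega>. (X \<omega>)\<^sup>2)"
    using LIMSEQ_subseq_LIMSEQ[OF lim r(1)] by (simp add: o_def)
  then have lim': "(\<lambda>n. ennreal (3 * (expectation (\<lambda>\<omega>. (Y (r n) \<omega>)\<^sup>2))\<^sup>2)) \<longlonglongrightarrow>
      ennreal (3 * (expectation (\<lambda>\<omega>. (X \<omega>)\<^sup>2))\<^sup>2)"
    by (intro tendsto_intros)
  have "(\<integral>\<^sup>+\<omega>. ennreal (X \<omega> ^ 4) \<partial>M) = (\<integral>\<^sup>+\<omega>. liminf (\<lambda>n. ennreal (Y (r n) \<omega> ^ 4)) \<partial>M)"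
  proof (rule nn_integral_cong_AE)
    from r(2) show "AE \<omega> in M. ennreal (X \<omega> ^ 4) = liminf (\<lambda>n. ennreal (Y (r n) \<omega> ^ 4))"
    proof eventually_elim
      case (elim \<omega>)
      then have "(\<lambda>n. ennreal (Y (r n) \<omega> ^ 4)) \<longlonglongrightarrow> ennreal (X \<omega> ^ 4)"
        by (intro tendsto_intros)
      then show ?case by (intro lim_imp_Liminf[symmetric]) auto
    qed
  qed
  also have "\<dots> \<le> liminf (\<lambda>n. \<integral>\<^sup>+\<omega>. ennreal (Y (r n) \<omega> ^ 4) \<partial>M)"
    by (rule nn_integral_liminf) measurable
  also have "(\<lambda>n. \<integral>\<^sup>+\<omega>. ennreal (Y (r n) \<omega> ^ 4) \<partial>M) =
      (\<lambda>n. ennreal (3 * (expectation (\<lambda>\<omega>. (Y (r n) \<omega>)\<^sup>2))\<^sup>2))"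
    using bm_combination_fourth_moment[OF F]
    by (intro ext) (simp add: nn_integral_eq_integral Y_def)
  also have "liminf \<dots> = ennreal (3 * (expectation (\<lambda>\<omega>. (X \<omega>)\<^sup>2))\<^sup>2)"
    by (rule lim_imp_Liminf[OF _ lim']) auto
  finally have le: "(\<integral>\<^sup>+\<omega>. ennreal (X \<omega> ^ 4) \<partial>M) \<le> ennreal (3 * (expectation (\<lambda>\<omega>. (X \<omega>)\<^sup>2))\<^sup>2)" .
  show i: "integrable M (\<lambda>\<omega>. (X \<omega>) ^ 4)"
    by (intro integrableI_bounded) (auto intro: le_less_trans[OF le])
  show "expectation (\<lambda>\<omega>. (X \<omega>) ^ 4) \<le> 3 * (expectation (\<lambda>\<omega>. (X \<omega>)\<^sup>2))\<^sup>2"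
    using le by (simp add: nn_integral_eq_integral[OF i])
qed

text \<open>X^2 - Y_n^2 is the product of X - Y_n and X + Y_n. Both factors are Wiener integrals, so
  their fourth moments are bounded by squared second moments. By Cauchy-Schwarz Y_n^2 tends to X^2
  in L2, and fourth moments converge as second moments of squares.\<close>

lemma wiener_fourth_moment:
  assumes X: "wiener f X"
  shows "expectation (\<lambda>\<omega>. (X \<omega>) ^ 4) = 3 * (LINT x|lborel. (f x)\<^sup>2)\<^sup>2"
proof -
  obtain F c where [measurable]: "f \<in> borel_measurable borel" "X \<in> borel_measurable M"
    and F0: "\<forall>n::nat. finite (F n)"
    and "(\<lambda>n. \<integral>\<^sup>+x. ennreal ((f x - step_combination (F n) (c n) x)\<^sup>2) \<partial>lborel) \<longlonglongrightarrow> 0"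
    and lim: "(\<lambda>n. \<integral>\<^sup>+\<omega>. ennreal ((X \<omega> - bm_combination B (F n) (c n) \<omega>)\<^sup>2) \<partial>M) \<longlonglongrightarrow> 0"
    by (rule wienerE[OF X])
  note F = spec[OF F0]
  define Y where "Y n = bm_combination B (F n) (c n)" for n
  have W: "\<exists>g. wiener g (Y n)" for n using wiener_step[OF F] by (auto simp: Y_def)
  have [measurable]: "Y n \<in> borel_measurable M" for n by (simp add: Y_def)
  have Y2: "integrable M (\<lambda>\<omega>. (Y n \<omega>)\<^sup>2)" for n
    unfolding Y_def by (rule bm_combination_isometry)
  have Y4: "integrable M (\<lambda>\<omega>. (Y n \<omega>) ^ 4)"
    "expectation (\<lambda>\<omega>. (Y n \<omega>) ^ 4) = 3 * (expectation (\<lambda>\<omega>. (Y n \<omega>)\<^sup>2))\<^sup>2" for n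
    unfolding Y_def by (rule bm_combination_fourth_moment[OF F])+
  note L = L2_limit[OF _ _ Y2 lim[folded Y_def], simplified]
  let ?D = "\<lambda>n \<omega>. X \<omega> - Y n \<omega>" and ?S = "\<lambda>n \<omega>. X \<omega> + Y n \<omega>"
  have D: "integrable M (\<lambda>\<omega>. ?D n \<omega> ^ 4)"
      "expectation (\<lambda>\<omega>. ?D n \<omega> ^ 4) \<le> 3 * (expectation (\<lambda>\<omega>. (?D n \<omega>)\<^sup>2))\<^sup>2"
    and S: "integrable M (\<lambda>\<omega>. ?S n \<omega> ^ 4)" "integrable M (\<lambda>\<omega>. (?S n \<omega>)\<^sup>2)"
      "expectation (\<lambda>\<omega>. ?S n \<omega> ^ 4) \<le> 3 * (expectation (\<lambda>\<omega>. (?S n \<omega>)\<^sup>2))\<^sup>2" for n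
  proof -
    obtain g where g: "wiener g (Y n)" using W by blast
    show "integrable M (\<lambda>\<omega>. ?D n \<omega> ^ 4)"
      "expectation (\<lambda>\<omega>. ?D n \<omega> ^ 4) \<le> 3 * (expectation (\<lambda>\<omega>. (?D n \<omega>)\<^sup>2))\<^sup>2"
      by (rule wiener_fourth_moment_le[OF wiener_diff[OF X g]])+
    show "integrable M (\<lambda>\<omega>. ?S n \<omega> ^ 4)"
      "expectation (\<lambda>\<omega>. ?S n \<omega> ^ 4) \<le> 3 * (expectation (\<lambda>\<omega>. (?S n \<omega>)\<^sup>2))\<^sup>2"
      by (rule wiener_fourth_moment_le[OF wiener_add[OF X g]])+
    show "integrable M (\<lambda>\<omega>. (?S n \<omega>)\<^sup>2)"
      by (rule wiener_isometry[OF wiener_add[OF X g]])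
  qed
  define u where "u n = 2 * expectation (\<lambda>\<omega>. (X \<omega>)\<^sup>2) + 2 * expectation (\<lambda>\<omega>. (Y n \<omega>)\<^sup>2)" for n
  have Su: "expectation (\<lambda>\<omega>. (?S n \<omega>)\<^sup>2) \<le> u n" for n
  proof -
    have "expectation (\<lambda>\<omega>. (?S n \<omega>)\<^sup>2) \<le> expectation (\<lambda>\<omega>. 2 * (X \<omega>)\<^sup>2 + 2 * (Y n \<omega>)\<^sup>2)"
    proof (intro integral_mono S)
      show "(?S n \<omega>)\<^sup>2 \<le> 2 * (X \<omega>)\<^sup>2 + 2 * (Y n \<omega>)\<^sup>2" for \<omega>
        using sum_squares_bound[of "X \<omega>" "Y n \<omega>"] power2_sum[of "X \<omega>" "Y n \<omega>"] by simp
    qed (use L(1) Y2 in simp)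
    then show ?thesis using L(1) Y2 by (simp add: u_def)
  qed
  have u0: "0 \<le> u n" for n by (simp add: u_def)
  have prod4: "((X \<omega>)\<^sup>2 - (Y n \<omega>)\<^sup>2)\<^sup>2 = (?D n \<omega>)\<^sup>2 * (?S n \<omega>)\<^sup>2" for n \<omega>
    by (simp add: power2_eq_square algebra_simps)
  have i4: "integrable M (\<lambda>\<omega>. ((X \<omega>)\<^sup>2 - (Y n \<omega>)\<^sup>2)\<^sup>2)"
    and le4: "expectation (\<lambda>\<omega>. ((X \<omega>)\<^sup>2 - (Y n \<omega>)\<^sup>2)\<^sup>2) \<le> 3 * expectation (\<lambda>\<omega>. (?D n \<omega>)\<^sup>2) * u n" for n
  proof -
    have D4: "integrable M (\<lambda>\<omega>. ((?D n \<omega>)\<^sup>2)\<^sup>2)" and S4: "integrable M (\<lambda>\<omega>. ((?S n \<omega>)\<^sup>2)\<^sup>2)"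
      using D(1) S(1) by simp_all
    show "integrable M (\<lambda>\<omega>. ((X \<omega>)\<^sup>2 - (Y n \<omega>)\<^sup>2)\<^sup>2)"
      unfolding prod4 by (rule integrable_mult_of_squares[OF _ _ D4 S4]) auto
    have "(expectation (\<lambda>\<omega>. (?D n \<omega>)\<^sup>2 * (?S n \<omega>)\<^sup>2))\<^sup>2 \<le>
        expectation (\<lambda>\<omega>. ((?D n \<omega>)\<^sup>2)\<^sup>2) * expectation (\<lambda>\<omega>. ((?S n \<omega>)\<^sup>2)\<^sup>2)"
      by (rule integral_Cauchy_Schwarz[OF _ _ D4 S4]) auto
    also have "\<dots> \<le> (3 * (expectation (\<lambda>\<omega>. (?D n \<omega>)\<^sup>2))\<^sup>2) * (3 * (u n)\<^sup>2)"
    proof (rule mult_mono)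
      have "expectation (\<lambda>\<omega>. ?S n \<omega> ^ 4) \<le> 3 * (u n)\<^sup>2"
        using S(3)[of n] power_mono[OF Su[of n], of 2] by simp
      then show "expectation (\<lambda>\<omega>. ((?S n \<omega>)\<^sup>2)\<^sup>2) \<le> 3 * (u n)\<^sup>2" by simp
    qed (use D(2) in simp_all)
    also have "\<dots> = (3 * expectation (\<lambda>\<omega>. (?D n \<omega>)\<^sup>2) * u n)\<^sup>2"
      by (simp add: power2_eq_square)
    finally show "expectation (\<lambda>\<omega>. ((X \<omega>)\<^sup>2 - (Y n \<omega>)\<^sup>2)\<^sup>2) \<le> 3 * expectation (\<lambda>\<omega>. (?D n \<omega>)\<^sup>2) * u n"
      unfolding prod4 by (rule power2_le_imp_le) (simp add: u0)
  qed
  have "(\<lambda>n. 3 * expectation (\<lambda>\<omega>. (?D n \<omega>)\<^sup>2) * u n) \<longlonglongrightarrow>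
      3 * 0 * (2 * expectation (\<lambda>\<omega>. (X \<omega>)\<^sup>2) + 2 * expectation (\<lambda>\<omega>. (X \<omega>)\<^sup>2))"
    unfolding u_def by (intro tendsto_intros L(3,4))
  then have lim0: "(\<lambda>n. ennreal (3 * expectation (\<lambda>\<omega>. (?D n \<omega>)\<^sup>2) * u n)) \<longlonglongrightarrow> 0"
    using tendsto_ennrealI by fastforce
  have "(\<lambda>n. \<integral>\<^sup>+\<omega>. ennreal (((X \<omega>)\<^sup>2 - (Y n \<omega>)\<^sup>2)\<^sup>2) \<partial>M) \<longlonglongrightarrow> 0"
  proof (rule tendsto_sandwich[OF _ _ tendsto_const lim0])
    show "\<forall>\<^sub>F n in sequentially. (\<integral>\<^sup>+\<omega>. ennreal (((X \<omega>)\<^sup>2 - (Y n \<omega>)\<^sup>2)\<^sup>2) \<partial>M) \<le>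
        ennreal (3 * expectation (\<lambda>\<omega>. (?D n \<omega>)\<^sup>2) * u n)"
      by (intro always_eventually allI) (simp add: nn_integral_eq_integral[OF i4] ennreal_leI le4)
  qed auto
  from L2_limit(4)[OF _ _ _ this] Y4(1)
  have "(\<lambda>n. expectation (\<lambda>\<omega>. (Y n \<omega>) ^ 4)) \<longlonglongrightarrow> expectation (\<lambda>\<omega>. (X \<omega>) ^ 4)"
    by simp
  moreover have "(\<lambda>n. expectation (\<lambda>\<omega>. (Y n \<omega>) ^ 4)) \<longlonglongrightarrow> 3 * (expectation (\<lambda>\<omega>. (X \<omega>)\<^sup>2))\<^sup>2"
    unfolding Y4(2) by (intro tendsto_intros L(4))
  ultimately show ?thesis
    using LIMSEQ_unique wiener_isometry(3)[OF X] by metis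
qed

lemma wiener_inner:
  assumes X: "wiener f X" and Y: "wiener g Y"
  shows "integrable lborel (\<lambda>x. f x * g x)" "integrable M (\<lambda>\<omega>. X \<omega> * Y \<omega>)"
    "expectation (\<lambda>\<omega>. X \<omega> * Y \<omega>) = (LINT x|lborel. f x * g x)"
proof -
  note m [measurable] = wiener_measurable[OF X] wiener_measurable[OF Y]
  note i = wiener_isometry[OF X] wiener_isometry[OF Y] wiener_isometry[OF wiener_add[OF X Y]]
  show fg: "integrable lborel (\<lambda>x. f x * g x)"
    by (rule integrable_mult_of_squares) (auto simp: i)
  show XY: "integrable M (\<lambda>\<omega>. X \<omega> * Y \<omega>)"
    by (rule integrable_mult_of_squares) (auto simp: i)
  have "expectation (\<lambda>\<omega>. (X \<omega> + Y \<omega>)\<^sup>2) =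
      expectation (\<lambda>\<omega>. (X \<omega>)\<^sup>2) + expectation (\<lambda>\<omega>. (Y \<omega>)\<^sup>2) + 2 * expectation (\<lambda>\<omega>. X \<omega> * Y \<omega>)"
    using i XY by (simp add: power2_sum mult.assoc)
  moreover have "(LINT x|lborel. (f x + g x)\<^sup>2) =
      (LINT x|lborel. (f x)\<^sup>2) + (LINT x|lborel. (g x)\<^sup>2) + 2 * (LINT x|lborel. f x * g x)"
    using i fg by (simp add: power2_sum mult.assoc)
  ultimately show "expectation (\<lambda>\<omega>. X \<omega> * Y \<omega>) = (LINT x|lborel. f x * g x)"
    using i by simp
qed

end

section \<open>The second chaos\<close>

text \<open>Fourth-order polarization: the first sign is fixed, the other three run through all
  eight choices, weighted by their product. Only the product of all four variables survives, with
  coefficient 8 * 4! = 192.\<close>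

lemma polarization_4:
  fixes a b c d :: real
  shows "192 * (a * b * c * d) =
    (a + b + c + d) ^ 4 - (a + b + c - d) ^ 4 - (a + b - c + d) ^ 4 + (a + b - c - d) ^ 4
    - (a - b + c + d) ^ 4 + (a - b + c - d) ^ 4 + (a - b - c + d) ^ 4 - (a - b - c - d) ^ 4"
  by algebra

text \<open>The same alternating sum for Gaussian fourth moments, which are three times the squared
  variance of the signed sum. Here n is the sum of the four variances, and a, b, c, d, e, f are the
  covariances of the pairs 12, 13, 14, 23, 24, 34.\<close>

lemma polarization_4_covariance:
  fixes n a b c d e f :: real
  shows "192 * (a * f + b * e + c * d) =
    3 * (n + 2 * (a + b + c + d + e + f))\<^sup>2 - 3 * (n + 2 * (a + b - c + d - e - f))\<^sup>2
    - 3 * (n + 2 * (a - b + c - d + e - f))\<^sup>2 + 3 * (n + 2 * (a - b - c - d - e + f))\<^sup>2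
    - 3 * (n + 2 * (- a + b + c - d - e + f))\<^sup>2 + 3 * (n + 2 * (- a + b - c - d + e - f))\<^sup>2
    + 3 * (n + 2 * (- a - b + c + d - e - f))\<^sup>2 - 3 * (n + 2 * (- a - b - c + d + e + f))\<^sup>2"
  by algebra

context two_sided_bm
begin

text \<open>Signed sums of Wiener integrals are Wiener integrals, so their fourth moments are known;
  polarization extracts the product moment from eight of them.\<close>

lemma wiener_isserlis:
  assumes W1: "wiener f1 X1" and W2: "wiener f2 X2" and W3: "wiener f3 X3" and W4: "wiener f4 X4"
  shows "integrable M (\<lambda>\<omega>. X1 \<omega> * X2 \<omega> * X3 \<omega> * X4 \<omega>)"
    and "expectation (\<lambda>\<omega>. X1 \<omega> * X2 \<omega> * X3 \<omega> * X4 \<omega>) =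
      (LINT x|lborel. f1 x * f2 x) * (LINT x|lborel. f3 x * f4 x)
      + (LINT x|lborel. f1 x * f3 x) * (LINT x|lborel. f2 x * f4 x)
      + (LINT x|lborel. f1 x * f4 x) * (LINT x|lborel. f2 x * f3 x)"
proof -
  note [measurable] = wiener_measurable[OF W1] wiener_measurable[OF W2]
    wiener_measurable[OF W3] wiener_measurable[OF W4]
  let ?s = "\<lambda>f g. LINT x|lborel. f x * g x :: real"
  note i = wiener_inner(1)[OF W1 W1] wiener_inner(1)[OF W1 W2] wiener_inner(1)[OF W1 W3]
    wiener_inner(1)[OF W1 W4] wiener_inner(1)[OF W2 W2] wiener_inner(1)[OF W2 W3]
    wiener_inner(1)[OF W2 W4] wiener_inner(1)[OF W3 W3] wiener_inner(1)[OF W3 W4]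
    wiener_inner(1)[OF W4 W4]
  define n where "n = ?s f1 f1 + ?s f2 f2 + ?s f3 f3 + ?s f4 f4"
  \<comment> \<open>Squares of signs are 1, so the sum \<open>n\<close> of the variances is common
    to all eight cases.\<close>
  have gen: "integrable M (\<lambda>\<omega>. (X1 \<omega> + e2 * X2 \<omega> + e3 * X3 \<omega> + e4 * X4 \<omega>) ^ 4) \<and>
    expectation (\<lambda>\<omega>. (X1 \<omega> + e2 * X2 \<omega> + e3 * X3 \<omega> + e4 * X4 \<omega>) ^ 4) =
      3 * (n + 2 * (e2 * ?s f1 f2 + e3 * ?s f1 f3 + e4 * ?s f1 f4
          + e2 * e3 * ?s f2 f3 + e2 * e4 * ?s f2 f4 + e3 * e4 * ?s f3 f4))\<^sup>2"
    if "e2 * e2 = 1" "e3 * e3 = 1" "e4 * e4 = 1" for e2 e3 e4 :: real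
  proof -
    have W: "wiener (\<lambda>x. f1 x + e2 * f2 x + e3 * f3 x + e4 * f4 x)
        (\<lambda>\<omega>. X1 \<omega> + e2 * X2 \<omega> + e3 * X3 \<omega> + e4 * X4 \<omega>)"
      using wiener_linear[OF wiener_linear[OF wiener_linear[OF W1 W2, of 1 e2] W3, of 1 e3] W4, of 1 e4]
      by simp
    have "(LINT x|lborel. (f1 x + e2 * f2 x + e3 * f3 x + e4 * f4 x)\<^sup>2) =
      (LINT x|lborel. f1 x * f1 x + e2 * e2 * (f2 x * f2 x) + e3 * e3 * (f3 x * f3 x)
        + e4 * e4 * (f4 x * f4 x) + 2 * (e2 * (f1 x * f2 x) + e3 * (f1 x * f3 x) + e4 * (f1 x * f4 x)
          + e2 * e3 * (f2 x * f3 x) + e2 * e4 * (f2 x * f4 x) + e3 * e4 * (f3 x * f4 x)))"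
      by (intro Bochner_Integration.integral_cong) (auto simp: power2_eq_square algebra_simps)
    also have "\<dots> = ?s f1 f1 + e2 * e2 * ?s f2 f2 + e3 * e3 * ?s f3 f3 + e4 * e4 * ?s f4 f4
        + 2 * (e2 * ?s f1 f2 + e3 * ?s f1 f3 + e4 * ?s f1 f4
          + e2 * e3 * ?s f2 f3 + e2 * e4 * ?s f2 f4 + e3 * e4 * ?s f3 f4)"
      using i by simp
    finally show ?thesis
      using wiener_fourth_moment[OF W] wiener_fourth_moment_le(1)[OF W] that by (simp add: n_def)
  qed
  note g = gen[of 1 1 1] gen[of 1 1 "- 1"] gen[of 1 "- 1" 1] gen[of 1 "- 1" "- 1"]
    gen[of "- 1" 1 1] gen[of "- 1" 1 "- 1"] gen[of "- 1" "- 1" 1] gen[of "- 1" "- 1" "- 1"]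
  let ?E = "\<lambda>\<omega>. (X1 \<omega> + X2 \<omega> + X3 \<omega> + X4 \<omega>) ^ 4 - (X1 \<omega> + X2 \<omega> + X3 \<omega> - X4 \<omega>) ^ 4
    - (X1 \<omega> + X2 \<omega> - X3 \<omega> + X4 \<omega>) ^ 4 + (X1 \<omega> + X2 \<omega> - X3 \<omega> - X4 \<omega>) ^ 4
    - (X1 \<omega> - X2 \<omega> + X3 \<omega> + X4 \<omega>) ^ 4 + (X1 \<omega> - X2 \<omega> + X3 \<omega> - X4 \<omega>) ^ 4
    + (X1 \<omega> - X2 \<omega> - X3 \<omega> + X4 \<omega>) ^ 4 - (X1 \<omega> - X2 \<omega> - X3 \<omega> - X4 \<omega>) ^ 4"
  have prod: "X1 \<omega> * X2 \<omega> * X3 \<omega> * X4 \<omega> = ?E \<omega> / 192" for \<omega>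
    unfolding polarization_4[symmetric] by simp
  have int: "integrable M ?E"
    using g by simp
  then show "integrable M (\<lambda>\<omega>. X1 \<omega> * X2 \<omega> * X3 \<omega> * X4 \<omega>)"
    unfolding prod by (rule integrable_divide)
  have "expectation (\<lambda>\<omega>. X1 \<omega> * X2 \<omega> * X3 \<omega> * X4 \<omega>) = expectation ?E / 192"
    unfolding prod by simp
  also have "expectation ?E =
    192 * (?s f1 f2 * ?s f3 f4 + ?s f1 f3 * ?s f2 f4 + ?s f1 f4 * ?s f2 f3)"
    unfolding polarization_4_covariance[of _ _ _ _ _ _ n]
    using g by (simp add: add.assoc)
  finally show "expectation (\<lambda>\<omega>. X1 \<omega> * X2 \<omega> * X3 \<omega> * X4 \<omega>) =
      ?s f1 f2 * ?s f3 f4 + ?s f1 f3 * ?s f2 f4 + ?s f1 f4 * ?s f2 f3" by simp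
qed

end

lemma (in pair_sigma_finite) integral_tensor:
  fixes u :: "'a \<Rightarrow> real" and v :: "'b \<Rightarrow> real"
  assumes u: "integrable M1 u" and v: "integrable M2 v"
  shows "integrable (M1 \<Otimes>\<^sub>M M2) (\<lambda>z. u (fst z) * v (snd z))"
    and "(LINT z|(M1 \<Otimes>\<^sub>M M2). u (fst z) * v (snd z)) = (LINT x|M1. u x) * (LINT y|M2. v y)"
proof -
  note [measurable] = borel_measurable_integrable[OF u] borel_measurable_integrable[OF v]
  show int: "integrable (M1 \<Otimes>\<^sub>M M2) (\<lambda>z. u (fst z) * v (snd z))"
    using u v by (intro Fubini_integrable) (auto simp: abs_mult)
  show "(LINT z|(M1 \<Otimes>\<^sub>M M2). u (fst z) * v (snd z)) = (LINT x|M1. u x) * (LINT y|M2. v y)"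
    using integral_fst'[OF int] by simp
qed

lemma integrable_square_add:
  fixes f g :: "'a \<Rightarrow> real"
  assumes [measurable]: "f \<in> borel_measurable M" "g \<in> borel_measurable M"
    and "integrable M (\<lambda>x. (f x)\<^sup>2)" "integrable M (\<lambda>x. (g x)\<^sup>2)"
  shows "integrable M (\<lambda>x. (f x + g x)\<^sup>2)"
  using assms integrable_mult_of_squares[OF assms] by (simp add: power2_sum mult.assoc)

abbreviation plane :: "(real \<times> real) measure" where
  "plane \<equiv> lborel \<Otimes>\<^sub>M lborel"

lemma plane_swap:
  fixes f :: "real \<times> real \<Rightarrow> real"
  assumes "f \<in> borel_measurable plane"
  shows "(\<lambda>z. f (prod.swap z)) \<in> borel_measurable plane"
    and "(LINT z|plane. f (prod.swap z)) = (LINT z|plane. f z)"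
    and "integrable plane (\<lambda>z. f (prod.swap z)) \<longleftrightarrow> integrable plane f"
proof -
  have sw: "(\<lambda>(x, y). f (y, x)) = (\<lambda>z. f (prod.swap z))" by (simp add: fun_eq_iff)
  show "(\<lambda>z. f (prod.swap z)) \<in> borel_measurable plane"
    using measurable_compose[OF measurable_pair_swap' assms] by (simp add: case_prod_beta' prod.swap_def)
  show "(LINT z|plane. f (prod.swap z)) = (LINT z|plane. f z)"
    using lborel_pair.integral_product_swap[OF assms] unfolding sw .
  show "integrable plane (\<lambda>z. f (prod.swap z)) \<longleftrightarrow> integrable plane f"
    using lborel_pair.integrable_product_swap_iff[of f] unfolding sw .
qed

context two_sided_bm
begin

text \<open>
  Off-diagonal kernels and their double integrals: orthogonality of \<open>f\<close> and \<open>g\<close> makes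
  \<open>X \<omega> * Y \<omega>\<close> centred, so that no diagonal correction is needed.
\<close>

inductive chaos2 :: "(real \<times> real \<Rightarrow> real) \<Rightarrow> ('a \<Rightarrow> real) \<Rightarrow> bool" where
  zero: "chaos2 (\<lambda>z. 0) (\<lambda>\<omega>. 0)"
| add: "chaos2 S I \<Longrightarrow> wiener f X \<Longrightarrow> wiener g Y \<Longrightarrow> (LINT x|lborel. f x * g x) = 0 \<Longrightarrow>
    chaos2 (\<lambda>z. S z + f (fst z) * g (snd z)) (\<lambda>\<omega>. I \<omega> + X \<omega> * Y \<omega>)"

lemma wiener_tensor_square:
  assumes "wiener f X" "wiener g Y"
  shows "(\<lambda>z. f (fst z) * g (snd z)) \<in> borel_measurable plane"
    and "(\<lambda>\<omega>. X \<omega> * Y \<omega>) \<in> borel_measurable M"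
    and "integrable plane (\<lambda>z. (f (fst z) * g (snd z))\<^sup>2)"
    and "integrable M (\<lambda>\<omega>. (X \<omega> * Y \<omega>)\<^sup>2)"
    and "(LINT z|plane. (f (fst z) * g (snd z))\<^sup>2) = (LINT x|lborel. (f x)\<^sup>2) * (LINT x|lborel. (g x)\<^sup>2)"
    and "expectation (\<lambda>\<omega>. (X \<omega> * Y \<omega>)\<^sup>2) =
      (LINT x|lborel. (f x)\<^sup>2) * (LINT x|lborel. (g x)\<^sup>2) + 2 * (LINT x|lborel. f x * g x)\<^sup>2"
proof -
  note [measurable] = wiener_measurable[OF assms(1)] wiener_measurable[OF assms(2)]
  show "(\<lambda>z. f (fst z) * g (snd z)) \<in> borel_measurable plane"
    and "(\<lambda>\<omega>. X \<omega> * Y \<omega>) \<in> borel_measurable M" by measurable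
  show "integrable plane (\<lambda>z. (f (fst z) * g (snd z))\<^sup>2)"
    "(LINT z|plane. (f (fst z) * g (snd z))\<^sup>2) = (LINT x|lborel. (f x)\<^sup>2) * (LINT x|lborel. (g x)\<^sup>2)"
    using lborel_pair.integral_tensor[OF wiener_isometry(1)[OF assms(1)] wiener_isometry(1)[OF assms(2)]]
    by (simp_all add: power_mult_distrib)
  show "integrable M (\<lambda>\<omega>. (X \<omega> * Y \<omega>)\<^sup>2)"
    using wiener_isserlis(1)[OF assms(1,1) assms(2,2)] by (simp add: power2_eq_square ac_simps)
  show "expectation (\<lambda>\<omega>. (X \<omega> * Y \<omega>)\<^sup>2) =
      (LINT x|lborel. (f x)\<^sup>2) * (LINT x|lborel. (g x)\<^sup>2) + 2 * (LINT x|lborel. f x * g x)\<^sup>2"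
    using wiener_isserlis(2)[OF assms(1,1) assms(2,2)] by (simp add: power2_eq_square ac_simps)
qed

lemma chaos2_square_integrable:
  assumes "chaos2 S I"
  shows "S \<in> borel_measurable plane \<and> I \<in> borel_measurable M \<and>
    integrable plane (\<lambda>z. (S z)\<^sup>2) \<and> integrable M (\<lambda>\<omega>. (I \<omega>)\<^sup>2)"
  using assms
proof induction
  case (add S I f X g Y)
  note t = wiener_tensor_square[OF add.hyps(2,3)]
  show ?case
    using add.IH t(1-4) by (intro conjI integrable_square_add borel_measurable_add) simp_all
qed simp

lemma chaos2_expectation: "chaos2 S I \<Longrightarrow> expectation I = 0"
proof (induction rule: chaos2.induct)
  case (add S I f X g Y)
  have "integrable M I"
    using chaos2_square_integrable[OF add.hyps(1)] by (auto intro: square_integrable_imp_integrable)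
  then show ?case
    using add wiener_inner[OF add.hyps(2,3)] by simp
qed simp

text \<open>Isserlis' formula gives three pairings for each summand of I. The one that pairs the two
  factors of the summand with each other vanishes by the orthogonality built into
  \<open>chaos2\<close>. As f and g are arbitrary, the formula also covers the square of one Wiener
  integral.\<close>

lemma chaos2_pairing:
  assumes f: "wiener f X" and g: "wiener g Y"
  shows "chaos2 S I \<Longrightarrow> expectation (\<lambda>\<omega>. X \<omega> * Y \<omega> * I \<omega>) =
    (LINT z|plane. f (fst z) * g (snd z) * S z) + (LINT z|plane. f (fst z) * g (snd z) * S (prod.swap z))"
proof (induction rule: chaos2.induct)
  case (add S I f' X' g' Y')
  note t = wiener_tensor_square[OF f g] and t' = wiener_tensor_square[OF add.hyps(2,3)]
  note s = chaos2_square_integrable[OF add.hyps(1)]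
  note w = wiener_inner(1)[OF f add.hyps(2)] wiener_inner(1)[OF f add.hyps(3)]
    wiener_inner(1)[OF g add.hyps(2)] wiener_inner(1)[OF g add.hyps(3)]
  have i1: "integrable M (\<lambda>\<omega>. X \<omega> * Y \<omega> * I \<omega>)"
    using s by (intro integrable_mult_of_squares t) auto
  have i2: "integrable M (\<lambda>\<omega>. X \<omega> * Y \<omega> * (X' \<omega> * Y' \<omega>))"
    by (intro integrable_mult_of_squares t t')
  have i3: "integrable plane (\<lambda>z. f (fst z) * g (snd z) * S z)"
    using s by (intro integrable_mult_of_squares t) auto
  have i4: "integrable plane (\<lambda>z. f (fst z) * g (snd z) * S (prod.swap z))"
    using s plane_swap[of S] plane_swap(3)[of "\<lambda>z. (S z)\<^sup>2"]
    by (intro integrable_mult_of_squares t) auto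
  have e: "(LINT z|plane. f (fst z) * g (snd z) * (f' (fst z) * g' (snd z))) =
      (LINT x|lborel. f x * f' x) * (LINT x|lborel. g x * g' x)"
    and i5: "integrable plane (\<lambda>z. f (fst z) * g (snd z) * (f' (fst z) * g' (snd z)))"
    using lborel_pair.integral_tensor[OF w(1,4)] by (simp_all add: ac_simps)
  have e': "(LINT z|plane. f (fst z) * g (snd z) * (f' (snd z) * g' (fst z))) =
      (LINT x|lborel. f x * g' x) * (LINT x|lborel. g x * f' x)"
    and i6: "integrable plane (\<lambda>z. f (fst z) * g (snd z) * (f' (snd z) * g' (fst z)))"
    using lborel_pair.integral_tensor[OF w(2,3)] by (simp_all add: ac_simps)
  have "expectation (\<lambda>\<omega>. X \<omega> * Y \<omega> * (I \<omega> + X' \<omega> * Y' \<omega>)) =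
      expectation (\<lambda>\<omega>. X \<omega> * Y \<omega> * I \<omega>) + expectation (\<lambda>\<omega>. X \<omega> * Y \<omega> * X' \<omega> * Y' \<omega>)"
    using i1 i2 by (simp add: distrib_left mult.assoc)
  also have "expectation (\<lambda>\<omega>. X \<omega> * Y \<omega> * X' \<omega> * Y' \<omega>) =
      (LINT x|lborel. f x * f' x) * (LINT x|lborel. g x * g' x)
      + (LINT x|lborel. f x * g' x) * (LINT x|lborel. g x * f' x)"
    using wiener_isserlis(2)[OF f g add.hyps(2,3)] add.hyps(4) by simp
  also have "expectation (\<lambda>\<omega>. X \<omega> * Y \<omega> * I \<omega>) + ((LINT x|lborel. f x * f' x) * (LINT x|lborel. g x * g' x)
      + (LINT x|lborel. f x * g' x) * (LINT x|lborel. g x * f' x)) =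
    (LINT z|plane. f (fst z) * g (snd z) * (S z + f' (fst z) * g' (snd z)))
    + (LINT z|plane. f (fst z) * g (snd z) * (S (prod.swap z) + f' (snd z) * g' (fst z)))"
    using add.IH i3 i4 i5 i6 by (simp add: distrib_left e e')
  finally show ?case by simp
qed simp

text \<open>S is not symmetrised, so the second moment is twice the inner product of S with its
  symmetrisation, written as two terms. The mixed terms of the induction come from
  \<open>chaos2_pairing\<close>.\<close>

lemma chaos2_second_moment:
  "chaos2 S I \<Longrightarrow> expectation (\<lambda>\<omega>. (I \<omega>)\<^sup>2) =
    (LINT z|plane. (S z)\<^sup>2) + (LINT z|plane. S z * S (prod.swap z))"
proof (induction rule: chaos2.induct)
  case (add S I f X g Y)
  note t = wiener_tensor_square[OF add.hyps(2,3)] and t' = wiener_tensor_square[OF add.hyps(3,2)]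
  note s = chaos2_square_integrable[OF add.hyps(1)]
  let ?h = "\<lambda>z. f (fst z) * g (snd z)"
  have s': "(\<lambda>z. S (prod.swap z)) \<in> borel_measurable plane"
    "integrable plane (\<lambda>z. (S (prod.swap z))\<^sup>2)"
    using s plane_swap[of S] plane_swap(3)[of "\<lambda>z. (S z)\<^sup>2"] by auto
  have h': "(\<lambda>z. ?h (prod.swap z)) \<in> borel_measurable plane"
    "integrable plane (\<lambda>z. (?h (prod.swap z))\<^sup>2)"
    using t' by (simp_all add: mult.commute)
  have i1: "integrable M (\<lambda>\<omega>. X \<omega> * Y \<omega> * I \<omega>)"
    using s by (intro integrable_mult_of_squares t) auto
  have i2: "integrable plane (\<lambda>z. ?h z * S z)"
    using s by (intro integrable_mult_of_squares t) auto
  have i3: "integrable plane (\<lambda>z. ?h z * S (prod.swap z))"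
    using s' by (intro integrable_mult_of_squares t) auto
  have i4: "integrable plane (\<lambda>z. S z * ?h (prod.swap z))"
    using s h' by (intro integrable_mult_of_squares) auto
  have i5: "integrable plane (\<lambda>z. S z * S (prod.swap z))"
    using s s' by (intro integrable_mult_of_squares) auto
  have i6: "integrable plane (\<lambda>z. ?h z * ?h (prod.swap z))"
    using h' by (intro integrable_mult_of_squares t) auto
  have e4: "(LINT z|plane. S z * ?h (prod.swap z)) = (LINT z|plane. ?h z * S (prod.swap z))"
    using plane_swap(2)[OF borel_measurable_integrable[OF i4]] by (simp add: mult.commute)
  \<comment> \<open>Pairing the new summand with its own swap gives the square of the inner product
    of f and g, which is 0.\<close>
  have e6: "(LINT z|plane. ?h z * ?h (prod.swap z)) = 0"
    using lborel_pair.integral_tensor[OF wiener_inner(1)[OF add.hyps(2,3)] wiener_inner(1)[OF add.hyps(2,3)]]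
      add.hyps(4) by (simp add: ac_simps)
  have "expectation (\<lambda>\<omega>. (I \<omega> + X \<omega> * Y \<omega>)\<^sup>2) =
      expectation (\<lambda>\<omega>. (I \<omega>)\<^sup>2 + (X \<omega> * Y \<omega>)\<^sup>2 + 2 * (X \<omega> * Y \<omega> * I \<omega>))"
    by (simp add: power2_sum ac_simps)
  also have "\<dots> = expectation (\<lambda>\<omega>. (I \<omega>)\<^sup>2) + expectation (\<lambda>\<omega>. (X \<omega> * Y \<omega>)\<^sup>2)
      + 2 * expectation (\<lambda>\<omega>. X \<omega> * Y \<omega> * I \<omega>)"
    using s t i1 by simp
  also have "\<dots> = (LINT z|plane. (S z)\<^sup>2) + (LINT z|plane. S z * S (prod.swap z))
      + (LINT z|plane. (?h z)\<^sup>2) + 2 * ((LINT z|plane. ?h z * S z) + (LINT z|plane. ?h z * S (prod.swap z)))"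
    using add.hyps(4)
    by (simp add: add.IH t(5,6) chaos2_pairing[OF add.hyps(2,3,1)])
  also have "\<dots> = (LINT z|plane. (S z)\<^sup>2 + (?h z)\<^sup>2 + 2 * (?h z * S z))
      + (LINT z|plane. S z * S (prod.swap z) + S z * ?h (prod.swap z) + ?h z * S (prod.swap z)
          + ?h z * ?h (prod.swap z))"
    using s t i2 i3 i4 i5 i6 by (simp add: e4 e6 del: fst_swap snd_swap)
  also have "\<dots> = (LINT z|plane. (S z + ?h z)\<^sup>2)
      + (LINT z|plane. (S z + ?h z) * (S (prod.swap z) + ?h (prod.swap z)))"
    by (intro arg_cong2[where f = "(+)"] Bochner_Integration.integral_cong)
      (auto simp: power2_eq_square algebra_simps)
  finally show ?case .
qed simp

end

text \<open>The family \<open>A\<close> is treated as L2-valued: bounded norms over a finite measure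
  give a square integrable result by Cauchy-Schwarz, and Fubini's theorem lets the pairing with Z
  pass under the integral. It serves twice, for the centred squares of X_s and for their
  kernels.\<close>

lemma L2_valued_integral:
  fixes A :: "'s \<Rightarrow> 'p \<Rightarrow> real"
  assumes Q: "finite_measure Q" and P: "sigma_finite_measure P"
    and [measurable]: "case_prod A \<in> borel_measurable (Q \<Otimes>\<^sub>M P)"
    and A2: "\<And>s. s \<in> space Q \<Longrightarrow> integrable P (\<lambda>p. (A s p)\<^sup>2)"
    and C: "\<And>s. s \<in> space Q \<Longrightarrow> (LINT p|P. (A s p)\<^sup>2) \<le> C"
  shows "(\<lambda>p. LINT s|Q. A s p) \<in> borel_measurable P"
    and "integrable P (\<lambda>p. (LINT s|Q. A s p)\<^sup>2)"
    and "\<And>Z :: 'p \<Rightarrow> real. Z \<in> borel_measurable P \<Longrightarrow> integrable P (\<lambda>p. (Z p)\<^sup>2) \<Longrightarrow>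
      (LINT p|P. (LINT s|Q. A s p) * Z p) = (LINT s|Q. LINT p|P. A s p * Z p)"
proof -
  interpret Q: finite_measure Q by fact
  interpret P: sigma_finite_measure P by fact
  interpret QP: pair_sigma_finite Q P by unfold_locales
  have sw [measurable]: "(\<lambda>(p, s). A s p) \<in> borel_measurable (P \<Otimes>\<^sub>M Q)"
    by (subst measurable_pair_swap_iff) simp
  show W [measurable]: "(\<lambda>p. LINT s|Q. A s p) \<in> borel_measurable P" by measurable
  have As [measurable]: "s \<in> space Q \<Longrightarrow> A s \<in> borel_measurable P" for s by measurable
  let ?q = "emeasure Q (space Q)"
  have "(\<integral>\<^sup>+p. ennreal (norm ((LINT s|Q. A s p)\<^sup>2)) \<partial>P) \<le>
      (\<integral>\<^sup>+p. ?q * (\<integral>\<^sup>+s. ennreal ((A s p)\<^sup>2) \<partial>Q) \<partial>P)"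
  proof (rule nn_integral_mono)
    fix p assume p [measurable]: "p \<in> space P"
    have [measurable]: "(\<lambda>s. A s p) \<in> borel_measurable Q" by measurable
    \<comment> \<open>Where the section in s is not integrable, the Bochner integral is 0 by default
      and the bound still holds.\<close>
    have "ennreal \<bar>LINT s|Q. A s p\<bar> \<le> (\<integral>\<^sup>+s. ennreal \<bar>A s p\<bar> * 1 \<partial>Q)"
      using integral_norm_bound_ennreal[of Q "\<lambda>s. A s p"] not_integrable_integral_eq[of Q "\<lambda>s. A s p"]
      by (cases "integrable Q (\<lambda>s. A s p)") auto
    then have "(ennreal \<bar>LINT s|Q. A s p\<bar>)\<^sup>2 \<le> (\<integral>\<^sup>+s. ennreal \<bar>A s p\<bar> * 1 \<partial>Q)\<^sup>2"
      by (rule power_mono) simp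
    also have "\<dots> \<le> (\<integral>\<^sup>+s. (ennreal \<bar>A s p\<bar>)\<^sup>2 \<partial>Q) * (\<integral>\<^sup>+s. 1\<^sup>2 \<partial>Q)"
      by (rule Cauchy_Schwarz_nn_integral) measurable
    finally show "ennreal (norm ((LINT s|Q. A s p)\<^sup>2)) \<le> ?q * (\<integral>\<^sup>+s. ennreal ((A s p)\<^sup>2) \<partial>Q)"
      by (simp add: ennreal_power mult.commute)
  qed
  also have "\<dots> = ?q * (\<integral>\<^sup>+p. \<integral>\<^sup>+s. ennreal ((A s p)\<^sup>2) \<partial>Q \<partial>P)"
    by (rule nn_integral_cmult) measurable
  also have "(\<integral>\<^sup>+p. \<integral>\<^sup>+s. ennreal ((A s p)\<^sup>2) \<partial>Q \<partial>P) = (\<integral>\<^sup>+s. \<integral>\<^sup>+p. ennreal ((A s p)\<^sup>2) \<partial>P \<partial>Q)"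
    by (rule QP.Fubini') measurable
  also have "\<dots> \<le> (\<integral>\<^sup>+s. ennreal C \<partial>Q)"
    by (intro nn_integral_mono) (simp add: nn_integral_eq_integral[OF A2] C ennreal_leI)
  also have "\<dots> = ennreal C * ?q" by simp
  finally have "(\<integral>\<^sup>+p. ennreal (norm ((LINT s|Q. A s p)\<^sup>2)) \<partial>P) \<le> ?q * (ennreal C * ?q)"
    by (simp add: mult_left_mono)
  moreover have "?q * (ennreal C * ?q) < \<infinity>"
    using Q.emeasure_finite[of "space Q"]
    by (simp add: less_top[symmetric] ennreal_mult_eq_top_iff)
  ultimately show W2: "integrable P (\<lambda>p. (LINT s|Q. A s p)\<^sup>2)"
    by (intro integrableI_bounded) (auto intro: le_less_trans)
  fix Z :: "'p \<Rightarrow> real" assume Z [measurable]: "Z \<in> borel_measurable P" and Z2: "integrable P (\<lambda>p. (Z p)\<^sup>2)"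
  define D where "D = C + (LINT p|P. (Z p)\<^sup>2)"
  have AZ: "integrable P (\<lambda>p. A s p * Z p)" if "s \<in> space Q" for s
    using that A2 Z2 by (intro integrable_mult_of_squares) auto
  have b: "(LINT p|P. \<bar>A s p * Z p\<bar>) \<le> D" if s: "s \<in> space Q" for s
  proof -
    have "(LINT p|P. \<bar>A s p * Z p\<bar>) \<le> (LINT p|P. (A s p)\<^sup>2 + (Z p)\<^sup>2)"
    proof (rule integral_mono)
      fix p
      have "2 * (\<bar>A s p\<bar> * \<bar>Z p\<bar>) \<le> (A s p)\<^sup>2 + (Z p)\<^sup>2"
        using sum_squares_bound[of "\<bar>A s p\<bar>" "\<bar>Z p\<bar>"] by (simp add: mult.assoc)
      moreover have "0 \<le> \<bar>A s p\<bar> * \<bar>Z p\<bar>" by simp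
      ultimately show "\<bar>A s p * Z p\<bar> \<le> (A s p)\<^sup>2 + (Z p)\<^sup>2" unfolding abs_mult by linarith
    qed (use AZ[OF s] A2[OF s] Z2 in auto)
    also have "\<dots> \<le> D" using A2[OF s] Z2 C[OF s] by (simp add: D_def)
    finally show ?thesis .
  qed
  have "integrable (Q \<Otimes>\<^sub>M P) (\<lambda>(s, p). A s p * Z p)"
  proof (rule QP.Fubini_integrable)
    show "integrable Q (\<lambda>s. LINT p|P. norm (case (s, p) of (s, p) \<Rightarrow> A s p * Z p))"
    proof (rule Q.integrable_const_bound[of _ D])
      show "AE s in Q. norm (LINT p|P. norm (case (s, p) of (s, p) \<Rightarrow> A s p * Z p)) \<le> D"
        using b by (intro AE_I2) auto
    qed measurable
    show "AE s in Q. integrable P (\<lambda>p. case (s, p) of (s, p) \<Rightarrow> A s p * Z p)"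
      using AZ by (intro AE_I2) auto
  qed measurable
  from QP.Fubini_integral[OF this] show "(LINT p|P. (LINT s|Q. A s p) * Z p) = (LINT s|Q. LINT p|P. A s p * Z p)"
    by simp
qed

section \<open>Distance between a quadratic functional and a double integral of a step
  kernel\<close>

context two_sided_bm
begin

text \<open>Both sides are expanded into inner products. By Isserlis' formula the covariance of the
  squares at s and r is twice the squared inner product of \<open>k s\<close> and
  \<open>k r\<close>, and the two kernels pair to that square. So V has second moment twice the
  squared norm of h, and its mixed moment with I is twice the inner product of h and S. The
  inequality enters through I alone, because S need not be symmetric.\<close>

lemma quadratic_functional_chaos2_distance:
  fixes k :: "'s \<Rightarrow> real \<Rightarrow> real" and X :: "'s \<Rightarrow> 'a \<Rightarrow> real"
  assumes Q: "finite_measure Q"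
    and k [measurable]: "case_prod k \<in> borel_measurable (Q \<Otimes>\<^sub>M lborel)"
    and X [measurable]: "case_prod X \<in> borel_measurable (Q \<Otimes>\<^sub>M M)"
    and W: "\<And>s. s \<in> space Q \<Longrightarrow> wiener (k s) (X s)"
    and C: "\<And>s. s \<in> space Q \<Longrightarrow> (LINT x|lborel. (k s x)\<^sup>2) \<le> C"
    and chaos: "chaos2 S I"
  defines "V \<equiv> \<lambda>\<omega>. LINT s|Q. (X s \<omega>)\<^sup>2 - expectation (\<lambda>\<omega>. (X s \<omega>)\<^sup>2)"
    and "h \<equiv> \<lambda>z. LINT s|Q. k s (fst z) * k s (snd z)"
  shows "V \<in> borel_measurable M" "h \<in> borel_measurable plane"
    "(\<integral>\<^sup>+\<omega>. ennreal ((V \<omega> - I \<omega>)\<^sup>2) \<partial>M) \<le> 2 * (\<integral>\<^sup>+z. ennreal ((h z - S z)\<^sup>2) \<partial>plane)"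
proof -
  interpret Q: finite_measure Q by fact
  let ?A = "\<lambda>s \<omega>. (X s \<omega>)\<^sup>2 - expectation (\<lambda>\<omega>. (X s \<omega>)\<^sup>2)"
  let ?K = "\<lambda>s z. k s (fst z) * k s (snd z)"
  let ?c = "\<lambda>s r. LINT x|lborel. k s x * k r x"
  have mA: "case_prod ?A \<in> borel_measurable (Q \<Otimes>\<^sub>M M)" by measurable
  have mK: "case_prod ?K \<in> borel_measurable (Q \<Otimes>\<^sub>M plane)" by measurable
  have X2: "integrable M (\<lambda>\<omega>. (X s \<omega>)\<^sup>2)" "expectation (\<lambda>\<omega>. (X s \<omega>)\<^sup>2) = ?c s s"
    if "s \<in> space Q" for s
    using wiener_isometry[OF W[OF that]] by (simp_all add: power2_eq_square)
  have mX [measurable]: "s \<in> space Q \<Longrightarrow> X s \<in> borel_measurable M" for s by measurable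
  have X4: "integrable M (\<lambda>\<omega>. (X s \<omega>)\<^sup>2 * (X r \<omega>)\<^sup>2)"
    "expectation (\<lambda>\<omega>. (X s \<omega>)\<^sup>2 * (X r \<omega>)\<^sup>2) = ?c s s * ?c r r + 2 * (?c s r)\<^sup>2"
    if "s \<in> space Q" "r \<in> space Q" for s r
    using wiener_isserlis[OF W[OF that(1)] W[OF that(1)] W[OF that(2)] W[OF that(2)]]
    by (simp_all add: power2_eq_square ac_simps)
  \<comment> \<open>The product of the two variances cancels against the centring.\<close>
  have AA: "integrable M (\<lambda>\<omega>. ?A s \<omega> * ?A r \<omega>)" "expectation (\<lambda>\<omega>. ?A s \<omega> * ?A r \<omega>) = 2 * (?c s r)\<^sup>2"
    if s: "s \<in> space Q" "r \<in> space Q" for s r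
    using X4[OF s] X2[OF s(1)] X2[OF s(2)]
    by (simp_all add: algebra_simps prob_space)
  have KK: "integrable plane (\<lambda>z. ?K s z * ?K r z)" "(LINT z|plane. ?K s z * ?K r z) = (?c s r)\<^sup>2"
    if s: "s \<in> space Q" "r \<in> space Q" for s r
    using lborel_pair.integral_tensor[OF wiener_inner(1)[OF W[OF s(1)] W[OF s(2)]]
        wiener_inner(1)[OF W[OF s(1)] W[OF s(2)]]]
    by (simp_all add: power2_eq_square ac_simps)
  have A2: "integrable M (\<lambda>\<omega>. (?A s \<omega>)\<^sup>2)" "expectation (\<lambda>\<omega>. (?A s \<omega>)\<^sup>2) \<le> 2 * C\<^sup>2"
    and K2: "integrable plane (\<lambda>z. (?K s z)\<^sup>2)" "(LINT z|plane. (?K s z)\<^sup>2) \<le> C\<^sup>2"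
    if s: "s \<in> space Q" for s
  proof -
    have c: "0 \<le> ?c s s" "?c s s \<le> C"
      using C[OF s] by (auto simp: power2_eq_square intro!: Bochner_Integration.integral_nonneg)
    show "integrable M (\<lambda>\<omega>. (?A s \<omega>)\<^sup>2)" "integrable plane (\<lambda>z. (?K s z)\<^sup>2)"
      using AA(1)[OF s s] KK(1)[OF s s] by (simp_all only: power2_eq_square)
    show "expectation (\<lambda>\<omega>. (?A s \<omega>)\<^sup>2) \<le> 2 * C\<^sup>2" "(LINT z|plane. (?K s z)\<^sup>2) \<le> C\<^sup>2"
      using AA(2)[OF s s] KK(2)[OF s s] power_mono[OF c(2,1), of 2]
      by (simp_all only: power2_eq_square mult_le_cancel_left_pos zero_less_numeral)
  qed
  have sf: "sigma_finite_measure M" "sigma_finite_measure plane"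
    by unfold_locales
  have V: "(LINT s|Q. ?A s \<omega>) = V \<omega>" for \<omega> by (simp add: V_def)
  have h: "(LINT s|Q. ?K s z) = h z" for z by (simp add: h_def)
  note LA = L2_valued_integral[OF Q sf(1) mA A2, unfolded V]
  note LK = L2_valued_integral[OF Q sf(2) mK K2, unfolded h]
  show mV [measurable]: "V \<in> borel_measurable M" by (rule LA(1))
  show mh [measurable]: "h \<in> borel_measurable plane" by (rule LK(1))
  have V2: "integrable M (\<lambda>\<omega>. (V \<omega>)\<^sup>2)" by (rule LA(2))
  have h2: "integrable plane (\<lambda>z. (h z)\<^sup>2)" by (rule LK(2))
  have mAs: "?A s \<in> borel_measurable M" and mKs: "?K s \<in> borel_measurable plane"
    if "s \<in> space Q" for s
    using mX[OF that] wiener_tensor_square(1)[OF W[OF that] W[OF that]] by auto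
  have s: "S \<in> borel_measurable plane" "I \<in> borel_measurable M"
      "integrable plane (\<lambda>z. (S z)\<^sup>2)" "integrable M (\<lambda>\<omega>. (I \<omega>)\<^sup>2)"
    using chaos2_square_integrable[OF chaos] by auto
  note [measurable] = s(1,2)
  have intI: "integrable M I"
    using s by (auto intro: square_integrable_imp_integrable)
  have VV: "expectation (\<lambda>\<omega>. V \<omega> * V \<omega>) = 2 * (LINT z|plane. h z * h z)"
  proof -
    have "expectation (\<lambda>\<omega>. V \<omega> * V \<omega>) = (LINT s|Q. expectation (\<lambda>\<omega>. ?A s \<omega> * V \<omega>))"
      by (rule LA(3)[OF _ _ mV V2])
    also have "\<dots> = (LINT s|Q. LINT r|Q. expectation (\<lambda>\<omega>. ?A r \<omega> * ?A s \<omega>))"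
      by (intro Bochner_Integration.integral_cong refl)
        (subst mult.commute, rule LA(3)[OF _ _ mAs A2(1)])
    also have "\<dots> = (LINT s|Q. LINT r|Q. 2 * (LINT z|plane. ?K r z * ?K s z))"
      by (intro Bochner_Integration.integral_cong refl) (simp only: AA(2) KK(2))
    also have "\<dots> = 2 * (LINT s|Q. LINT r|Q. (LINT z|plane. ?K r z * ?K s z))"
      by simp
    also have "(LINT s|Q. LINT r|Q. (LINT z|plane. ?K r z * ?K s z)) = (LINT s|Q. LINT z|plane. ?K s z * h z)"
      by (intro Bochner_Integration.integral_cong refl)
        (subst (2) mult.commute, rule LK(3)[OF _ _ mKs K2(1), symmetric])
    also have "\<dots> = (LINT z|plane. h z * h z)"
      by (rule LK(3)[OF _ _ mh h2, symmetric])
    finally show ?thesis .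
  qed
  have VI: "expectation (\<lambda>\<omega>. V \<omega> * I \<omega>) = 2 * (LINT z|plane. h z * S z)"
  proof -
    have AI: "expectation (\<lambda>\<omega>. ?A s \<omega> * I \<omega>) = 2 * (LINT z|plane. ?K s z * S z)"
      if sQ: "s \<in> space Q" for s
    proof -
      have i: "integrable M (\<lambda>\<omega>. X s \<omega> * X s \<omega> * I \<omega>)"
        using s wiener_tensor_square[OF W[OF sQ] W[OF sQ]] by (intro integrable_mult_of_squares) auto
      have "expectation (\<lambda>\<omega>. ?A s \<omega> * I \<omega>) =
          expectation (\<lambda>\<omega>. X s \<omega> * X s \<omega> * I \<omega>) - expectation (\<lambda>\<omega>. (X s \<omega>)\<^sup>2) * expectation I"
        using i intI by (simp add: power2_eq_square left_diff_distrib)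
      also have "\<dots> = (LINT z|plane. ?K s z * S z) + (LINT z|plane. ?K s z * S (prod.swap z))"
        by (simp add: chaos2_pairing[OF W[OF sQ] W[OF sQ] chaos] chaos2_expectation[OF chaos])
      \<comment> \<open>The kernel of a square is symmetric, so the swap can be removed from
        S.\<close>
      also have "(LINT z|plane. ?K s z * S (prod.swap z)) = (LINT z|plane. ?K s z * S z)"
        using plane_swap(2)[of "\<lambda>z. ?K s z * S z"] mKs[OF sQ] by (simp add: mult.commute[of "k s (snd _)"])
      finally show ?thesis by simp
    qed
    have "expectation (\<lambda>\<omega>. V \<omega> * I \<omega>) = (LINT s|Q. expectation (\<lambda>\<omega>. ?A s \<omega> * I \<omega>))"
      by (rule LA(3)[OF _ _ s(2,4)])
    also have "\<dots> = (LINT s|Q. 2 * (LINT z|plane. ?K s z * S z))"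
      by (intro Bochner_Integration.integral_cong refl AI)
    also have "\<dots> = 2 * (LINT s|Q. (LINT z|plane. ?K s z * S z))" by simp
    also have "(LINT s|Q. (LINT z|plane. ?K s z * S z)) = (LINT z|plane. h z * S z)"
      by (rule LK(3)[OF _ _ s(1,3), symmetric])
    finally show ?thesis .
  qed
  have s': "(\<lambda>z. S (prod.swap z)) \<in> borel_measurable plane"
    "integrable plane (\<lambda>z. (S (prod.swap z))\<^sup>2)"
    "(LINT z|plane. (S (prod.swap z))\<^sup>2) = (LINT z|plane. (S z)\<^sup>2)"
    using s plane_swap[of S] plane_swap(2,3)[of "\<lambda>z. (S z)\<^sup>2"] by auto
  have iSS: "integrable plane (\<lambda>z. S z * S (prod.swap z))"
    using s s' by (intro integrable_mult_of_squares) auto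
  \<comment> \<open>The difference between S and its swap has nonnegative squared norm.\<close>
  have SS: "(LINT z|plane. S z * S (prod.swap z)) \<le> (LINT z|plane. (S z)\<^sup>2)"
  proof -
    have "0 \<le> (LINT z|plane. (S z - S (prod.swap z))\<^sup>2)" by simp
    also have "\<dots> = 2 * (LINT z|plane. (S z)\<^sup>2) - 2 * (LINT z|plane. S z * S (prod.swap z))"
      using s s' iSS by (simp add: power2_diff mult.assoc)
    finally show ?thesis by simp
  qed
  have iVI: "integrable M (\<lambda>\<omega>. V \<omega> * I \<omega>)" and ihS: "integrable plane (\<lambda>z. h z * S z)"
    using s V2 h2 by (auto intro!: integrable_mult_of_squares)
  have iV: "integrable M (\<lambda>\<omega>. (V \<omega> - I \<omega>)\<^sup>2)" and ih: "integrable plane (\<lambda>z. (h z - S z)\<^sup>2)"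
    using iVI ihS V2 h2 s by (auto simp: power2_diff mult.assoc)
  have "expectation (\<lambda>\<omega>. (V \<omega> - I \<omega>)\<^sup>2) =
      expectation (\<lambda>\<omega>. V \<omega> * V \<omega>) + expectation (\<lambda>\<omega>. (I \<omega>)\<^sup>2) - 2 * expectation (\<lambda>\<omega>. V \<omega> * I \<omega>)"
    using iVI V2 s by (simp add: power2_diff mult.assoc flip: power2_eq_square)
  also have "\<dots> \<le> 2 * ((LINT z|plane. h z * h z) + (LINT z|plane. (S z)\<^sup>2) - 2 * (LINT z|plane. h z * S z))"
    using SS by (simp add: VV VI chaos2_second_moment[OF chaos])
  also have "\<dots> = 2 * (LINT z|plane. (h z - S z)\<^sup>2)"
    using ihS h2 s by (simp add: power2_diff mult.assoc flip: power2_eq_square)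
  finally have "expectation (\<lambda>\<omega>. (V \<omega> - I \<omega>)\<^sup>2) \<le> 2 * (LINT z|plane. (h z - S z)\<^sup>2)" .
  then show "(\<integral>\<^sup>+\<omega>. ennreal ((V \<omega> - I \<omega>)\<^sup>2) \<partial>M) \<le> 2 * (\<integral>\<^sup>+z. ennreal ((h z - S z)\<^sup>2) \<partial>plane)"
    by (simp add: nn_integral_eq_integral[OF iV] nn_integral_eq_integral[OF ih] ennreal_leI
        flip: ennreal_mult ennreal_numeral)
qed

end

section \<open>Fractional kernels\<close>

lemma nn_integral_mult_iterated:
  assumes Q: "sigma_finite_measure Q" and R: "sigma_finite_measure R" and P: "sigma_finite_measure P"
    and [measurable]: "case_prod F \<in> borel_measurable (Q \<Otimes>\<^sub>M P)"
      "case_prod G \<in> borel_measurable (R \<Otimes>\<^sub>M P)"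
  shows "(\<integral>\<^sup>+p. (\<integral>\<^sup>+s. F s p \<partial>Q) * (\<integral>\<^sup>+r. G r p \<partial>R) \<partial>P) =
    (\<integral>\<^sup>+s. \<integral>\<^sup>+r. \<integral>\<^sup>+p. F s p * G r p \<partial>P \<partial>R \<partial>Q)"
proof -
  interpret Q: sigma_finite_measure Q by fact
  interpret R: sigma_finite_measure R by fact
  interpret P: sigma_finite_measure P by fact
  interpret QP: pair_sigma_finite Q P by unfold_locales
  interpret RP: pair_sigma_finite R P by unfold_locales
  have [measurable]: "(\<lambda>(p, s). F s p) \<in> borel_measurable (P \<Otimes>\<^sub>M Q)"
    "(\<lambda>(p, r). G r p) \<in> borel_measurable (P \<Otimes>\<^sub>M R)"
    by (subst measurable_pair_swap_iff, simp)+
  have "(\<integral>\<^sup>+p. (\<integral>\<^sup>+s. F s p \<partial>Q) * (\<integral>\<^sup>+r. G r p \<partial>R) \<partial>P) =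
      (\<integral>\<^sup>+p. \<integral>\<^sup>+s. F s p * (\<integral>\<^sup>+r. G r p \<partial>R) \<partial>Q \<partial>P)"
    by (intro nn_integral_cong nn_integral_multc[symmetric]) measurable
  also have "\<dots> = (\<integral>\<^sup>+s. \<integral>\<^sup>+p. F s p * (\<integral>\<^sup>+r. G r p \<partial>R) \<partial>P \<partial>Q)"
    by (rule QP.Fubini') measurable
  also have "\<dots> = (\<integral>\<^sup>+s. \<integral>\<^sup>+p. \<integral>\<^sup>+r. F s p * G r p \<partial>R \<partial>P \<partial>Q)"
    by (intro nn_integral_cong nn_integral_cmult[symmetric]) measurable
  also have "\<dots> = (\<integral>\<^sup>+s. \<integral>\<^sup>+r. \<integral>\<^sup>+p. F s p * G r p \<partial>P \<partial>R \<partial>Q)"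
    by (intro nn_integral_cong RP.Fubini') measurable
  finally show ?thesis .
qed

lemma (in pair_sigma_finite) nn_integral_tensor:
  assumes [measurable]: "f \<in> borel_measurable M1" "g \<in> borel_measurable M2"
  shows "(\<integral>\<^sup>+z. f (fst z) * g (snd z) \<partial>(M1 \<Otimes>\<^sub>M M2)) = (\<integral>\<^sup>+x. f x \<partial>M1) * (\<integral>\<^sup>+y. g y \<partial>M2)"
proof -
  have "(\<integral>\<^sup>+z. f (fst z) * g (snd z) \<partial>(M1 \<Otimes>\<^sub>M M2)) = (\<integral>\<^sup>+x. \<integral>\<^sup>+y. f x * g y \<partial>M2 \<partial>M1)"
    by (subst M2.nn_integral_fst[symmetric]) auto
  also have "\<dots> = (\<integral>\<^sup>+x. f x * (\<integral>\<^sup>+y. g y \<partial>M2) \<partial>M1)"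
    by (intro nn_integral_cong nn_integral_cmult) measurable
  also have "\<dots> = (\<integral>\<^sup>+x. f x \<partial>M1) * (\<integral>\<^sup>+y. g y \<partial>M2)"
    by (rule nn_integral_multc) measurable
  finally show ?thesis .
qed

lemma nn_integral_powr_Icc_finite:
  assumes "-1 < (e::real)"
  shows "(\<integral>\<^sup>+y. ennreal (indicator {0..c} y * y powr e) \<partial>lborel) < \<infinity>"
proof (cases "0 \<le> c")
  case True
  have "((\<lambda>y. if y \<in> {0..c} then y powr e else 0) has_integral (c powr (e + 1) / (e + 1))) UNIV"
    using has_integral_powr_from_0[OF assms True] by (simp only: has_integral_restrict_UNIV)
  then have "((\<lambda>y. indicator {0..c} y * y powr e) has_integral (c powr (e + 1) / (e + 1))) UNIV"
    by (rule has_integral_eq_rhs[OF has_integral_eq[rotated]]) (auto simp: indicator_def)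
  then have "(\<integral>\<^sup>+y. ennreal (indicator {0..c} y * y powr e) \<partial>lborel) = ennreal (c powr (e + 1) / (e + 1))"
    by (intro nn_integral_has_integral_lborel) auto
  then show ?thesis by simp
qed simp

lemma nn_integral_powr_Ici_finite:
  assumes "(e::real) < -1"
  shows "(\<integral>\<^sup>+y. ennreal (indicator {1..} y * y powr e) \<partial>lborel) < \<infinity>"
proof -
  have "((\<lambda>y. if y \<in> {1..} then y powr e else 0) has_integral (- (1 powr (e + 1)) / (e + 1))) UNIV"
    using has_integral_powr_to_inf[OF assms, of 1] by (simp only: has_integral_restrict_UNIV)
  then have "((\<lambda>y. indicator {1..} y * y powr e) has_integral (- (1 powr (e + 1)) / (e + 1))) UNIV"
    by (rule has_integral_eq_rhs[OF has_integral_eq[rotated]]) (auto simp: indicator_def)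
  then have "(\<integral>\<^sup>+y. ennreal (indicator {1..} y * y powr e) \<partial>lborel) = ennreal (- (1 powr (e + 1)) / (e + 1))"
    by (intro nn_integral_has_integral_lborel) auto
  then show ?thesis by simp
qed

lemma nn_integral_abs_powr_finite:
  assumes "-1 < (e::real)"
  shows "(\<integral>\<^sup>+y. ennreal (indicator {-c..c} y * \<bar>y\<bar> powr e) \<partial>lborel) < \<infinity>"
proof -
  let ?f = "\<lambda>y. ennreal (indicator {0..c} y * y powr e)"
  have "(\<integral>\<^sup>+y. ennreal (indicator {-c..c} y * \<bar>y\<bar> powr e) \<partial>lborel) \<le> (\<integral>\<^sup>+y. ?f y + ?f (- y) \<partial>lborel)"
    by (intro nn_integral_mono) (auto simp: indicator_def abs_if)
  also have "\<dots> = (\<integral>\<^sup>+y. ?f y \<partial>lborel) + (\<integral>\<^sup>+y. ?f (- y) \<partial>lborel)"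
    by (rule nn_integral_add) measurable
  also have "(\<integral>\<^sup>+y. ?f (- y) \<partial>lborel) = (\<integral>\<^sup>+y. ?f y \<partial>lborel)"
    using nn_integral_real_affine[of ?f "-1" 0] by simp
  also have "(\<integral>\<^sup>+y. ?f y \<partial>lborel) + (\<integral>\<^sup>+y. ?f y \<partial>lborel) < \<infinity>"
    using nn_integral_powr_Icc_finite[OF assms, of c] by simp
  finally show ?thesis .
qed

definition frac_kernel :: "real \<Rightarrow> real \<Rightarrow> real \<Rightarrow> real" where
  "frac_kernel a u \<xi> = max 0 (u - \<xi>) powr a"

lemma frac_kernel_nonneg [simp]: "0 \<le> frac_kernel a u \<xi>"
  by (simp add: frac_kernel_def)

lemma frac_kernel_measurable [measurable (raw)]:
  "f \<in> borel_measurable M \<Longrightarrow> g \<in> borel_measurable M \<Longrightarrow>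
    (\<lambda>x. frac_kernel a (f x) (g x)) \<in> borel_measurable M"
  unfolding frac_kernel_def by measurable

lemma frac_kernel_scale: "0 < T \<Longrightarrow> frac_kernel a (T * u) (T * \<xi>) = T powr a * frac_kernel a u \<xi>"
proof -
  assume T: "0 < T"
  then have "max 0 (T * u - T * \<xi>) = T * max 0 (u - \<xi>)"
    by (simp add: max_mult_distrib_left right_diff_distrib)
  then show ?thesis using T by (simp add: frac_kernel_def powr_mult)
qed

text \<open>For -1 < a < -1/2 this is the Beta value B(a + 1, -1 - 2a). It is never evaluated, since
  the constants of the theorem are compared at the level of kernels.\<close>

definition frac_const :: "real \<Rightarrow> real" where
  "frac_const a = enn2real (\<integral>\<^sup>+y. ennreal (max 0 y powr a * max 0 (1 + y) powr a) \<partial>lborel)"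

text \<open>For a = H - 3/2 the exponent is 2H - 2, as in the integrability condition on x.\<close>

definition frac_cov :: "real \<Rightarrow> real \<Rightarrow> real" where
  "frac_cov a x = frac_const a * \<bar>x\<bar> powr (2 * a + 1)"

lemma frac_cov_nonneg [simp]: "0 \<le> frac_cov a x"
  by (simp add: frac_cov_def frac_const_def)

lemma frac_cov_minus: "frac_cov a (- x) = frac_cov a x"
  by (simp add: frac_cov_def)

lemma frac_cov_measurable [measurable (raw)]:
  "f \<in> borel_measurable M \<Longrightarrow> (\<lambda>x. frac_cov a (f x)) \<in> borel_measurable M"
  unfolding frac_cov_def by measurable

text \<open>With d = |u - v|, a substitution that starts at the smaller of u and v extracts all
  powers of d: one from the measure and a from each factor. The remaining integral converges at 0
  since a > -1 and at infinity since 2a < -1. At u = v the left side is infinite while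
  \<open>frac_cov a 0\<close> is 0, so later uses discard the diagonal as a null set.\<close>

lemma frac_kernel_inner:
  assumes a: "-1 < a" "a < -1/2" and uv: "u \<noteq> v"
  shows "(\<integral>\<^sup>+\<xi>. ennreal (frac_kernel a u \<xi>) * ennreal (frac_kernel a v \<xi>) \<partial>lborel) = ennreal (frac_cov a (u - v))"
proof -
  let ?h = "\<lambda>y. ennreal (max 0 y powr a * max 0 (1 + y) powr a)"
  have "(\<integral>\<^sup>+y. ?h y \<partial>lborel) \<le> (\<integral>\<^sup>+y. ennreal (indicator {0..1} y * y powr a) + ennreal (indicator {1..} y * y powr (2 * a)) \<partial>lborel)"
  proof (rule nn_integral_mono)
    fix y :: real
    have le: "max 0 y powr a * max 0 (1 + y) powr a \<le> indicator {0..1} y * y powr a + indicator {1..} y * y powr (2 * a)"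
    proof (cases "0 < y")
      case True
      show ?thesis
      proof (cases "y \<le> 1")
        case True
        have "(1 + y) powr a \<le> 1 powr a"
          using a \<open>0 < y\<close> by (intro powr_mono2') auto
        then have "y powr a * (1 + y) powr a \<le> y powr a" by (simp add: mult_left_le)
        then show ?thesis using True \<open>0 < y\<close> by (auto simp: indicator_def)
      next
        case False
        have "(1 + y) powr a \<le> y powr a"
          using a \<open>0 < y\<close> by (intro powr_mono2') auto
        then have "y powr a * (1 + y) powr a \<le> y powr a * y powr a" by (intro mult_left_mono) auto
        then show ?thesis using False \<open>0 < y\<close> by (auto simp: indicator_def powr_add[symmetric])
      qed
    qed auto
    show "?h y \<le> ennreal (indicator {0..1} y * y powr a) + ennreal (indicator {1..} y * y powr (2 * a))"
      using ennreal_leI[OF le] by (subst (asm) ennreal_plus) auto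
  qed
  also have "\<dots> = (\<integral>\<^sup>+y. ennreal (indicator {0..1} y * y powr a) \<partial>lborel) + (\<integral>\<^sup>+y. ennreal (indicator {1..} y * y powr (2 * a)) \<partial>lborel)"
    by (rule nn_integral_add) measurable
  also have "\<dots> < \<infinity>"
    using nn_integral_powr_Icc_finite[of a 1] nn_integral_powr_Ici_finite[of "2 * a"] a by simp
  finally have fin: "(\<integral>\<^sup>+y. ?h y \<partial>lborel) = ennreal (frac_const a)"
    by (simp add: frac_const_def)
  have *: "(\<integral>\<^sup>+\<xi>. ennreal (frac_kernel a u \<xi>) * ennreal (frac_kernel a v \<xi>) \<partial>lborel) = ennreal (frac_cov a (u - v))"
    if uv: "u < v" for u v
  proof -
    define d where "d = v - u"
    have d: "0 < d" using uv by (simp add: d_def)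
    have e1: "frac_kernel a u (u + - d * y) = d powr a * max 0 y powr a" for y
    proof -
      have "max 0 (u - (u + - d * y)) = d * max 0 y" using d by (simp add: max_mult_distrib_left)
      then show ?thesis using d by (simp add: frac_kernel_def powr_mult)
    qed
    have e2: "frac_kernel a v (u + - d * y) = d powr a * max 0 (1 + y) powr a" for y
    proof -
      have "v - (u + - d * y) = d * (1 + y)" by (simp add: d_def algebra_simps)
      then have "max 0 (v - (u + - d * y)) = d * max 0 (1 + y)"
        using d by (simp add: max_mult_distrib_left)
      then show ?thesis using d by (simp add: frac_kernel_def powr_mult)
    qed
    have "(\<integral>\<^sup>+\<xi>. ennreal (frac_kernel a u \<xi>) * ennreal (frac_kernel a v \<xi>) \<partial>lborel) =
        ennreal d * (\<integral>\<^sup>+y. ennreal (frac_kernel a u (u + - d * y)) * ennreal (frac_kernel a v (u + - d * y)) \<partial>lborel)"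
      using nn_integral_real_affine[of "\<lambda>\<xi>. ennreal (frac_kernel a u \<xi>) * ennreal (frac_kernel a v \<xi>)" "- d" u] d
      by simp
    also have "\<dots> = ennreal d * (\<integral>\<^sup>+y. ennreal (d powr a * d powr a) * ?h y \<partial>lborel)"
    proof -
      have "ennreal (d powr a * max 0 y powr a) * ennreal (d powr a * max 0 (1 + y) powr a) =
          ennreal (d powr a * d powr a) * ?h y" for y
        by (simp add: ac_simps flip: ennreal_mult)
      then show ?thesis unfolding e1 e2 by simp
    qed
    also have "\<dots> = ennreal d * (ennreal (d powr a * d powr a) * ennreal (frac_const a))"
      by (subst nn_integral_cmult) (auto simp: fin)
    also have "\<dots> = ennreal (frac_const a * (d * (d powr a * d powr a)))"
      using d by (simp add: ennreal_mult frac_const_def ac_simps)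
    also have "d * (d powr a * d powr a) = d powr (2 * a + 1)"
      using d powr_add[of d a a] powr_add[of d "2 * a" 1] by simp
    finally show ?thesis using uv by (simp add: frac_cov_def d_def)
  qed
  show ?thesis
  proof (cases "u < v")
    case False
    then have "v < u" using uv by simp
    from *[OF this] show ?thesis
      using frac_cov_minus[of a "u - v"] by (simp add: mult.commute)
  qed (rule *)
qed

text \<open>X_s only integrates over times u >= 0. After rescaling these times are s - p and s - q,
  so the constraint becomes s >= p and s >= q.\<close>

definition window :: "real \<Rightarrow> real \<Rightarrow> real \<Rightarrow> real \<Rightarrow> real" where
  "window t p q s = indicator {0..t} s * indicator {p..} s * indicator {q..} s"

lemma window_measurable [measurable (raw)]:
  assumes [measurable]: "p \<in> borel_measurable M" "q \<in> borel_measurable M" "s \<in> borel_measurable M"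
  shows "(\<lambda>x. window t (p x) (q x) (s x)) \<in> borel_measurable M"
proof -
  have "(\<lambda>x. window t (p x) (q x) (s x)) = (\<lambda>x. indicator {x. 0 \<le> s x \<and> s x \<le> t \<and> p x \<le> s x \<and> q x \<le> s x} x)"
    by (auto simp: window_def indicator_def fun_eq_iff)
  moreover have "(\<lambda>x. indicator {x. 0 \<le> s x \<and> s x \<le> t \<and> p x \<le> s x \<and> q x \<le> s x} x :: real) \<in> borel_measurable M"
    by measurable
  ultimately show ?thesis by simp
qed

lemma window_nonneg [simp]: "0 \<le> window t p q s" by (simp add: window_def)

definition window_kernel :: "real \<Rightarrow> real \<Rightarrow> real \<Rightarrow> real \<Rightarrow> real \<Rightarrow> real \<times> real \<Rightarrow> real" where
  "window_kernel a t p q s z =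
     window t p q s * (frac_kernel a (s - p) (fst z) * frac_kernel a (s - q) (snd z))"

lemma window_kernel_nonneg [simp]: "0 \<le> window_kernel a t p q s z"
  by (simp add: window_kernel_def)

lemma window_kernel_measurable [measurable (raw)]:
  assumes [measurable]: "p \<in> borel_measurable M" "q \<in> borel_measurable M" "s \<in> borel_measurable M"
    "z \<in> measurable M plane"
  shows "(\<lambda>x. window_kernel a t (p x) (q x) (s x) (z x)) \<in> borel_measurable M"
proof -
  have [measurable]: "(\<lambda>x. fst (z x)) \<in> borel_measurable M" "(\<lambda>x. snd (z x)) \<in> borel_measurable M"
    using measurable_compose[OF assms(4) measurable_fst] measurable_compose[OF assms(4) measurable_snd]
    by simp_all
  show ?thesis unfolding window_kernel_def by measurable
qed

text \<open>Valued in \<open>ennreal\<close>, so that Tonelli's theorem and Fatou's lemma apply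
  before finiteness almost everywhere is known. For p = q = 0 it is the Rosenblatt kernel up to a
  constant.\<close>

definition shifted_kernel :: "real \<Rightarrow> real \<Rightarrow> real \<Rightarrow> real \<Rightarrow> real \<times> real \<Rightarrow> ennreal" where
  "shifted_kernel a t p q z = (\<integral>\<^sup>+s. ennreal (window_kernel a t p q s z) \<partial>lborel)"

lemma shifted_kernel_measurable [measurable (raw)]:
  assumes [measurable]: "p \<in> borel_measurable M" "q \<in> borel_measurable M" "z \<in> measurable M plane"
  shows "(\<lambda>x. shifted_kernel a t (p x) (q x) (z x)) \<in> borel_measurable M"
  unfolding shifted_kernel_def by measurable

text \<open>Tonelli's theorem separates the two coordinates of z, and each of them yields one
  \<open>frac_cov\<close>. For fixed s only two values of r are exceptional in
  \<open>frac_kernel_inner\<close>.\<close>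

lemma shifted_kernel_inner:
  assumes a: "-1 < a" "a < -1/2"
  shows "(\<integral>\<^sup>+z. shifted_kernel a t p q z * shifted_kernel a t p' q' z \<partial>plane) =
    (\<integral>\<^sup>+s. \<integral>\<^sup>+r. ennreal (window t p q s * window t p' q' r *
      (frac_cov a (s - p - (r - p')) * frac_cov a (s - q - (r - q')))) \<partial>lborel \<partial>lborel)"
proof -
  have "(\<integral>\<^sup>+z. shifted_kernel a t p q z * shifted_kernel a t p' q' z \<partial>plane) =
    (\<integral>\<^sup>+s. \<integral>\<^sup>+r. \<integral>\<^sup>+z. ennreal (window_kernel a t p q s z) * ennreal (window_kernel a t p' q' r z)
      \<partial>plane \<partial>lborel \<partial>lborel)"
    unfolding shifted_kernel_def
    by (intro nn_integral_mult_iterated lborel.sigma_finite_measure_axioms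
        lborel_pair.sigma_finite_measure_axioms) measurable
  also have "\<dots> = (\<integral>\<^sup>+s. \<integral>\<^sup>+r. ennreal (window t p q s * window t p' q' r *
      (frac_cov a (s - p - (r - p')) * frac_cov a (s - q - (r - q')))) \<partial>lborel \<partial>lborel)"
  proof (rule nn_integral_cong, rule nn_integral_cong_AE)
    fix s :: real
    have "AE r in lborel. r \<noteq> s - p + p'" "AE r in lborel. r \<noteq> s - q + q'"
      by (rule AE_lborel_singleton)+
    then show "AE r in lborel. (\<integral>\<^sup>+z. ennreal (window_kernel a t p q s z) * ennreal (window_kernel a t p' q' r z) \<partial>plane) =
        ennreal (window t p q s * window t p' q' r *
          (frac_cov a (s - p - (r - p')) * frac_cov a (s - q - (r - q'))))"
    proof eventually_elim
      case (elim r)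
      let ?F = "\<lambda>\<xi>. ennreal (frac_kernel a (s - p) \<xi>) * ennreal (frac_kernel a (r - p') \<xi>)"
      let ?G = "\<lambda>\<xi>. ennreal (frac_kernel a (s - q) \<xi>) * ennreal (frac_kernel a (r - q') \<xi>)"
      have "(\<integral>\<^sup>+z. ennreal (window_kernel a t p q s z) * ennreal (window_kernel a t p' q' r z) \<partial>plane) =
          (\<integral>\<^sup>+z. ennreal (window t p q s * window t p' q' r) * (?F (fst z) * ?G (snd z)) \<partial>plane)"
        by (intro nn_integral_cong) (simp add: window_kernel_def ac_simps flip: ennreal_mult)
      also have "\<dots> = ennreal (window t p q s * window t p' q' r) * (\<integral>\<^sup>+z. ?F (fst z) * ?G (snd z) \<partial>plane)"
        by (rule nn_integral_cmult) measurable
      also have "(\<integral>\<^sup>+z. ?F (fst z) * ?G (snd z) \<partial>plane) = (\<integral>\<^sup>+\<xi>. ?F \<xi> \<partial>lborel) * (\<integral>\<^sup>+\<xi>. ?G \<xi> \<partial>lborel)"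
        by (rule lborel_pair.nn_integral_tensor) measurable
      also have "\<dots> = ennreal (frac_cov a (s - p - (r - p'))) * ennreal (frac_cov a (s - q - (r - q')))"
        using elim by (subst (1 2) frac_kernel_inner[OF a]) auto
      finally show ?case by (simp add: ennreal_mult)
    qed
  qed
  finally show ?thesis .
qed

text \<open>The squared norm of the unshifted kernel, which also bounds those of all shifted
  kernels.\<close>

definition cov_energy :: "real \<Rightarrow> real \<Rightarrow> ennreal" where
  "cov_energy a t = (\<integral>\<^sup>+s. \<integral>\<^sup>+r. ennreal (indicator {0..t} s * indicator {0..t} r * (frac_cov a (s - r))\<^sup>2)
     \<partial>lborel \<partial>lborel)"

text \<open>The singularity \<open>\<bar>s - r\<bar> powr (4 * a + 2)\<close> is integrable because \<open>H > 3/4\<close>.\<close>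

lemma cov_energy_finite:
  assumes "-3/4 < a"
  shows "cov_energy a t < \<infinity>"
proof -
  let ?K = "\<integral>\<^sup>+y. ennreal (indicator {-t..t} y * \<bar>y\<bar> powr (4 * a + 2)) \<partial>lborel"
  have "cov_energy a t \<le> (\<integral>\<^sup>+s. indicator {0..t} s * (ennreal ((frac_const a)\<^sup>2) * ?K) \<partial>lborel)"
    unfolding cov_energy_def
  proof (rule nn_integral_mono)
    fix s :: real
    have "(\<integral>\<^sup>+r. ennreal (indicator {0..t} s * indicator {0..t} r * (frac_cov a (s - r))\<^sup>2) \<partial>lborel) =
        (\<integral>\<^sup>+y. ennreal (indicator {0..t} s * indicator {0..t} (s - y) * (frac_cov a y)\<^sup>2) \<partial>lborel)"
      using nn_integral_real_affine[of "\<lambda>r. ennreal (indicator {0..t} s * indicator {0..t} r * (frac_cov a (s - r))\<^sup>2)" "- 1" s]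
      by simp
    also have "\<dots> \<le> (\<integral>\<^sup>+y. indicator {0..t} s * (ennreal ((frac_const a)\<^sup>2) *
        ennreal (indicator {-t..t} y * \<bar>y\<bar> powr (4 * a + 2))) \<partial>lborel)"
    proof (rule nn_integral_mono)
      fix y :: real
      have "(frac_cov a y)\<^sup>2 = (frac_const a)\<^sup>2 * \<bar>y\<bar> powr (4 * a + 2)"
        using powr_add[of "\<bar>y\<bar>" "2 * a + 1" "2 * a + 1"]
        by (simp add: frac_cov_def power_mult_distrib power2_eq_square)
      then show "ennreal (indicator {0..t} s * indicator {0..t} (s - y) * (frac_cov a y)\<^sup>2) \<le>
          indicator {0..t} s * (ennreal ((frac_const a)\<^sup>2) * ennreal (indicator {-t..t} y * \<bar>y\<bar> powr (4 * a + 2)))"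
        by (auto simp: indicator_def ennreal_mult[symmetric])
    qed
    also have "\<dots> = indicator {0..t} s * (ennreal ((frac_const a)\<^sup>2) * ?K)"
      by (subst nn_integral_cmult; (subst nn_integral_cmult)?) auto
    finally show "(\<integral>\<^sup>+r. ennreal (indicator {0..t} s * indicator {0..t} r * (frac_cov a (s - r))\<^sup>2) \<partial>lborel) \<le>
        indicator {0..t} s * (ennreal ((frac_const a)\<^sup>2) * ?K)" .
  qed
  also have "\<dots> = emeasure lborel {0..t} * (ennreal ((frac_const a)\<^sup>2) * ?K)"
    by (subst nn_integral_multc) auto
  also have "\<dots> < \<infinity>"
    using nn_integral_abs_powr_finite[of "4 * a + 2" t] assms
    by (cases "0 \<le> t") (auto simp: ennreal_mult_less_top)
  finally show ?thesis .
qed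

text \<open>When a kernel is paired with itself, the shifts cancel and leave s - r in both
  covariances; the window is contained in [0, t].\<close>

lemma shifted_kernel_norm_le:
  assumes "-1 < a" "a < -1/2"
  shows "(\<integral>\<^sup>+z. (shifted_kernel a t p q z)\<^sup>2 \<partial>plane) \<le> cov_energy a t"
proof -
  have "(\<integral>\<^sup>+z. (shifted_kernel a t p q z)\<^sup>2 \<partial>plane) =
      (\<integral>\<^sup>+s. \<integral>\<^sup>+r. ennreal (window t p q s * window t p q r *
        (frac_cov a (s - p - (r - p)) * frac_cov a (s - q - (r - q)))) \<partial>lborel \<partial>lborel)"
    unfolding power2_eq_square by (rule shifted_kernel_inner[OF assms])
  also have "\<dots> \<le> cov_energy a t"
    unfolding cov_energy_def
    by (intro nn_integral_mono ennreal_leI)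
      (auto simp: window_def indicator_def power2_eq_square)
  finally show ?thesis .
qed

lemma shifted_kernel_norm_0:
  assumes "-1 < a" "a < -1/2"
  shows "(\<integral>\<^sup>+z. (shifted_kernel a t 0 0 z)\<^sup>2 \<partial>plane) = cov_energy a t"
proof -
  have "(\<integral>\<^sup>+z. (shifted_kernel a t 0 0 z)\<^sup>2 \<partial>plane) =
      (\<integral>\<^sup>+s. \<integral>\<^sup>+r. ennreal (window t 0 0 s * window t 0 0 r *
        (frac_cov a (s - 0 - (r - 0)) * frac_cov a (s - 0 - (r - 0)))) \<partial>lborel \<partial>lborel)"
    unfolding power2_eq_square by (rule shifted_kernel_inner[OF assms])
  also have "\<dots> = cov_energy a t"
    unfolding cov_energy_def
    by (intro nn_integral_cong arg_cong[where f = ennreal])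
      (auto simp: window_def indicator_def power2_eq_square)
  finally show ?thesis .
qed

text \<open>In the formula for the inner product, convergence of the shifts becomes pointwise
  convergence of a nonnegative integrand. Fatou's lemma then gives the lower bound without a
  dominating function.\<close>

lemma shifted_kernel_liminf:
  assumes a: "-1 < a" "a < -1/2"
    and p: "p \<longlonglongrightarrow> 0" and q: "q \<longlonglongrightarrow> 0"
  shows "cov_energy a t \<le> liminf (\<lambda>n. \<integral>\<^sup>+z. shifted_kernel a t (p n) (q n) z * shifted_kernel a t 0 0 z \<partial>plane)"
proof -
  let ?g = "\<lambda>p q z. ennreal (window t p q (fst z) * window t 0 0 (snd z) *
      (frac_cov a (fst z - p - (snd z - 0)) * frac_cov a (fst z - q - (snd z - 0))))"
  have eq: "(\<integral>\<^sup>+z. shifted_kernel a t p q z * shifted_kernel a t 0 0 z \<partial>plane) = (\<integral>\<^sup>+z. ?g p q z \<partial>plane)" for p q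
    unfolding shifted_kernel_inner[OF a]
    by (subst lborel.nn_integral_fst[symmetric]) auto
  \<comment> \<open>Excluded are s = 0, where the window may jump in the limit, and s = r, where
    \<open>frac_cov\<close> is singular.\<close>
  have "AE z in plane. fst z \<noteq> 0 \<and> fst z \<noteq> snd z"
  proof (rule lborel_pair.AE_pair_measure)
    have "AE s in lborel. s \<noteq> (0::real)" by (rule AE_lborel_singleton)
    then show "AE s in lborel. AE r in lborel. fst (s, r) \<noteq> 0 \<and> fst (s, r) \<noteq> (snd (s, r) :: real)"
    proof eventually_elim
      case (elim s)
      from AE_lborel_singleton[of s] show ?case
        by eventually_elim (use elim in auto)
    qed
  qed measurable
  then have lim: "AE z in plane. (\<lambda>n. ?g (p n) (q n) z) \<longlonglongrightarrow> ?g 0 0 z"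
  proof eventually_elim
    case (elim z)
    have w: "(\<lambda>n. window t (p n) (q n) (fst z)) \<longlonglongrightarrow> window t 0 0 (fst z)"
    proof (cases "fst z < 0")
      case True
      then show ?thesis by (simp add: window_def)
    next
      case False
      then have "0 < fst z" using elim by simp
      then have "eventually (\<lambda>n. p n < fst z) sequentially" "eventually (\<lambda>n. q n < fst z) sequentially"
        using order_tendstoD(2)[OF p] order_tendstoD(2)[OF q] by auto
      then have "eventually (\<lambda>n. window t (p n) (q n) (fst z) = window t 0 0 (fst z)) sequentially"
        by eventually_elim (use \<open>0 < fst z\<close> in \<open>auto simp: window_def indicator_def\<close>)
      then show ?thesis by (rule tendsto_eventually)
    qed
    have c: "(\<lambda>n. frac_cov a (fst z - p n - (snd z - 0))) \<longlonglongrightarrow> frac_cov a (fst z - 0 - (snd z - 0))"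
      if p: "p \<longlonglongrightarrow> 0" for p
      unfolding frac_cov_def using elim p by (intro tendsto_intros) auto
    show ?case by (intro tendsto_ennrealI tendsto_mult w c p q tendsto_const)
  qed
  have "cov_energy a t = (\<integral>\<^sup>+z. ?g 0 0 z \<partial>plane)"
    using shifted_kernel_norm_0[OF a, of t] eq[of 0 0] by (simp add: power2_eq_square)
  also have "\<dots> = (\<integral>\<^sup>+z. liminf (\<lambda>n. ?g (p n) (q n) z) \<partial>plane)"
  proof (rule nn_integral_cong_AE)
    from lim show "AE z in plane. ?g 0 0 z = liminf (\<lambda>n. ?g (p n) (q n) z)"
      by eventually_elim (rule lim_imp_Liminf[symmetric], simp)
  qed
  also have "\<dots> \<le> liminf (\<lambda>n. \<integral>\<^sup>+z. ?g (p n) (q n) z \<partial>plane)"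
    by (rule nn_integral_liminf) measurable
  finally show ?thesis by (simp only: eq)
qed

lemma shifted_kernel_finite:
  assumes "-3/4 < a" "a < -1/2"
  shows "AE z in plane. shifted_kernel a t p q z < \<infinity>"
proof -
  have "(\<integral>\<^sup>+z. (shifted_kernel a t p q z)\<^sup>2 \<partial>plane) \<noteq> \<infinity>"
    using shifted_kernel_norm_le[of a t p q] cov_energy_finite[of a t] assms
    by (auto simp: less_top[symmetric] top_unique)
  from nn_integral_PInf_AE[OF _ this] have "AE z in plane. (shifted_kernel a t p q z)\<^sup>2 \<noteq> \<infinity>" by simp
  then show ?thesis
    by eventually_elim (auto simp: less_top power2_eq_square ennreal_mult_eq_top_iff)
qed

text \<open>The expansion of a squared distance, with the mixed term kept on the left because
  subtraction in \<open>ennreal\<close> is truncated.\<close>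

lemma shifted_kernel_diff:
  assumes a: "-3/4 < a" "a < -1/2"
  shows "(\<integral>\<^sup>+z. ennreal ((enn2real (shifted_kernel a t p q z) - enn2real (shifted_kernel a t 0 0 z))\<^sup>2) \<partial>plane)
      + 2 * (\<integral>\<^sup>+z. shifted_kernel a t p q z * shifted_kernel a t 0 0 z \<partial>plane) \<le> 2 * cov_energy a t"
proof -
  have a': "-1 < a" using a by simp
  let ?f = "shifted_kernel a t p q" and ?g = "shifted_kernel a t 0 0"
  have "(\<integral>\<^sup>+z. ennreal ((enn2real (?f z) - enn2real (?g z))\<^sup>2) \<partial>plane) + 2 * (\<integral>\<^sup>+z. ?f z * ?g z \<partial>plane) =
      (\<integral>\<^sup>+z. ennreal ((enn2real (?f z) - enn2real (?g z))\<^sup>2) + 2 * (?f z * ?g z) \<partial>plane)"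
    by (simp add: nn_integral_add nn_integral_cmult)
  also have "\<dots> = (\<integral>\<^sup>+z. (?f z)\<^sup>2 + (?g z)\<^sup>2 \<partial>plane)"
  proof (rule nn_integral_cong_AE)
    from shifted_kernel_finite[OF a, of t p q] shifted_kernel_finite[OF a, of t 0 0]
    show "AE z in plane. ennreal ((enn2real (?f z) - enn2real (?g z))\<^sup>2) + 2 * (?f z * ?g z) = (?f z)\<^sup>2 + (?g z)\<^sup>2"
    proof eventually_elim
      case (elim z)
      obtain x y where x: "?f z = ennreal x" "0 \<le> x" and y: "?g z = ennreal y" "0 \<le> y"
        using elim by (metis less_top_ennreal infinity_ennreal_def)
      have "ennreal ((x - y)\<^sup>2) + 2 * (ennreal x * ennreal y) = ennreal ((x - y)\<^sup>2 + 2 * (x * y))"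
        using x y by (simp add: ennreal_mult ennreal_plus)
      also have "(x - y)\<^sup>2 + 2 * (x * y) = x\<^sup>2 + y\<^sup>2" by (simp add: power2_eq_square algebra_simps)
      finally show ?case using x y by (simp add: ennreal_power)
    qed
  qed
  also have "\<dots> = (\<integral>\<^sup>+z. (?f z)\<^sup>2 \<partial>plane) + (\<integral>\<^sup>+z. (?g z)\<^sup>2 \<partial>plane)"
    by (rule nn_integral_add) measurable
  also have "\<dots> \<le> cov_energy a t + cov_energy a t"
    using a' a by (intro add_mono shifted_kernel_norm_le) auto
  finally show ?thesis by (simp add: mult_2)
qed

text \<open>
  Translating the two factors does not increase the norm, so lower semicontinuity of the
  inner product (Fatou's lemma) is enough for convergence in norm.
\<close>

lemma shifted_kernel_tendsto:
  assumes a: "-3/4 < a" "a < -1/2" and p: "p \<longlonglongrightarrow> 0" and q: "q \<longlonglongrightarrow> 0"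
  shows "(\<lambda>n. \<integral>\<^sup>+z. ennreal ((enn2real (shifted_kernel a t (p n) (q n) z)
    - enn2real (shifted_kernel a t 0 0 z))\<^sup>2) \<partial>plane) \<longlonglongrightarrow> 0" (is "?D \<longlonglongrightarrow> 0")
proof -
  obtain \<theta> where \<theta>: "cov_energy a t = ennreal \<theta>" "0 \<le> \<theta>"
    using cov_energy_finite[OF a(1), of t] by (cases "cov_energy a t") auto
  let ?c = "\<lambda>n. \<integral>\<^sup>+z. shifted_kernel a t (p n) (q n) z * shifted_kernel a t 0 0 z \<partial>plane"
  have D: "?D n + 2 * ?c n \<le> ennreal (2 * \<theta>)" for n
    using shifted_kernel_diff[OF a, of t "p n" "q n"] \<theta> by (simp add: ennreal_mult)
  have le: "ennreal \<theta> \<le> liminf ?c"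
    using shifted_kernel_liminf[OF _ a(2) p q, of t] a \<theta> by simp
  show ?thesis
  proof (rule order_tendstoI)
    fix e :: ennreal assume "0 < e"
    then obtain e0 where e0: "0 < e0" "e0 < e" using dense by blast
    then obtain e' where e': "e0 = ennreal e'" "0 < e'"
      by (cases e0) (auto simp: ennreal_less_zero_iff)
    have small: "?D n < e" if "?D n \<le> ennreal (e' / 2)" for n
    proof -
      have "ennreal (e' / 2) \<le> ennreal e'" using e' by (intro ennreal_leI) simp
      with that have "?D n \<le> e0" using e' by (simp add: order_trans[OF that])
      then show ?thesis using e0(2) by (rule le_less_trans)
    qed
    show "eventually (\<lambda>n. ?D n < e) sequentially"
    \<comment> \<open>In the first case the bound 2 \<open>\<theta>\<close> is already small. In the
      second \<open>\<theta> - e' / 4\<close> is positive, so \<open>ennreal\<close> does not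
      truncate it.\<close>
    proof (cases "\<theta> \<le> e' / 4")
      case True
      have "?D n \<le> ennreal (e' / 2)" for n
      proof -
        have "?D n \<le> ?D n + 2 * ?c n" by simp
        also have "\<dots> \<le> ennreal (2 * \<theta>)" by (rule D)
        also have "\<dots> \<le> ennreal (e' / 2)" using True by (intro ennreal_leI) simp
        finally show ?thesis .
      qed
      then show ?thesis by (intro always_eventually allI small)
    next
      case False
      then have "ennreal (\<theta> - e' / 4) < ennreal \<theta>"
        using e' by (intro ennreal_lessI) auto
      from less_LiminfD[OF less_le_trans[OF this le]]
      have "eventually (\<lambda>n. ennreal (\<theta> - e' / 4) < ?c n) sequentially" .
      then show ?thesis
      proof eventually_elim
        case (elim n)
        have "?D n + ennreal (2 * \<theta> - e' / 2) = ?D n + 2 * ennreal (\<theta> - e' / 4)"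
          using False by (simp add: ennreal_mult[symmetric] flip: ennreal_numeral)
        also have "\<dots> \<le> ?D n + 2 * ?c n"
          using elim by (intro add_left_mono mult_left_mono) auto
        also have "\<dots> \<le> ennreal (2 * \<theta>)" by (rule D)
        also have "\<dots> = ennreal (e' / 2) + ennreal (2 * \<theta> - e' / 2)"
          using False e' by (simp flip: ennreal_plus)
        finally show ?case
          by (intro small) (simp add: ennreal_add_left_cancel_le add.commute)
      qed
    qed
  qed auto
qed

section \<open>Averages of translated kernels\<close>

lemma abs_integral_le_nn_integral:
  fixes f :: "'a \<Rightarrow> real"
  shows "ennreal \<bar>LINT x|M. f x\<bar> \<le> (\<integral>\<^sup>+x. ennreal \<bar>f x\<bar> \<partial>M)"
  using integral_norm_bound_ennreal[of M f] not_integrable_integral_eq[of M f]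
  by (cases "integrable M f") auto

text \<open>The weight is split into two square roots, one for each factor.\<close>

lemma weighted_Cauchy_Schwarz:
  assumes [measurable]: "g \<in> borel_measurable M" "f \<in> borel_measurable M"
  shows "(\<integral>\<^sup>+x. ennreal \<bar>g x\<bar> * f x \<partial>M)\<^sup>2 \<le>
    (\<integral>\<^sup>+x. ennreal \<bar>g x\<bar> \<partial>M) * (\<integral>\<^sup>+x. ennreal \<bar>g x\<bar> * (f x)\<^sup>2 \<partial>M)"
proof -
  let ?r = "\<lambda>x. ennreal (sqrt \<bar>g x\<bar>)"
  have r: "?r x * ?r x = ennreal \<bar>g x\<bar>" for x
    by (simp flip: ennreal_mult)
  have "(\<integral>\<^sup>+x. ennreal \<bar>g x\<bar> * f x \<partial>M)\<^sup>2 = (\<integral>\<^sup>+x. ?r x * (?r x * f x) \<partial>M)\<^sup>2"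
    by (simp add: r flip: mult.assoc)
  also have "\<dots> \<le> (\<integral>\<^sup>+x. (?r x)\<^sup>2 \<partial>M) * (\<integral>\<^sup>+x. (?r x * f x)\<^sup>2 \<partial>M)"
    by (rule Cauchy_Schwarz_nn_integral) measurable
  also have "\<dots> = (\<integral>\<^sup>+x. ennreal \<bar>g x\<bar> \<partial>M) * (\<integral>\<^sup>+x. ennreal \<bar>g x\<bar> * (f x)\<^sup>2 \<partial>M)"
    by (simp add: power_mult_distrib r power2_eq_square[of "?r _"])
  finally show ?thesis .
qed

lemma ennreal_enn2real_le: "ennreal (enn2real x) \<le> x"
  by (cases x) auto

text \<open>The kernel of X_s up to the factor \<open>hermite_const 1 H\<close>; y stands for a
  Borel version of x.\<close>

definition volterra_kernel :: "real \<Rightarrow> (real \<Rightarrow> real) \<Rightarrow> real \<Rightarrow> real \<Rightarrow> real" where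
  "volterra_kernel a y s \<xi> = (LINT u|lborel. indicator {0..s} u * y (s - u) * frac_kernel a u \<xi>)"

lemma indicator_Icc_measurable:
  assumes [measurable]: "f \<in> borel_measurable M" "g \<in> borel_measurable M" "h \<in> borel_measurable M"
  shows "(\<lambda>x. indicator {f x..g x} (h x :: real) :: real) \<in> borel_measurable M"
proof -
  have "(\<lambda>x. indicator {f x..g x} (h x)) = (\<lambda>x. indicator {x. f x \<le> h x \<and> h x \<le> g x} x :: real)"
    by (auto simp: indicator_def fun_eq_iff)
  moreover have "(\<lambda>x. indicator {x. f x \<le> h x \<and> h x \<le> g x} x :: real) \<in> borel_measurable M"
    by measurable
  ultimately show ?thesis by simp
qed

lemma volterra_kernel_measurable [measurable (raw)]:
  assumes [measurable]: "y \<in> borel_measurable borel" "f \<in> borel_measurable M" "g \<in> borel_measurable M"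
  shows "(\<lambda>x. volterra_kernel a y (f x) (g x)) \<in> borel_measurable M"
proof -
  have [measurable]: "(\<lambda>z. indicator {0..f (fst z)} (snd z :: real) :: real) \<in> borel_measurable (M \<Otimes>\<^sub>M lborel)"
    by (rule indicator_Icc_measurable) measurable
  show ?thesis unfolding volterra_kernel_def by measurable
qed

definition frac_energy :: "real \<Rightarrow> (real \<Rightarrow> real) \<Rightarrow> ennreal" where
  "frac_energy a y = (\<integral>\<^sup>+u. \<integral>\<^sup>+v. ennreal (\<bar>y u\<bar> * \<bar>y v\<bar> * \<bar>u - v\<bar> powr (2 * a + 1)) \<partial>lborel \<partial>lborel)"

text \<open>The bound is uniform in s: reflecting u to s - u removes s from the integrand once the
  restriction to [0, s] is dropped.\<close>

lemma volterra_kernel_norm: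
  assumes a: "-1 < a" "a < -1/2" and [measurable]: "y \<in> borel_measurable borel"
  shows "(\<integral>\<^sup>+\<xi>. ennreal ((volterra_kernel a y s \<xi>)\<^sup>2) \<partial>lborel) \<le> ennreal (frac_const a) * frac_energy a y"
proof -
  let ?F = "\<lambda>u \<xi>. ennreal (indicator {0..s} u * \<bar>y (s - u)\<bar> * frac_kernel a u \<xi>)"
  let ?e = "\<lambda>u v. ennreal (frac_const a) * ennreal (\<bar>y u\<bar> * \<bar>y v\<bar> * \<bar>u - v\<bar> powr (2 * a + 1))"
  have "(\<integral>\<^sup>+\<xi>. ennreal ((volterra_kernel a y s \<xi>)\<^sup>2) \<partial>lborel) \<le>
      (\<integral>\<^sup>+\<xi>. (\<integral>\<^sup>+u. ?F u \<xi> \<partial>lborel) * (\<integral>\<^sup>+v. ?F v \<xi> \<partial>lborel) \<partial>lborel)"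
  proof (rule nn_integral_mono)
    fix \<xi> :: real
    have "ennreal \<bar>volterra_kernel a y s \<xi>\<bar> \<le> (\<integral>\<^sup>+u. ?F u \<xi> \<partial>lborel)"
      unfolding volterra_kernel_def
      using abs_integral_le_nn_integral[of lborel "\<lambda>u. indicator {0..s} u * y (s - u) * frac_kernel a u \<xi>"]
      by (simp add: abs_mult)
    from power_mono[OF this, of 2] show "ennreal ((volterra_kernel a y s \<xi>)\<^sup>2) \<le>
        (\<integral>\<^sup>+u. ?F u \<xi> \<partial>lborel) * (\<integral>\<^sup>+v. ?F v \<xi> \<partial>lborel)"
      by (simp add: ennreal_power power2_eq_square[of "\<integral>\<^sup>+u. _ u \<partial>lborel"])
  qed
  also have "\<dots> = (\<integral>\<^sup>+u. \<integral>\<^sup>+v. \<integral>\<^sup>+\<xi>. ?F u \<xi> * ?F v \<xi> \<partial>lborel \<partial>lborel \<partial>lborel)"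
    by (intro nn_integral_mult_iterated lborel.sigma_finite_measure_axioms) measurable
  also have "\<dots> \<le> (\<integral>\<^sup>+u. \<integral>\<^sup>+v. ?e (s - u) (s - v) \<partial>lborel \<partial>lborel)"
  proof (rule nn_integral_mono, rule nn_integral_mono_AE)
    fix u :: real
    from AE_lborel_singleton[of u]
    show "AE v in lborel. (\<integral>\<^sup>+\<xi>. ?F u \<xi> * ?F v \<xi> \<partial>lborel) \<le> ?e (s - u) (s - v)"
    proof eventually_elim
      case (elim v)
      let ?w = "indicator {0..s} u * \<bar>y (s - u)\<bar> * (indicator {0..s} v * \<bar>y (s - v)\<bar>)"
      have "(\<integral>\<^sup>+\<xi>. ?F u \<xi> * ?F v \<xi> \<partial>lborel) =
          (\<integral>\<^sup>+\<xi>. ennreal ?w * (ennreal (frac_kernel a u \<xi>) * ennreal (frac_kernel a v \<xi>)) \<partial>lborel)"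
        by (intro nn_integral_cong) (simp add: ac_simps flip: ennreal_mult)
      also have "\<dots> = ennreal ?w * ennreal (frac_cov a (u - v))"
        using elim by (subst nn_integral_cmult) (auto simp: frac_kernel_inner[OF a])
      also have "\<dots> \<le> ?e (s - u) (s - v)"
        by (auto simp: indicator_def frac_cov_def abs_minus_commute[of v u] ac_simps frac_const_def
            intro!: ennreal_leI simp flip: ennreal_mult)
      finally show ?case .
    qed
  qed
  also have "\<dots> = (\<integral>\<^sup>+u. \<integral>\<^sup>+v. ?e u v \<partial>lborel \<partial>lborel)"
  proof -
    have e1: "(\<integral>\<^sup>+v. ?e u (s - v) \<partial>lborel) = (\<integral>\<^sup>+v. ?e u v \<partial>lborel)" for u
      using nn_integral_real_affine[of "\<lambda>v. ?e u v" "- 1" s] by simp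
    have "(\<integral>\<^sup>+u. \<integral>\<^sup>+v. ?e (s - u) (s - v) \<partial>lborel \<partial>lborel) = (\<integral>\<^sup>+u. \<integral>\<^sup>+v. ?e (s - u) v \<partial>lborel \<partial>lborel)"
      by (simp only: e1)
    also have "\<dots> = (\<integral>\<^sup>+u. \<integral>\<^sup>+v. ?e u v \<partial>lborel \<partial>lborel)"
      using nn_integral_real_affine[of "\<lambda>u. \<integral>\<^sup>+v. ?e u v \<partial>lborel" "- 1" s] by simp
    finally show ?thesis .
  qed
  also have "\<dots> = ennreal (frac_const a) * frac_energy a y"
    unfolding frac_energy_def by (subst nn_integral_cmult; (subst nn_integral_cmult)?) auto
  finally show ?thesis .
qed

text \<open>A mixture of shifted kernels with signed weights independent of T, so that T occurs in
  the shifts alone. Up to constants it is the kernel of G_T after Brownian scaling.\<close>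

definition averaged_kernel :: "real \<Rightarrow> real \<Rightarrow> (real \<Rightarrow> real) \<Rightarrow> real \<Rightarrow> real \<times> real \<Rightarrow> real" where
  "averaged_kernel a t y T z = (LINT w|plane. y (fst w) * y (snd w) *
     enn2real (shifted_kernel a t (fst w / T) (snd w / T) z))"

text \<open>By the weighted Cauchy-Schwarz inequality, the squared norm of the average is at most
  the squared total weight times \<open>cov_energy a t\<close>. The finiteness obtained here
  licenses Fubini's theorem at almost every z.\<close>

lemma shifted_kernel_average_finite:
  assumes a: "-3/4 < a" "a < -1/2" and y: "integrable lborel y"
  shows "AE z in plane. (\<integral>\<^sup>+w. ennreal \<bar>y (fst w) * y (snd w)\<bar> *
      shifted_kernel a t (fst w / T) (snd w / T) z \<partial>plane) < \<infinity>"
proof -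
  let ?Y = "\<lambda>w. y (fst w) * y (snd w)"
  let ?S = "\<lambda>w. shifted_kernel a t (fst w / T) (snd w / T)"
  have [measurable]: "y \<in> borel_measurable borel" using y by auto
  have Y: "integrable plane ?Y" by (rule lborel_pair.integral_tensor[OF y y])
  let ?N = "\<integral>\<^sup>+w. ennreal \<bar>?Y w\<bar> \<partial>plane"
  have N: "?N < \<infinity>" using Y by (auto simp: integrable_iff_bounded)
  have "(\<integral>\<^sup>+z. (\<integral>\<^sup>+w. ennreal \<bar>?Y w\<bar> * ?S w z \<partial>plane)\<^sup>2 \<partial>plane) \<le>
      (\<integral>\<^sup>+z. ?N * (\<integral>\<^sup>+w. ennreal \<bar>?Y w\<bar> * (?S w z)\<^sup>2 \<partial>plane) \<partial>plane)"
    by (intro nn_integral_mono weighted_Cauchy_Schwarz) measurable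
  also have "\<dots> = ?N * (\<integral>\<^sup>+z. \<integral>\<^sup>+w. ennreal \<bar>?Y w\<bar> * (?S w z)\<^sup>2 \<partial>plane \<partial>plane)"
    by (rule nn_integral_cmult) measurable
  also have "(\<integral>\<^sup>+z. \<integral>\<^sup>+w. ennreal \<bar>?Y w\<bar> * (?S w z)\<^sup>2 \<partial>plane \<partial>plane) =
      (\<integral>\<^sup>+w. \<integral>\<^sup>+z. ennreal \<bar>?Y w\<bar> * (?S w z)\<^sup>2 \<partial>plane \<partial>plane)"
    by (intro pair_sigma_finite.Fubini' pair_sigma_finite.intro lborel_pair.sigma_finite_measure_axioms) measurable
  also have "\<dots> = (\<integral>\<^sup>+w. ennreal \<bar>?Y w\<bar> * (\<integral>\<^sup>+z. (?S w z)\<^sup>2 \<partial>plane) \<partial>plane)"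
    by (intro nn_integral_cong nn_integral_cmult) measurable
  also have "\<dots> \<le> (\<integral>\<^sup>+w. ennreal \<bar>?Y w\<bar> * cov_energy a t \<partial>plane)"
    using a by (intro nn_integral_mono mult_left_mono shifted_kernel_norm_le) auto
  also have "\<dots> = ?N * cov_energy a t"
    by (rule nn_integral_multc) measurable
  finally have "(\<integral>\<^sup>+z. (\<integral>\<^sup>+w. ennreal \<bar>?Y w\<bar> * ?S w z \<partial>plane)\<^sup>2 \<partial>plane) \<le> ?N * (?N * cov_energy a t)"
    by (simp add: mult_left_mono)
  also have "\<dots> < \<infinity>"
    using N cov_energy_finite[OF a(1), of t] by (simp add: ennreal_mult_less_top)
  finally have "(\<integral>\<^sup>+z. (\<integral>\<^sup>+w. ennreal \<bar>?Y w\<bar> * ?S w z \<partial>plane)\<^sup>2 \<partial>plane) \<noteq> \<infinity>" by simp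
  from nn_integral_PInf_AE[OF _ this]
  have "AE z in plane. (\<integral>\<^sup>+w. ennreal \<bar>?Y w\<bar> * ?S w z \<partial>plane)\<^sup>2 \<noteq> \<infinity>" by simp
  then show ?thesis
    by eventually_elim (auto simp: less_top power2_eq_square ennreal_mult_eq_top_iff)
qed

text \<open>The same Cauchy-Schwarz bound is applied to the deviations from the unshifted kernel. At
  each weight point the shifts tend to 0, hence so does the squared deviation; twice
  \<open>cov_energy a t\<close> dominates it, and the weights are integrable.\<close>

lemma averaged_kernel_tendsto:
  assumes a: "-3/4 < a" "a < -1/2" and y: "integrable lborel y"
    and T: "filterlim T at_top sequentially"
  shows "(\<lambda>n. \<integral>\<^sup>+z. ennreal ((averaged_kernel a t y (T n) z
    - (LINT v|lborel. y v)\<^sup>2 * enn2real (shifted_kernel a t 0 0 z))\<^sup>2) \<partial>plane) \<longlonglongrightarrow> 0"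
proof -
  let ?Y = "\<lambda>w. y (fst w) * y (snd w)"
  let ?S = "\<lambda>n w. shifted_kernel a t (fst w / T n) (snd w / T n)"
  let ?Z = "shifted_kernel a t 0 0"
  let ?e = "\<lambda>n z. averaged_kernel a t y (T n) z - (LINT v|lborel. y v)\<^sup>2 * enn2real (?Z z)"
  let ?d = "\<lambda>n w z. enn2real (?S n w z) - enn2real (?Z z)"
  let ?D = "\<lambda>n w. \<integral>\<^sup>+z. ennreal ((?d n w z)\<^sup>2) \<partial>plane"
  have [measurable]: "y \<in> borel_measurable borel" using y by auto
  have Y: "integrable plane ?Y" and Yint: "(LINT w|plane. ?Y w) = (LINT v|lborel. y v)\<^sup>2"
    using lborel_pair.integral_tensor[OF y y] by (auto simp: power2_eq_square)
  let ?N = "\<integral>\<^sup>+w. ennreal \<bar>?Y w\<bar> \<partial>plane"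
  have N: "?N < \<infinity>" using Y by (auto simp: integrable_iff_bounded)
  have le: "(\<integral>\<^sup>+z. ennreal ((?e n z)\<^sup>2) \<partial>plane)
      \<le> ?N * (\<integral>\<^sup>+w. ennreal \<bar>?Y w\<bar> * ?D n w \<partial>plane)" for n
  proof -
    have "AE z in plane. ennreal ((?e n z)\<^sup>2) \<le>
        ?N * (\<integral>\<^sup>+w. ennreal \<bar>?Y w\<bar> * ennreal ((?d n w z)\<^sup>2) \<partial>plane)"
      using shifted_kernel_average_finite[OF a y, of t "T n"]
    proof eventually_elim
      case (elim z)
      have [measurable]: "z \<in> space plane" by (simp add: space_pair_measure)
      have "integrable plane (\<lambda>w. ?Y w * enn2real (?S n w z))"
      proof (rule integrableI_bounded)
        have "(\<integral>\<^sup>+w. ennreal (norm (?Y w * enn2real (?S n w z))) \<partial>plane) \<le>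
            (\<integral>\<^sup>+w. ennreal \<bar>?Y w\<bar> * ?S n w z \<partial>plane)"
        proof (rule nn_integral_mono)
          fix w
          have "ennreal (norm (?Y w * enn2real (?S n w z))) = ennreal \<bar>?Y w\<bar> * ennreal (enn2real (?S n w z))"
            by (simp add: abs_mult ennreal_mult)
          also have "\<dots> \<le> ennreal \<bar>?Y w\<bar> * ?S n w z"
            by (intro mult_left_mono ennreal_enn2real_le) auto
          finally show "ennreal (norm (?Y w * enn2real (?S n w z))) \<le> ennreal \<bar>?Y w\<bar> * ?S n w z" .
        qed
        from this elim show "(\<integral>\<^sup>+w. ennreal (norm (?Y w * enn2real (?S n w z))) \<partial>plane) < \<infinity>"
          by (rule le_less_trans)
      qed measurable
      \<comment> \<open>The total weight is the squared integral of y, so the limit kernel can be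
        moved inside the average.\<close>
      then have "?e n z =
          (LINT w|plane. ?Y w * (?d n w z))"
        using Y by (simp add: averaged_kernel_def right_diff_distrib Yint)
      then have "ennreal \<bar>?e n z\<bar> \<le>
          (\<integral>\<^sup>+w. ennreal \<bar>?Y w\<bar> * ennreal \<bar>?d n w z\<bar> \<partial>plane)"
        using abs_integral_le_nn_integral[of plane "\<lambda>w. ?Y w * ?d n w z"]
        by (simp add: abs_mult[of "?Y _"] ennreal_mult)
      from power_mono[OF this, of 2]
      have "ennreal ((?e n z)\<^sup>2) \<le>
          (\<integral>\<^sup>+w. ennreal \<bar>?Y w\<bar> * ennreal \<bar>?d n w z\<bar> \<partial>plane)\<^sup>2"
        by (simp add: ennreal_power)
      also have "\<dots> \<le> ?N * (\<integral>\<^sup>+w. ennreal \<bar>?Y w\<bar> * (ennreal \<bar>?d n w z\<bar>)\<^sup>2 \<partial>plane)"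
        by (rule weighted_Cauchy_Schwarz) measurable
      finally show ?case by (simp add: ennreal_power)
    qed
    then have "(\<integral>\<^sup>+z. ennreal ((?e n z)\<^sup>2) \<partial>plane) \<le>
      (\<integral>\<^sup>+z. ?N * (\<integral>\<^sup>+w. ennreal \<bar>?Y w\<bar> * ennreal ((?d n w z)\<^sup>2) \<partial>plane) \<partial>plane)"
      by (rule nn_integral_mono_AE)
    also have "\<dots> = ?N * (\<integral>\<^sup>+z. \<integral>\<^sup>+w. ennreal \<bar>?Y w\<bar> * ennreal ((?d n w z)\<^sup>2) \<partial>plane \<partial>plane)"
      by (rule nn_integral_cmult) measurable
    also have "(\<integral>\<^sup>+z. \<integral>\<^sup>+w. ennreal \<bar>?Y w\<bar> * ennreal ((?d n w z)\<^sup>2) \<partial>plane \<partial>plane) =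
        (\<integral>\<^sup>+w. \<integral>\<^sup>+z. ennreal \<bar>?Y w\<bar> * ennreal ((?d n w z)\<^sup>2) \<partial>plane \<partial>plane)"
      by (intro pair_sigma_finite.Fubini' pair_sigma_finite.intro lborel_pair.sigma_finite_measure_axioms) measurable
    also have "\<dots> = (\<integral>\<^sup>+w. ennreal \<bar>?Y w\<bar> * ?D n w \<partial>plane)"
      by (intro nn_integral_cong nn_integral_cmult) measurable
    finally show ?thesis .
  qed
  have D_le: "?D n w \<le> 2 * cov_energy a t" for n w
  proof -
    have "?D n w \<le> ?D n w + 2 * (\<integral>\<^sup>+z. ?S n w z * ?Z z \<partial>plane)" by simp
    also have "\<dots> \<le> 2 * cov_energy a t" by (rule shifted_kernel_diff[OF a])
    finally show ?thesis .
  qed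
  have D_lim: "(\<lambda>n. ?D n w) \<longlonglongrightarrow> 0" for w
    by (rule shifted_kernel_tendsto[OF a]) (intro tendsto_divide_0[OF tendsto_const]
        filterlim_at_top_imp_at_infinity T)+
  have "(\<lambda>n. \<integral>\<^sup>+w. ennreal \<bar>?Y w\<bar> * ?D n w \<partial>plane) \<longlonglongrightarrow> (\<integral>\<^sup>+w. 0 \<partial>plane)"
  proof (rule nn_integral_dominated_convergence[where w = "\<lambda>w. ennreal \<bar>?Y w\<bar> * (2 * cov_energy a t)"])
    show "AE w in plane. ennreal \<bar>?Y w\<bar> * ?D n w \<le> ennreal \<bar>?Y w\<bar> * (2 * cov_energy a t)" for n
      by (intro AE_I2 mult_left_mono D_le) auto
    have "(\<integral>\<^sup>+w. ennreal \<bar>?Y w\<bar> * (2 * cov_energy a t) \<partial>plane) = ?N * (2 * cov_energy a t)"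
      by (rule nn_integral_multc) measurable
    also have "\<dots> < \<infinity>" using N cov_energy_finite[OF a(1), of t] by (simp add: ennreal_mult_less_top)
    finally show "(\<integral>\<^sup>+w. ennreal \<bar>?Y w\<bar> * (2 * cov_energy a t) \<partial>plane) < \<infinity>" .
    show "AE w in plane. (\<lambda>n. ennreal \<bar>?Y w\<bar> * ?D n w) \<longlonglongrightarrow> 0"
    proof (rule AE_I2)
      fix w
      from ennreal_tendsto_cmult[OF _ D_lim, of "ennreal \<bar>?Y w\<bar>" w]
      show "(\<lambda>n. ennreal \<bar>?Y w\<bar> * ?D n w) \<longlonglongrightarrow> 0" by simp
    qed
  qed measurable
  then have "(\<lambda>n. ?N * (\<integral>\<^sup>+w. ennreal \<bar>?Y w\<bar> * ?D n w \<partial>plane)) \<longlonglongrightarrow> ?N * 0"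
    using N by (intro ennreal_tendsto_cmult) auto
  then have lim: "(\<lambda>n. ?N * (\<integral>\<^sup>+w. ennreal \<bar>?Y w\<bar> * ?D n w \<partial>plane)) \<longlonglongrightarrow> 0" by simp
  show ?thesis
    by (rule tendsto_sandwich[OF _ _ tendsto_const lim]) (auto intro!: always_eventually le)
qed

text \<open>Substitute u = T s - v and use the homogeneity of \<open>frac_kernel\<close>. The
  constraint u <= T s reads v >= 0, which y encodes by vanishing on negative numbers, and u >= 0
  reads v / T <= s.\<close>

lemma volterra_kernel_rescaled:
  assumes T: "0 < T" and y0: "\<And>v. v < 0 \<Longrightarrow> y v = 0"
  shows "volterra_kernel a y (T * s) (T * \<xi>) =
    T powr a * (LINT v|lborel. y v * (indicator {v / T..} s * frac_kernel a (s - v / T) \<xi>))"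
proof -
  have "volterra_kernel a y (T * s) (T * \<xi>) =
      (LINT v|lborel. indicator {0..T * s} (T * s - v) * y v * frac_kernel a (T * s - v) (T * \<xi>))"
    unfolding volterra_kernel_def
    using lborel_integral_real_affine[of "- 1" "\<lambda>u. indicator {0..T * s} u * y (T * s - u) * frac_kernel a u (T * \<xi>)" "T * s"]
    by simp
  also have "\<dots> = (LINT v|lborel. T powr a * (y v * (indicator {v / T..} s * frac_kernel a (s - v / T) \<xi>)))"
  proof (intro Bochner_Integration.integral_cong refl)
    fix v
    have "frac_kernel a (T * s - v) (T * \<xi>) = T powr a * frac_kernel a (s - v / T) \<xi>"
      using frac_kernel_scale[OF T, of a "s - v / T" \<xi>] T by (simp add: right_diff_distrib)
    moreover have "indicator {0..T * s} (T * s - v) * y v = y v * indicator {v / T..} s"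
    proof (cases "v < 0")
      case False
      have "v / T \<le> s \<longleftrightarrow> v \<le> T * s" using T by (simp add: pos_divide_le_eq mult.commute)
      then show ?thesis using False by (auto simp: indicator_def)
    qed (simp add: y0)
    ultimately have "indicator {0..T * s} (T * s - v) * y v * frac_kernel a (T * s - v) (T * \<xi>) =
        y v * indicator {v / T..} s * (T powr a * frac_kernel a (s - v / T) \<xi>)"
      by (simp only:)
    then show "indicator {0..T * s} (T * s - v) * y v * frac_kernel a (T * s - v) (T * \<xi>) =
        T powr a * (y v * (indicator {v / T..} s * frac_kernel a (s - v / T) \<xi>))"
      by (simp add: ac_simps)
  qed
  finally show ?thesis by simp
qed

text \<open>A product of two integrals against y is a double integral, and Fubini's theorem moves
  the time integral inside it. The time substitution gives a factor T and each kernel a factor T^a;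
  the prefactor cancels them.\<close>

lemma volterra_square_integral_rescaled:
  assumes a: "-3/4 < a" "a < -1/2" and y: "integrable lborel y"
    and T: "0 < T" and y0: "\<And>v. v < 0 \<Longrightarrow> y v = 0"
  shows "AE z in plane. T powr (- 1 - 2 * a) * (LINT s:{0..T * t}|lborel.
      volterra_kernel a y s (T * fst z) * volterra_kernel a y s (T * snd z)) = averaged_kernel a t y T z"
  using shifted_kernel_average_finite[OF a y, of t T]
proof eventually_elim
  case (elim z)
  let ?Y = "\<lambda>w. y (fst w) * y (snd w)"
  let ?W = "\<lambda>s w. ?Y w * window_kernel a t (fst w / T) (snd w / T) s z"
  have [measurable]: "y \<in> borel_measurable borel" using y by auto
  interpret LP: pair_sigma_finite lborel plane
    by (intro pair_sigma_finite.intro lborel_pair.sigma_finite_measure_axioms lborel.sigma_finite_measure_axioms)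
  define A where "A \<xi> s = (LINT v|lborel. y v * (indicator {v / T..} s * frac_kernel a (s - v / T) \<xi>))" for \<xi> s
  have [measurable]: "z \<in> space plane" by (simp add: space_pair_measure)
  have [measurable]: "case_prod ?W \<in> borel_measurable (lborel \<Otimes>\<^sub>M plane)"
    unfolding case_prod_beta' by measurable
  have resc: "volterra_kernel a y (T * s) (T * \<xi>) = T powr a * A \<xi> s" for s \<xi>
    unfolding A_def using y0 by (intro volterra_kernel_rescaled[OF T]) auto
  have "integrable (lborel \<Otimes>\<^sub>M plane) (case_prod ?W)"
  proof (rule integrableI_bounded)
    have "(\<integral>\<^sup>+x. ennreal (norm (case_prod ?W x)) \<partial>(lborel \<Otimes>\<^sub>M plane)) =
        (\<integral>\<^sup>+s. \<integral>\<^sup>+w. ennreal \<bar>?Y w\<bar> * ennreal (window_kernel a t (fst w / T) (snd w / T) s z) \<partial>plane \<partial>lborel)"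
      by (subst lborel_pair.nn_integral_fst[symmetric]) (auto simp: abs_mult ennreal_mult)
    also have "\<dots> = (\<integral>\<^sup>+w. \<integral>\<^sup>+s. ennreal \<bar>?Y w\<bar> * ennreal (window_kernel a t (fst w / T) (snd w / T) s z) \<partial>lborel \<partial>plane)"
      by (rule LP.Fubini'[symmetric]) measurable
    also have "\<dots> = (\<integral>\<^sup>+w. ennreal \<bar>?Y w\<bar> * shifted_kernel a t (fst w / T) (snd w / T) z \<partial>plane)"
      unfolding shifted_kernel_def by (intro nn_integral_cong nn_integral_cmult) measurable
    finally show "(\<integral>\<^sup>+x. ennreal (norm (case_prod ?W x)) \<partial>(lborel \<Otimes>\<^sub>M plane)) < \<infinity>"
      using elim by simp
  qed measurable
  note W = this
  \<comment> \<open>The product formula is proved for integrable slices, which Fubini's theorem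
    provides for almost every s.\<close>
  have inner: "(LINT w|plane. ?W s w) = indicator {0..t} s * (A (fst z) s * A (snd z) s)"
    if i: "integrable plane (?W s)" for s
  proof -
    define f where "f v = y v * (indicator {v / T..} s * frac_kernel a (s - v / T) (fst z))" for v
    define g where "g w = y w * (indicator {w / T..} s * frac_kernel a (s - w / T) (snd z))" for w
    have "(LINT w|plane. ?W s w) = (LINT v|lborel. LINT w|lborel. ?W s (v, w))"
      by (rule lborel_pair.integral_fst'[OF i, symmetric])
    also have "\<dots> = (LINT v|lborel. LINT w|lborel. indicator {0..t} s * (f v * g w))"
      unfolding f_def g_def
      by (intro Bochner_Integration.integral_cong refl) (simp add: window_kernel_def window_def ac_simps)
    also have "\<dots> = indicator {0..t} s * ((LINT v|lborel. f v) * (LINT w|lborel. g w))"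
      by simp
    also have "\<dots> = indicator {0..t} s * (A (fst z) s * A (snd z) s)"
      by (simp only: A_def f_def g_def)
    finally show ?thesis .
  qed
  have "averaged_kernel a t y T z = (LINT w|plane. LINT s|lborel. ?W s w)"
    unfolding averaged_kernel_def shifted_kernel_def
    by (intro Bochner_Integration.integral_cong refl) (simp add: integral_eq_nn_integral)
  also have "\<dots> = (LINT s|lborel. LINT w|plane. ?W s w)"
    by (rule LP.Fubini_integral[OF W])
  also have "\<dots> = (LINT s|lborel. indicator {0..t} s * (A (fst z) s * A (snd z) s))"
  proof (rule integral_cong_AE)
    from LP.AE_integrable_fst'[OF W]
    show "AE s in lborel. (LINT w|plane. ?W s w) = indicator {0..t} s * (A (fst z) s * A (snd z) s)"
      by eventually_elim (simp add: inner)
    have [measurable]: "(\<lambda>p. indicator {snd p / T..} (fst p :: real) :: real) \<in> borel_measurable (lborel \<Otimes>\<^sub>M lborel)"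
    proof -
      have "(\<lambda>p. indicator {snd p / T..} (fst p)) = (\<lambda>p. indicator {p. snd p / T \<le> fst p} p :: real)"
        by (auto simp: fun_eq_iff indicator_def)
      then show ?thesis by simp
    qed
    show "(\<lambda>s. indicator {0..t} s * (A (fst z) s * A (snd z) s)) \<in> borel_measurable lborel"
      unfolding A_def by measurable
  qed measurable
  finally have avg: "averaged_kernel a t y T z = (LINT s|lborel. indicator {0..t} s * (A (fst z) s * A (snd z) s))" .
  have "(LINT s:{0..T * t}|lborel. volterra_kernel a y s (T * fst z) * volterra_kernel a y s (T * snd z)) =
      T * (LINT s|lborel. indicator {0..T * t} (T * s) *
        (volterra_kernel a y (T * s) (T * fst z) * volterra_kernel a y (T * s) (T * snd z)))"
    unfolding set_lebesgue_integral_def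
    using T by (subst lborel_integral_real_affine[of T _ 0]) auto
  also have "\<dots> = T * (LINT s|lborel. (T powr a * T powr a) * (indicator {0..t} s * (A (fst z) s * A (snd z) s)))"
  proof -
    have "indicator {0..T * t} (T * s) * (volterra_kernel a y (T * s) (T * fst z) * volterra_kernel a y (T * s) (T * snd z)) =
        (T powr a * T powr a) * (indicator {0..t} s * (A (fst z) s * A (snd z) s))" for s
      unfolding resc using T by (auto simp: indicator_def zero_le_mult_iff)
    then show ?thesis by (simp only:)
  qed
  also have "\<dots> = T powr (1 + 2 * a) * averaged_kernel a t y T z"
  proof -
    have p: "T * (T powr a * T powr a) = T powr (1 + 2 * a)"
      using T powr_add[of T a a] powr_add[of T 1 "2 * a"] by simp
    show ?thesis
      unfolding avg integral_mult_right_zero p[symmetric] by (simp only: mult.assoc)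
  qed
  finally have eq: "(LINT s:{0..T * t}|lborel. volterra_kernel a y s (T * fst z) * volterra_kernel a y s (T * snd z)) =
      T powr (1 + 2 * a) * averaged_kernel a t y T z" .
  have "T powr (- 1 - 2 * a) * T powr (1 + 2 * a) = T powr ((- 1 - 2 * a) + (1 + 2 * a))"
    by (rule powr_add[symmetric])
  then have one: "T powr (- 1 - 2 * a) * T powr (1 + 2 * a) = 1" using T by simp
  show ?case
    unfolding eq mult.assoc[symmetric] one by (rule mult_1_left)
qed

lemma rescaled_volterra_square_tendsto:
  assumes a: "-3/4 < a" "a < -1/2" and y: "integrable lborel y" and y0: "\<And>v. v < 0 \<Longrightarrow> y v = 0"
    and T: "filterlim T at_top sequentially" and Tpos: "\<And>n. 0 < T n"
  shows "(\<lambda>n. \<integral>\<^sup>+z. ennreal ((T n powr (- 1 - 2 * a) * (LINT s:{0..T n * t}|lborel.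
      volterra_kernel a y s (T n * fst z) * volterra_kernel a y s (T n * snd z))
    - (LINT v|lborel. y v)\<^sup>2 * enn2real (shifted_kernel a t 0 0 z))\<^sup>2) \<partial>plane) \<longlonglongrightarrow> 0"
proof -
  let ?h = "\<lambda>n z. T n powr (- 1 - 2 * a) * (LINT s:{0..T n * t}|lborel.
    volterra_kernel a y s (T n * fst z) * volterra_kernel a y s (T n * snd z))"
  let ?l = "\<lambda>z. (LINT v|lborel. y v)\<^sup>2 * enn2real (shifted_kernel a t 0 0 z)"
  have "(\<integral>\<^sup>+z. ennreal ((?h n z - ?l z)\<^sup>2) \<partial>plane) =
    (\<integral>\<^sup>+z. ennreal ((averaged_kernel a t y (T n) z - ?l z)\<^sup>2) \<partial>plane)" for n
  proof -
    have AE: "AE z in plane. ?h n z = averaged_kernel a t y (T n) z"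
      using y0 by (intro volterra_square_integral_rescaled[OF a y Tpos]) auto
    show ?thesis
      by (rule nn_integral_cong_AE, rule eventually_mono[OF AE]) simp
  qed
  then show ?thesis
    using averaged_kernel_tendsto[OF a y T, of t] by simp
qed

section \<open>Off-diagonal step functions and Brownian scaling\<close>

text \<open>The product measure over \<open>{..<q}\<close> lives on extensional functions, so the
  identification with the line must return a restricted function; likewise
  \<open>plane_point\<close> for the plane.\<close>

definition line_point :: "real \<Rightarrow> nat \<Rightarrow> real" where
  "line_point x = (\<lambda>j\<in>{..<1}. x)"

definition plane_point :: "real \<times> real \<Rightarrow> nat \<Rightarrow> real" where
  "plane_point z = (\<lambda>j\<in>{..<2}. if j = 0 then fst z else snd z)"

lemma line_point_measurable [measurable]: "line_point \<in> measurable lborel (\<Pi>\<^sub>M j\<in>{..<1}. lborel)"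
  unfolding line_point_def[abs_def] by (intro measurable_restrict) simp

lemma plane_point_measurable [measurable]: "plane_point \<in> measurable plane (\<Pi>\<^sub>M j\<in>{..<2}. lborel)"
  unfolding plane_point_def[abs_def] by (intro measurable_restrict) simp

lemma nn_integral_line_point:
  assumes "g \<in> borel_measurable (\<Pi>\<^sub>M j\<in>{..<1::nat}. lborel :: real measure)"
  shows "(\<integral>\<^sup>+\<xi>. g \<xi> \<partial>(\<Pi>\<^sub>M j\<in>{..<1::nat}. lborel)) = (\<integral>\<^sup>+x. g (line_point x) \<partial>lborel)"
proof -
  interpret product_sigma_finite "\<lambda>_::nat. lborel :: real measure" by standard
  have s: "{..<1} = {0::nat}" by auto
  have "(\<integral>\<^sup>+\<xi>. g \<xi> \<partial>(\<Pi>\<^sub>M j\<in>{..<1::nat}. lborel)) = (\<integral>\<^sup>+\<xi>. g (line_point (\<xi> 0)) \<partial>(\<Pi>\<^sub>M j\<in>{..<1::nat}. lborel))"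
  proof (rule nn_integral_cong)
    fix \<xi> assume "\<xi> \<in> space (\<Pi>\<^sub>M j\<in>{..<1::nat}. lborel :: real measure)"
    then have "line_point (\<xi> 0) = \<xi>"
      by (auto simp: line_point_def space_PiM PiE_def extensional_def fun_eq_iff)
    then show "g \<xi> = g (line_point (\<xi> 0))" by simp
  qed
  also have "\<dots> = (\<integral>\<^sup>+x. g (line_point x) \<partial>lborel)"
    unfolding s using measurable_compose[OF line_point_measurable assms]
    by (rule product_nn_integral_singleton)
  finally show ?thesis .
qed

lemma nn_integral_plane_point:
  assumes g: "g \<in> borel_measurable (\<Pi>\<^sub>M j\<in>{..<2::nat}. lborel :: real measure)"
  shows "(\<integral>\<^sup>+\<xi>. g \<xi> \<partial>(\<Pi>\<^sub>M j\<in>{..<2::nat}. lborel)) = (\<integral>\<^sup>+z. g (plane_point z) \<partial>plane)"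
proof -
  interpret product_sigma_finite "\<lambda>_::nat. lborel :: real measure" by standard
  have s: "{..<2} = insert 1 {0::nat}" by auto
  have gz: "(\<lambda>z. g (plane_point z)) \<in> borel_measurable plane"
    by (rule measurable_compose[OF plane_point_measurable g])
  have "(\<integral>\<^sup>+\<xi>. g \<xi> \<partial>(\<Pi>\<^sub>M j\<in>{..<2::nat}. lborel)) =
      (\<integral>\<^sup>+x. \<integral>\<^sup>+y. g (x(1 := y)) \<partial>lborel \<partial>(\<Pi>\<^sub>M j\<in>{0::nat}. lborel))"
    unfolding s by (rule product_nn_integral_insert) (use g s in auto)
  also have "\<dots> = (\<integral>\<^sup>+x. (\<lambda>u. \<integral>\<^sup>+y. g (plane_point (u, y)) \<partial>lborel) (x 0) \<partial>(\<Pi>\<^sub>M j\<in>{0::nat}. lborel))"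
  proof (rule nn_integral_cong)
    fix x assume x: "x \<in> space (\<Pi>\<^sub>M j\<in>{0::nat}. lborel :: real measure)"
    have "x(1 := y) = plane_point (x 0, y)" for y
    proof
      fix j :: nat
      show "(x(1 := y)) j = plane_point (x 0, y) j"
        using x by (cases "j = 0"; cases "j = 1")
          (auto simp: plane_point_def space_PiM PiE_def extensional_def)
    qed
    then show "(\<integral>\<^sup>+y. g (x(1 := y)) \<partial>lborel) = (\<lambda>u. \<integral>\<^sup>+y. g (plane_point (u, y)) \<partial>lborel) (x 0)" by simp
  qed
  also have "\<dots> = (\<integral>\<^sup>+u. \<integral>\<^sup>+y. g (plane_point (u, y)) \<partial>lborel \<partial>lborel)"
    by (rule product_nn_integral_singleton) (use gz in measurable)
  also have "\<dots> = (\<integral>\<^sup>+z. g (plane_point z) \<partial>plane)"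
    using lborel.nn_integral_fst[OF gz] by simp
  finally show ?thesis .
qed

lemma offdiag_step_measurable:
  "offdiag_step q n p a \<in> borel_measurable (\<Pi>\<^sub>M j\<in>{..<q}. lborel)"
  unfolding offdiag_step_def[abs_def]
proof (intro borel_measurable_sum borel_measurable_times borel_measurable_const borel_measurable_prod)
  fix i j assume "j \<in> {..<q}"
  then have "(\<lambda>\<xi>. \<xi> j) \<in> measurable (\<Pi>\<^sub>M j\<in>{..<q}. lborel) (lborel :: real measure)"
    by (rule measurable_component_singleton)
  from measurable_compose[OF this, of "indicator {p (i j)<..p (Suc (i j))}" borel]
  show "(\<lambda>\<xi>. indicator {p (i j)<..p (Suc (i j))} (\<xi> j) :: real) \<in> borel_measurable (\<Pi>\<^sub>M j\<in>{..<q}. lborel)"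
    by simp
qed

lemma finite_offdiag_indices: "finite (offdiag_indices q n)"
  unfolding offdiag_indices_def by (rule finite_subset[of _ "{..<q} \<rightarrow>\<^sub>E {..<n}"]) (auto intro: finite_PiE)

lemma offdiag_step_line_point:
  "offdiag_step 1 n p a (line_point x) =
    (\<Sum>i\<in>offdiag_indices 1 n. a i * indicator {p (i 0)<..p (Suc (i 0))} x)"
  by (simp add: offdiag_step_def line_point_def)

lemma offdiag_step_plane_point:
  "offdiag_step 2 n p a (plane_point z) = (\<Sum>i\<in>offdiag_indices 2 n. a i *
    indicator {p (i 0)<..p (Suc (i 0))} (fst z) * indicator {p (i 1)<..p (Suc (i 1))} (snd z))"
  by (simp add: offdiag_step_def plane_point_def numeral_2_eq_2 mult.assoc)

lemma offdiag_step_integral_1: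
  "offdiag_step_integral B 1 n p a \<omega> =
    (\<Sum>i\<in>offdiag_indices 1 n. a i * (B (p (Suc (i 0))) \<omega> - B (p (i 0)) \<omega>))"
  by (simp add: offdiag_step_integral_def)

lemma offdiag_step_integral_2:
  "offdiag_step_integral B 2 n p a \<omega> = (\<Sum>i\<in>offdiag_indices 2 n. a i *
    (B (p (Suc (i 0))) \<omega> - B (p (i 0)) \<omega>) * (B (p (Suc (i 1))) \<omega> - B (p (i 1)) \<omega>))"
  by (simp add: offdiag_step_integral_def numeral_2_eq_2 mult.assoc)

lemma offdiag_indices_2D:
  assumes "i \<in> offdiag_indices 2 n"
  shows "i 0 < n" "i 1 < n" "i 0 \<noteq> i 1"
  using assms inj_onD[of i "{..<2}" 0 1] by (auto simp: offdiag_indices_def PiE_def Pi_def)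

section \<open>Step functions in the first and second chaos\<close>

context two_sided_bm
begin

text \<open>The elementary pairs of which \<open>wiener\<close> is the closure.\<close>

definition step_pair :: "(real \<Rightarrow> real) \<Rightarrow> ('a \<Rightarrow> real) \<Rightarrow> bool" where
  "step_pair f X \<longleftrightarrow> (\<exists>F c. finite F \<and> f = step_combination F c \<and> X = bm_combination B F c)"

lemma step_pair_wiener: "step_pair f X \<Longrightarrow> wiener f X"
  unfolding step_pair_def using wiener_step by blast

lemma step_pair_linear:
  assumes "step_pair f X" "step_pair g Y"
  shows "step_pair (\<lambda>x. a * f x + b * g x) (\<lambda>\<omega>. a * X \<omega> + b * Y \<omega>)"
proof -
  obtain F c G d where "finite F" "finite G" "f = step_combination F c" "X = bm_combination B F c"
    "g = step_combination G d" "Y = bm_combination B G d"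
    using assms unfolding step_pair_def by blast
  then show ?thesis
    unfolding step_pair_def
    by (intro exI[of _ "F \<union> G"] exI[of _ "\<lambda>t. a * (if t \<in> F then c t else 0) + b * (if t \<in> G then d t else 0)"])
      (simp add: fun_eq_iff bm_combination_linear step_combination_linear)
qed

lemma step_pair_interval:
  assumes "s < t"
  shows "step_pair (indicator {s<..t}) (\<lambda>\<omega>. B t \<omega> - B s \<omega>)"
proof -
  let ?c = "\<lambda>r. if r = t then 1 else - 1 :: real"
  have "indicator {s<..t} = step_combination {s, t} ?c"
    using assms signed_interval_diff[of s t]
    by (auto simp: step_combination_def fun_eq_iff)
  moreover have "(\<lambda>\<omega>. B t \<omega> - B s \<omega>) = bm_combination B {s, t} ?c"
    using assms by (auto simp: bm_combination_def fun_eq_iff)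
  ultimately show ?thesis unfolding step_pair_def by (intro exI[of _ "{s, t}"] exI[of _ ?c]) simp
qed

lemma step_pair_sum:
  assumes "finite K" "\<And>i. i \<in> K \<Longrightarrow> step_pair (f i) (X i)"
  shows "step_pair (\<lambda>x. \<Sum>i\<in>K. a i * f i x) (\<lambda>\<omega>. \<Sum>i\<in>K. a i * X i \<omega>)"
  using assms
proof induction
  case empty
  have "(\<lambda>x. 0) = step_combination {} (\<lambda>_. 0)" "(\<lambda>\<omega>. 0) = bm_combination B {} (\<lambda>_. 0)"
    by (auto simp: step_combination_def bm_combination_def)
  then show ?case
    unfolding step_pair_def by (intro exI[of _ "{}"] exI[of _ "\<lambda>_. 0"]) simp
next
  case (insert i K)
  have "step_pair (\<lambda>x. a i * f i x + 1 * (\<Sum>i\<in>K. a i * f i x)) (\<lambda>\<omega>. a i * X i \<omega> + 1 * (\<Sum>i\<in>K. a i * X i \<omega>))"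
    using insert by (intro step_pair_linear) auto
  then show ?case using insert by simp
qed

text \<open>In order 1 every multi-index is injective, so off-diagonal step functions are ordinary
  step functions.\<close>

lemma wiener_of_multiple_integral:
  assumes "has_multiple_wiener_integral M B 1 f Y"
  shows "wiener (\<lambda>x. f (line_point x)) Y"
proof -
  obtain n p a where f [measurable]: "f \<in> borel_measurable (\<Pi>\<^sub>M j\<in>{..<1}. lborel)"
    and Y: "Y \<in> borel_measurable M"
    and p: "\<And>k. strict_mono_on {..n k} (p k)"
    and l1: "(\<lambda>k. \<integral>\<^sup>+\<xi>. ennreal ((f \<xi> - offdiag_step 1 (n k) (p k) (a k) \<xi>)\<^sup>2)
               \<partial>(\<Pi>\<^sub>M j\<in>{..<1}. lborel)) \<longlonglongrightarrow> 0"
    and l2: "(\<lambda>k. \<integral>\<^sup>+\<omega>. ennreal ((Y \<omega> - offdiag_step_integral B 1 (n k) (p k) (a k) \<omega>)\<^sup>2) \<partial>M) \<longlonglongrightarrow> 0"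
    using assms unfolding has_multiple_wiener_integral_def by blast
  have sp: "step_pair (\<lambda>x. offdiag_step 1 (n k) (p k) (a k) (line_point x))
      (offdiag_step_integral B 1 (n k) (p k) (a k))" for k
  proof -
    have "step_pair (\<lambda>x. \<Sum>i\<in>offdiag_indices 1 (n k). a k i * indicator {p k (i 0)<..p k (Suc (i 0))} x)
        (\<lambda>\<omega>. \<Sum>i\<in>offdiag_indices 1 (n k). a k i * (B (p k (Suc (i 0))) \<omega> - B (p k (i 0)) \<omega>))"
    proof (rule step_pair_sum[OF finite_offdiag_indices step_pair_interval])
      fix i assume "i \<in> offdiag_indices 1 (n k)"
      then have "i 0 < n k" by (auto simp: offdiag_indices_def PiE_def Pi_def)
      then show "p k (i 0) < p k (Suc (i 0))" using p[of k] by (simp add: strict_mono_on_def)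
    qed
    then show ?thesis
      unfolding offdiag_step_line_point[symmetric] offdiag_step_integral_1[symmetric] .
  qed
  have "\<forall>k. \<exists>Fc. finite (fst Fc) \<and>
      (\<lambda>x. offdiag_step 1 (n k) (p k) (a k) (line_point x)) = step_combination (fst Fc) (snd Fc) \<and>
      offdiag_step_integral B 1 (n k) (p k) (a k) = bm_combination B (fst Fc) (snd Fc)"
    using sp unfolding step_pair_def by (metis fst_conv snd_conv)
  from choice[OF this] obtain Fc where Fc: "\<And>k. finite (fst (Fc k))"
      "\<And>k. (\<lambda>x. offdiag_step 1 (n k) (p k) (a k) (line_point x)) = step_combination (fst (Fc k)) (snd (Fc k))"
      "\<And>k. offdiag_step_integral B 1 (n k) (p k) (a k) = bm_combination B (fst (Fc k)) (snd (Fc k))"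
    by blast
  have 1: "(\<integral>\<^sup>+\<xi>. ennreal ((f \<xi> - offdiag_step 1 (n k) (p k) (a k) \<xi>)\<^sup>2) \<partial>(\<Pi>\<^sub>M j\<in>{..<1}. lborel)) =
      (\<integral>\<^sup>+x. ennreal ((f (line_point x) - step_combination (fst (Fc k)) (snd (Fc k)) x)\<^sup>2) \<partial>lborel)" for k
  proof -
    note [measurable] = offdiag_step_measurable[of 1 "n k" "p k" "a k"]
    have m: "(\<lambda>\<xi>. ennreal ((f \<xi> - offdiag_step 1 (n k) (p k) (a k) \<xi>)\<^sup>2)) \<in>
        borel_measurable (\<Pi>\<^sub>M j\<in>{..<1}. lborel)" by measurable
    show ?thesis
      unfolding nn_integral_line_point[OF m] fun_cong[OF Fc(2)[of k], symmetric] ..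
  qed
  show ?thesis
    unfolding wiener_def
  proof (intro conjI exI[of _ "\<lambda>k. fst (Fc k)"] exI[of _ "\<lambda>k. snd (Fc k)"])
    show "(\<lambda>x. f (line_point x)) \<in> borel_measurable borel"
      using measurable_compose[OF line_point_measurable f] by simp
    show "(\<lambda>k. \<integral>\<^sup>+x. ennreal ((f (line_point x) - step_combination (fst (Fc k)) (snd (Fc k)) x)\<^sup>2) \<partial>lborel) \<longlonglongrightarrow> 0"
      using l1 unfolding 1 .
    show "(\<lambda>k. \<integral>\<^sup>+\<omega>. ennreal ((Y \<omega> - bm_combination B (fst (Fc k)) (snd (Fc k)) \<omega>)\<^sup>2) \<partial>M) \<longlonglongrightarrow> 0"
      using l2 unfolding Fc(3) .
  qed (use Y Fc(1) in simp_all)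
qed

lemma chaos2_sum:
  assumes "finite K"
    and "\<And>i. i \<in> K \<Longrightarrow> wiener (f i) (X i)" "\<And>i. i \<in> K \<Longrightarrow> wiener (g i) (Y i)"
    and "\<And>i. i \<in> K \<Longrightarrow> (LINT x|lborel. f i x * g i x) = 0"
  shows "chaos2 (\<lambda>z. \<Sum>i\<in>K. f i (fst z) * g i (snd z)) (\<lambda>\<omega>. \<Sum>i\<in>K. X i \<omega> * Y i \<omega>)"
  using assms
proof induction
  case empty
  then show ?case using chaos2.zero by simp
next
  case (insert i K)
  then show ?case
    using chaos2.add[of "\<lambda>z. \<Sum>i\<in>K. f i (fst z) * g i (snd z)" "\<lambda>\<omega>. \<Sum>i\<in>K. X i \<omega> * Y i \<omega>" "f i" "X i" "g i" "Y i"]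
    by (simp add: add.commute)
qed

text \<open>Cells of a strictly increasing grid are disjoint, and an off-diagonal index picks two
  different ones. Hence the factors of each summand are orthogonal, as \<open>chaos2\<close>
  demands.\<close>

lemma chaos2_offdiag_step:
  assumes p: "strict_mono_on {..n} p"
  shows "chaos2 (\<lambda>z. c * offdiag_step 2 n p a (plane_point z)) (\<lambda>\<omega>. c * offdiag_step_integral B 2 n p a \<omega>)"
proof -
  let ?I = "\<lambda>i. indicator {p i<..p (Suc i)} :: real \<Rightarrow> real"
  have less: "p i < p (Suc i)" if "i < n" for i
    using p that by (simp add: strict_mono_on_def)
  have le: "p i \<le> p j" if "i \<le> j" "j \<le> n" for i j
    using strict_mono_onD[OF p, of i j] that by (cases "i = j") auto
  have disj: "?I i x * ?I j x = 0" if "i < n" "j < n" "i \<noteq> j" for i j x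
  proof -
    have "Suc i \<le> j \<or> Suc j \<le> i" using that by auto
    then show ?thesis
    proof
      assume "Suc i \<le> j"
      then have "p (Suc i) \<le> p j" using that by (intro le) auto
      then show ?thesis by (auto simp: indicator_def)
    next
      assume "Suc j \<le> i"
      then have "p (Suc j) \<le> p i" using that by (intro le) auto
      then show ?thesis by (auto simp: indicator_def)
    qed
  qed
  have w: "wiener (?I i) (\<lambda>\<omega>. B (p (Suc i)) \<omega> - B (p i) \<omega>)" if "i < n" for i
    by (rule step_pair_wiener[OF step_pair_interval[OF less[OF that]]])
  have w': "wiener (\<lambda>x. b * ?I i x) (\<lambda>\<omega>. b * (B (p (Suc i)) \<omega> - B (p i) \<omega>))" if "i < n" for i b
    using wiener_linear[OF w[OF that] w[OF that], of b 0] by simp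
  have "chaos2 (\<lambda>z. \<Sum>i\<in>offdiag_indices 2 n. (c * a i * ?I (i 0) (fst z)) * ?I (i 1) (snd z))
      (\<lambda>\<omega>. \<Sum>i\<in>offdiag_indices 2 n. (c * a i * (B (p (Suc (i 0))) \<omega> - B (p (i 0)) \<omega>)) *
        (B (p (Suc (i 1))) \<omega> - B (p (i 1)) \<omega>))"
  proof (rule chaos2_sum[OF finite_offdiag_indices])
    fix i assume i: "i \<in> offdiag_indices 2 n"
    show "wiener (\<lambda>x. c * a i * ?I (i 0) x) (\<lambda>\<omega>. c * a i * (B (p (Suc (i 0))) \<omega> - B (p (i 0)) \<omega>))"
      by (rule w'[OF offdiag_indices_2D(1)[OF i]])
    show "wiener (?I (i 1)) (\<lambda>\<omega>. B (p (Suc (i 1))) \<omega> - B (p (i 1)) \<omega>)"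
      by (rule w[OF offdiag_indices_2D(2)[OF i]])
    show "(LINT x|lborel. c * a i * ?I (i 0) x * ?I (i 1) x) = 0"
    proof -
      have "c * a i * ?I (i 0) x * ?I (i 1) x = 0" for x
        using disj[OF offdiag_indices_2D[OF i], of x] by (simp only: mult.assoc mult_zero_right)
      then show ?thesis by (simp only: Bochner_Integration.integral_zero)
    qed
  qed
  then show ?thesis
    by (simp add: offdiag_step_plane_point offdiag_step_integral_2 sum_distrib_left mult.assoc)
qed

text \<open>The right-hand side mentions neither the probability space nor T, which makes laws on
  unrelated spaces comparable.\<close>

lemma scaled_increments_law:
  assumes p: "strict_mono_on {..n} p" and n: "0 < n" and T: "0 < T"
  shows "distr M (\<Pi>\<^sub>M i\<in>{..<n}. borel) (\<lambda>\<omega>. \<lambda>i\<in>{..<n}. (B (T * p (Suc i)) \<omega> - B (T * p i) \<omega>) / sqrt T) =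
    (\<Pi>\<^sub>M i\<in>{..<n}. density lborel (normal_density 0 (sqrt (p (Suc i) - p i))))"
proof -
  let ?X = "\<lambda>i \<omega>. (B (T * p (Suc i)) \<omega> - B (T * p i) \<omega>) / sqrt T"
  have "strict_mono_on {..n} (\<lambda>i. T * p i)"
    using p T by (simp add: strict_mono_on_def)
  from increments_indep[OF this]
  have ind: "indep_vars (\<lambda>_. borel) (\<lambda>i \<omega>. B (T * p (Suc i)) \<omega> - B (T * p i) \<omega>) {..<n}" .
  from indep_vars_compose2[OF this, of "\<lambda>i x. x / sqrt T" "\<lambda>_. borel"]
  have "indep_vars (\<lambda>_. borel) ?X {..<n}" by simp
  then have "distr M (\<Pi>\<^sub>M i\<in>{..<n}. borel) (\<lambda>\<omega>. \<lambda>i\<in>{..<n}. ?X i \<omega>) = (\<Pi>\<^sub>M i\<in>{..<n}. distr M borel (?X i))"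
    using n by (subst (asm) indep_vars_iff_distr_eq_PiM') auto
  also have "\<dots> = (\<Pi>\<^sub>M i\<in>{..<n}. density lborel (normal_density 0 (sqrt (p (Suc i) - p i))))"
  proof (rule PiM_cong[OF refl])
    fix i assume "i \<in> {..<n}"
    then have less: "p i < p (Suc i)" using p by (simp add: strict_mono_on_def)
    then have "T * p i < T * p (Suc i)" using T by simp
    from normal_density_affine[OF increment_normal[OF this], of "1 / sqrt T" 0]
    have "distributed M lborel (?X i) (normal_density 0 (sqrt (T * p (Suc i) - T * p i) / sqrt T))"
      using less T by simp
    also have "sqrt (T * p (Suc i) - T * p i) / sqrt T = sqrt (p (Suc i) - p i)"
      using T by (simp add: real_sqrt_mult flip: right_diff_distrib)
    finally have "distr M lborel (?X i) = density lborel (normal_density 0 (sqrt (p (Suc i) - p i)))"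
      by (rule distributed_distr_eq_density)
    moreover have "distr M borel (?X i) = distr M lborel (?X i)"
      by (rule distr_cong) auto
    ultimately show "distr M borel (?X i) = density lborel (normal_density 0 (sqrt (p (Suc i) - p i)))"
      by simp
  qed
  finally show ?thesis .
qed

text \<open>The values on \<open>F\<close> are a fixed linear map of the independent increments, so
  their law is again determined by the grid and the positions of the times on it.\<close>

lemma scaled_bm_law:
  assumes p: "strict_mono_on {..n} p" and n: "0 < n" and T: "0 < T"
    and k: "\<And>t. t \<in> insert 0 F \<Longrightarrow> k t \<le> n \<and> p (k t) = t"
  shows "distr M (\<Pi>\<^sub>M t\<in>F. borel) (\<lambda>\<omega>. \<lambda>t\<in>F. (B (T * t) \<omega> - B 0 \<omega>) / sqrt T) =
    distr (\<Pi>\<^sub>M i\<in>{..<n}. density lborel (normal_density 0 (sqrt (p (Suc i) - p i)))) (\<Pi>\<^sub>M t\<in>F. borel)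
      (\<lambda>v. \<lambda>t\<in>F. \<Sum>i<n. (of_bool (i < k t) - of_bool (i < k 0)) * v i)"
proof -
  let ?X = "\<lambda>\<omega>. \<lambda>i\<in>{..<n}. (B (T * p (Suc i)) \<omega> - B (T * p i) \<omega>) / sqrt T"
  let ?g = "\<lambda>v. \<lambda>t\<in>F. \<Sum>i<n. (of_bool (i < k t) - of_bool (i < k 0)) * v i :: real"
  have X: "?X \<in> measurable M (\<Pi>\<^sub>M i\<in>{..<n}. borel)"
    by (intro measurable_restrict) simp
  have g: "?g \<in> measurable (\<Pi>\<^sub>M i\<in>{..<n}. borel) (\<Pi>\<^sub>M t\<in>F. borel)"
    by (intro measurable_restrict borel_measurable_sum borel_measurable_times borel_measurable_const
        measurable_component_singleton) auto
  have "distr (distr M (\<Pi>\<^sub>M i\<in>{..<n}. borel) ?X) (\<Pi>\<^sub>M t\<in>F. borel) ?g = distr M (\<Pi>\<^sub>M t\<in>F. borel) (?g \<circ> ?X)"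
    by (rule distr_distr[OF g X])
  also have "?g \<circ> ?X = (\<lambda>\<omega>. \<lambda>t\<in>F. (B (T * t) \<omega> - B 0 \<omega>) / sqrt T)"
  proof
    fix \<omega>
    have "(B (T * t) \<omega> - B 0 \<omega>) / sqrt T = (\<Sum>i<n. (of_bool (i < k t) - of_bool (i < k 0)) * ?X \<omega> i)"
      if "t \<in> F" for t
    proof -
      have "B (T * p (k t)) \<omega> - B (T * p (k 0)) \<omega> = (\<Sum>i<n. (of_bool (i < k t) - of_bool (i < k 0)) *
          (B (T * p (Suc i)) \<omega> - B (T * p i) \<omega>))"
        using k that by (intro grid_telescope) auto
      then show ?thesis
        using k[of t] k[of 0] that by (simp add: sum_divide_distrib)
    qed
    then show "(?g \<circ> ?X) \<omega> = (\<lambda>t\<in>F. (B (T * t) \<omega> - B 0 \<omega>) / sqrt T)"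
      by (auto simp: fun_eq_iff)
  qed
  finally show ?thesis
    unfolding scaled_increments_law[OF p n T] by (rule sym)
qed

end

text \<open>Both sides are the push-forward from \<open>scaled_bm_law\<close>, with scale 1 on the
  right.\<close>

lemma bm_scaling_law:
  assumes M: "two_sided_bm M B" and N: "two_sided_bm N W" and F: "finite F" and T: "0 < T"
  shows "distr M (\<Pi>\<^sub>M t\<in>F. borel) (\<lambda>\<omega>. \<lambda>t\<in>F. (B (T * t) \<omega> - B 0 \<omega>) / sqrt T) =
    distr N (\<Pi>\<^sub>M t\<in>F. borel) (\<lambda>\<omega>. \<lambda>t\<in>F. W t \<omega> - W 0 \<omega>)"
proof -
  \<comment> \<open>Including 1 besides 0 guarantees two grid points, hence at least one
    increment.\<close>
  obtain n p where p: "strict_mono_on {..n::nat} p" and P: "insert 0 (insert 1 F) = p ` {..n}"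
    using finite_grid[of "insert 0 (insert 1 F)"] F by auto
  have n: "0 < n"
  proof (rule ccontr)
    assume "\<not> 0 < n"
    then have "p ` {..n} = {p 0}" by auto
    with P have "(0::real) = 1" by (metis insertI1 insertI2 singletonD)
    then show False by simp
  qed
  have "\<forall>t\<in>insert 0 F. \<exists>i\<le>n. p i = t"
    using P by (metis atMost_iff imageE insert_iff)
  then obtain k where k: "\<And>t. t \<in> insert 0 F \<Longrightarrow> k t \<le> n \<and> p (k t) = t" by metis
  show ?thesis
    using two_sided_bm.scaled_bm_law[OF M p n T, of F k] two_sided_bm.scaled_bm_law[OF N p n, of 1 F k] k
    by simp
qed

text \<open>Both vectors are one quadratic polynomial of Brownian values, and two factors 1 / sqrt T
  produce 1 / T. A single finite set of times serves all of \<open>J\<close>, so the joint law is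
  obtained although every t has its own grid.\<close>

lemma step_integral_scaling_law:
  assumes M: "two_sided_bm M B" and N: "two_sided_bm N W" and J: "finite J" and T: "0 < T"
  shows "distr M (\<Pi>\<^sub>M t\<in>J. borel) (\<lambda>\<omega>. \<lambda>t\<in>J. c / T * offdiag_step_integral B 2 (n t) (\<lambda>i. T * p t i) (a t) \<omega>) =
    distr N (\<Pi>\<^sub>M t\<in>J. borel) (\<lambda>\<omega>. \<lambda>t\<in>J. c * offdiag_step_integral W 2 (n t) (p t) (a t) \<omega>)"
proof -
  interpret M: two_sided_bm M B by fact
  interpret N: two_sided_bm N W by fact
  define F where "F = (\<Union>t\<in>J. p t ` {..n t})"
  have F: "finite F" using J by (simp add: F_def)
  define \<Psi> where "\<Psi> v = (\<lambda>t\<in>J. c * (\<Sum>i\<in>offdiag_indices 2 (n t). a t i *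
    (v (p t (Suc (i 0))) - v (p t (i 0))) * (v (p t (Suc (i 1))) - v (p t (i 1)))))" for v :: "real \<Rightarrow> real"
  have inF: "p t (i 0) \<in> F" "p t (Suc (i 0)) \<in> F" "p t (i 1) \<in> F" "p t (Suc (i 1)) \<in> F"
    if "t \<in> J" "i \<in> offdiag_indices 2 (n t)" for t i
  proof -
    have "p t j \<in> F" if "j \<le> n t" for j using \<open>t \<in> J\<close> that by (auto simp: F_def)
    then show "p t (i 0) \<in> F" "p t (Suc (i 0)) \<in> F" "p t (i 1) \<in> F" "p t (Suc (i 1)) \<in> F"
      using offdiag_indices_2D[OF that(2)] by auto
  qed
  have \<Psi>: "\<Psi> \<in> measurable (\<Pi>\<^sub>M t\<in>F. borel) (\<Pi>\<^sub>M t\<in>J. borel)"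
    unfolding \<Psi>_def[abs_def]
    by (intro measurable_restrict borel_measurable_sum borel_measurable_times borel_measurable_const
        borel_measurable_diff measurable_component_singleton inF)
  have X: "(\<lambda>\<omega>. \<lambda>t\<in>F. (B (T * t) \<omega> - B 0 \<omega>) / sqrt T) \<in> measurable M (\<Pi>\<^sub>M t\<in>F. borel)"
    by (intro measurable_restrict) simp
  have Y: "(\<lambda>\<omega>. \<lambda>t\<in>F. W t \<omega> - W 0 \<omega>) \<in> measurable N (\<Pi>\<^sub>M t\<in>F. borel)"
    by (intro measurable_restrict) simp
  have 1: "(\<lambda>\<omega>. \<lambda>t\<in>J. c / T * offdiag_step_integral B 2 (n t) (\<lambda>i. T * p t i) (a t) \<omega>) =
      \<Psi> \<circ> (\<lambda>\<omega>. \<lambda>t\<in>F. (B (T * t) \<omega> - B 0 \<omega>) / sqrt T)"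
  proof (intro ext)
    fix \<omega> t
    have "c / T * offdiag_step_integral B 2 (n t) (\<lambda>i. T * p t i) (a t) \<omega> =
        \<Psi> (\<lambda>t\<in>F. (B (T * t) \<omega> - B 0 \<omega>) / sqrt T) t" if t: "t \<in> J"
    proof -
      have d: "(x - z) / sqrt T - (y - z) / sqrt T = (x - y) / sqrt T" for x y z
        by (simp add: diff_divide_distrib)
      have q: "(x / sqrt T) * (y / sqrt T) = x * y / T" for x y
        using T by simp
      show ?thesis
        using t inF[OF t] T
        by (simp add: \<Psi>_def offdiag_step_integral_2 d q sum_distrib_left mult.assoc cong: sum.cong)
    qed
    then show "(\<lambda>t\<in>J. c / T * offdiag_step_integral B 2 (n t) (\<lambda>i. T * p t i) (a t) \<omega>) t =
        (\<Psi> \<circ> (\<lambda>\<omega>. \<lambda>t\<in>F. (B (T * t) \<omega> - B 0 \<omega>) / sqrt T)) \<omega> t"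
      by (cases "t \<in> J") (auto simp: \<Psi>_def)
  qed
  have 2: "(\<lambda>\<omega>. \<lambda>t\<in>J. c * offdiag_step_integral W 2 (n t) (p t) (a t) \<omega>) = \<Psi> \<circ> (\<lambda>\<omega>. \<lambda>t\<in>F. W t \<omega> - W 0 \<omega>)"
    using inF by (auto simp: fun_eq_iff \<Psi>_def offdiag_step_integral_2 restrict_def cong: sum.cong)
  show ?thesis
    unfolding 1 2 distr_distr[OF \<Psi> X, symmetric] distr_distr[OF \<Psi> Y, symmetric]
      bm_scaling_law[OF M N F T] ..
qed

section \<open>The quadratic functional of the Volterra process\<close>

lemma completion_AE_eq:
  fixes f g :: "'a \<Rightarrow> real"
  assumes g: "g \<in> borel_measurable M" and eq: "AE x in M. f x = g x"
  shows "f \<in> borel_measurable (completion M)"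
    and "integral\<^sup>L (completion M) f = integral\<^sup>L M g"
    and "integrable (completion M) f \<longleftrightarrow> integrable M g"
proof -
  have g': "g \<in> borel_measurable (completion M)" by (rule measurable_completion[OF g])
  have eq': "AE x in completion M. f x = g x" by (rule AE_completion[OF eq])
  show f: "f \<in> borel_measurable (completion M)"
  proof (rule measurableI)
    fix A :: "real set" assume A: "A \<in> sets borel"
    show "f -` A \<inter> space (completion M) \<in> sets (completion M)"
    proof (rule completion.in_sets_AE)
      show "g -` A \<inter> space (completion M) \<in> sets (completion M)"
        by (rule measurable_sets[OF g' A])
      show "AE x in completion M. (x \<in> g -` A \<inter> space (completion M)) = (x \<in> f -` A \<inter> space (completion M))"
        using eq' by eventually_elim simp
    qed auto
  qed simp
  show "integral\<^sup>L (completion M) f = integral\<^sup>L M g"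
    using integral_cong_AE[OF f g' eq'] integral_completion[OF g] by simp
  show "integrable (completion M) f \<longleftrightarrow> integrable M g"
    using integrable_cong_AE[OF f g' eq'] integrable_completion[OF g] by simp
qed

lemma AE_lborel_reflect:
  assumes "AE v in lborel. P (v :: real)"
  shows "AE u in lborel. P (t - u)"
proof -
  obtain N where N: "{v \<in> space lborel. \<not> P v} \<subseteq> N" "emeasure lborel N = 0" "N \<in> sets lborel"
    using assms by (rule AE_E)
  have [measurable]: "N \<in> sets borel" using N by simp
  have "(\<integral>\<^sup>+u. indicator N (t - u) \<partial>lborel) = (\<integral>\<^sup>+v. indicator N v \<partial>lborel)"
    using nn_integral_real_affine[of "indicator N" "- 1" t] by simp
  also have "\<dots> = 0" using N by simp
  finally have "AE u in lborel. indicator N (t - u) = (0::ennreal)"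
    by (subst (asm) nn_integral_0_iff_AE) auto
  then show ?thesis
    by eventually_elim (use N in \<open>auto simp: indicator_def split: if_splits\<close>)
qed

lemma AE_plane:
  assumes "AE v in lborel. P (v :: real)"
  shows "AE z in plane. P (fst z) \<and> P (snd z)"
proof -
  obtain N where N: "{v \<in> space lborel. \<not> P v} \<subseteq> N" "emeasure lborel N = 0" "N \<in> sets lborel"
    using assms by (rule AE_E)
  have [measurable]: "N \<in> sets lborel" by (rule N)
  have n: "AE v in lborel. v \<notin> N" using N by (intro AE_not_in) (auto simp: null_sets_def)
  have "AE z in plane. fst z \<notin> N \<and> snd z \<notin> N"
  proof (rule lborel_pair.AE_pair_measure)
    from n show "AE x in lborel. AE y in lborel. fst (x, y) \<notin> N \<and> snd (x, y) \<notin> N"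
      by eventually_elim (use n in \<open>eventually_elim, simp\<close>)
  qed measurable
  then show ?thesis by eventually_elim (use N in auto)
qed

lemma nn_integral_plane_scale:
  assumes T: "0 < T" and [measurable]: "g \<in> borel_measurable plane"
  shows "(\<integral>\<^sup>+z. g z \<partial>plane) = ennreal (T\<^sup>2) * (\<integral>\<^sup>+z. g (T * fst z, T * snd z) \<partial>plane)"
proof -
  have "(\<integral>\<^sup>+z. g z \<partial>plane) = (\<integral>\<^sup>+x. \<integral>\<^sup>+y. g (x, y) \<partial>lborel \<partial>lborel)"
    by (rule lborel.nn_integral_fst[symmetric]) measurable
  also have "\<dots> = ennreal T * (\<integral>\<^sup>+x. \<integral>\<^sup>+y. g (T * x, y) \<partial>lborel \<partial>lborel)"
    using nn_integral_real_affine[of "\<lambda>x. \<integral>\<^sup>+y. g (x, y) \<partial>lborel" T 0] T by simp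
  also have "(\<integral>\<^sup>+x. \<integral>\<^sup>+y. g (T * x, y) \<partial>lborel \<partial>lborel) =
      (\<integral>\<^sup>+x. ennreal T * (\<integral>\<^sup>+y. g (T * x, T * y) \<partial>lborel) \<partial>lborel)"
  proof (rule nn_integral_cong)
    fix x :: real
    show "(\<integral>\<^sup>+y. g (T * x, y) \<partial>lborel) = ennreal T * (\<integral>\<^sup>+y. g (T * x, T * y) \<partial>lborel)"
      using nn_integral_real_affine[of "\<lambda>y. g (T * x, y)" T 0] T by simp
  qed
  also have "\<dots> = ennreal T * (\<integral>\<^sup>+x. \<integral>\<^sup>+y. g (T * x, T * y) \<partial>lborel \<partial>lborel)"
    by (rule nn_integral_cmult) measurable
  also have "(\<integral>\<^sup>+x. \<integral>\<^sup>+y. g (T * x, T * y) \<partial>lborel \<partial>lborel) = (\<integral>\<^sup>+z. g (T * fst z, T * snd z) \<partial>plane)"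
    by (subst lborel.nn_integral_fst[symmetric]) auto
  finally show ?thesis
    using T by (simp add: power2_eq_square ennreal_mult mult.assoc)
qed

text \<open>Equality holds at every \<open>\<xi>\<close>, since for fixed t the integrands differ
  only on the reflection of the null set where y is not a version of x.\<close>

lemma hermite_kernel_1_eq_volterra:
  assumes f: "hermite_integrand H (\<lambda>u. indicator {0..t} u * x (t - u))"
    and [measurable]: "y \<in> borel_measurable borel" and eq: "AE v in lborel. indicator {0..} v * x v = y v"
  shows "hermite_kernel 1 H (\<lambda>u. indicator {0..t} u * x (t - u)) (line_point \<xi>) =
    hermite_const 1 H * volterra_kernel (H - 3/2) y t \<xi>"
proof -
  have "AE u in lborel. indicator {0..t} u * x (t - u) * frac_kernel (H - 3/2) u \<xi> =
      indicator {0..t} u * y (t - u) * frac_kernel (H - 3/2) u \<xi>"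
    using AE_lborel_reflect[OF eq, of t]
    by eventually_elim (auto simp: indicator_def)
  then have "(LINT u|lebesgue. indicator {0..t} u * x (t - u) * frac_kernel (H - 3/2) u \<xi>) =
      volterra_kernel (H - 3/2) y t \<xi>"
    unfolding volterra_kernel_def by (intro completion_AE_eq(2)) measurable
  then show ?thesis
    by (simp add: hermite_kernel_def hermite_H0_def line_point_def frac_kernel_def)
qed

text \<open>The parameter 2H - 1 makes \<open>hermite_H0 2 (2 * H - 1)\<close> equal to H, so both
  factors have exponent H - 3/2. Where the integral diverges, the Bochner integral and
  \<open>enn2real\<close> both return 0.\<close>

lemma hermite_kernel_2_eq_shifted:
  "hermite_kernel 2 (2 * H - 1) (indicator {0..t}) (plane_point z) =
    hermite_const 2 (2 * H - 1) * enn2real (shifted_kernel (H - 3/2) t 0 0 z)"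
proof -
  have e: "hermite_H0 2 (2 * H - 1) - 3/2 = H - 3/2"
    by (simp add: hermite_H0_def field_simps)
  have p: "(\<Prod>j<2. max 0 (u - plane_point z j) powr (H - 3/2)) =
      frac_kernel (H - 3/2) u (fst z) * frac_kernel (H - 3/2) u (snd z)" for u
    by (simp add: numeral_2_eq_2 plane_point_def frac_kernel_def)
  have w: "indicator {0..t} u * (frac_kernel (H - 3/2) u (fst z) * frac_kernel (H - 3/2) u (snd z)) =
      window_kernel (H - 3/2) t 0 0 u z" for u
    by (auto simp: window_kernel_def window_def indicator_def)
  have m: "(\<lambda>u. window_kernel (H - 3/2) t 0 0 u z) \<in> borel_measurable lborel"
  proof -
    have [measurable]: "z \<in> space plane" by (simp add: space_pair_measure)
    show ?thesis by measurable
  qed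
  have "(LINT u|lebesgue. window_kernel (H - 3/2) t 0 0 u z) = enn2real (shifted_kernel (H - 3/2) t 0 0 z)"
    unfolding shifted_kernel_def using m
    by (simp add: integral_completion integral_eq_nn_integral)
  then show ?thesis
    unfolding hermite_kernel_def e p w by simp
qed

text \<open>As \<open>hermite_H0\<close> is H in both constants, they share one Beta value. It
  enters the squared constant of order 1 once and that of order 2 squared under the root, so it has
  the same power on both sides; the remaining ratio is the prefactor of b.\<close>

lemma rosenblatt_constant:
  assumes "3 / 4 < H" "H < 1"
  shows "H * (2 * H - 1) / sqrt ((H - 1 / 2) * (4 * H - 3)) * hermite_const 2 (2 * H - 1) = (hermite_const 1 H)\<^sup>2"
proof -
  define \<beta> where "\<beta> = Beta (H - 1 / 2) (2 - 2 * H)"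
  have \<beta>: "0 < \<beta>"
    unfolding \<beta>_def Beta_def using assms by (intro divide_pos_pos mult_pos_pos Gamma_real_pos) auto
  have h: "hermite_H0 1 H = H" "hermite_H0 2 (2 * H - 1) = H"
    by (auto simp: hermite_H0_def field_simps)
  have c1: "(hermite_const 1 H)\<^sup>2 = H * (2 * H - 1) / \<beta>"
    unfolding hermite_const_def h using assms \<beta> by (simp add: \<beta>_def)
  let ?r = "(H - 1 / 2) * (4 * H - 3)"
  have r: "0 < ?r" using assms by simp
  have "(2 * H - 1) * (2 * (2 * H - 1) - 1) = fact 2 * ?r"
    by (simp add: algebra_simps)
  then have "hermite_const 2 (2 * H - 1) = sqrt (fact 2 * ?r / (fact 2 * \<beta>\<^sup>2))"
    unfolding hermite_const_def h \<beta>_def[symmetric] by (simp only:)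
  also have "\<dots> = sqrt (?r / \<beta>\<^sup>2)"
    by (intro arg_cong[where f = sqrt] mult_divide_mult_cancel_left) simp
  also have "\<dots> = sqrt ?r / \<beta>"
    using \<beta> by (simp only: real_sqrt_divide real_sqrt_abs abs_of_pos)
  finally have c2: "hermite_const 2 (2 * H - 1) = sqrt ?r / \<beta>" .
  show ?thesis
    unfolding c1 c2 using r assms by (simp only: times_divide_times_eq) simp
qed

text \<open>x is only Lebesgue measurable, while joint measurability of
  \<open>volterra_kernel\<close> asks for a Borel function. Vanishing on negative numbers builds the
  half-line into y itself.\<close>

lemma borel_version:
  assumes "set_integrable lebesgue {0..} x"
  obtains y :: "real \<Rightarrow> real" where "integrable lborel y" "\<forall>v<0. y v = 0"
    "AE v in lborel. indicator {0..} v * x v = y v"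
proof -
  have x: "integrable lebesgue (\<lambda>v. indicator {0..} v * x v)"
    using assms by (simp add: set_integrable_def)
  obtain g where g: "g \<in> borel_measurable lborel" "AE v in lborel. indicator {0..} v * x v = g v"
    using completion_ex_borel_measurable_real[OF borel_measurable_integrable[OF x]] by auto
  define y where "y v = indicator {0..} v * g v" for v
  have eq: "AE v in lborel. indicator {0..} v * x v = y v"
    using g(2) by eventually_elim (auto simp: y_def indicator_def split: if_splits)
  have ym: "y \<in> borel_measurable lborel" unfolding y_def[abs_def] using g by measurable
  have "integrable lborel y" using x unfolding completion_AE_eq(3)[OF ym eq] .
  then show thesis using that eq by (auto simp: y_def)
qed

lemma plane_completion: "completion plane = (lebesgue :: (real \<times> real) measure)"
  by (simp add: lborel_prod)

lemma integral_square_borel_version: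
  fixes x y :: "real \<Rightarrow> real"
  assumes y: "integrable lborel y" and eq: "AE v in lborel. indicator {0..} v * x v = y v"
  shows "set_lebesgue_integral (lebesgue :: (real \<times> real) measure) ({0..} \<times> {0..}) (\<lambda>(u, v). x u * x v) =
    (LINT v|lborel. y v)\<^sup>2"
proof -
  have "integral\<^sup>L (completion plane) (\<lambda>z. indicator ({0..} \<times> {0..}) z *\<^sub>R (case z of (u, v) \<Rightarrow> x u * x v)) =
      (LINT z|plane. y (fst z) * y (snd z))"
  proof (rule completion_AE_eq(2))
    show "AE z in plane. indicator ({0..} \<times> {0..}) z *\<^sub>R (case z of (u, v) \<Rightarrow> x u * x v) = y (fst z) * y (snd z)"
      using AE_plane[OF eq]
      by eventually_elim (auto simp: indicator_def split: if_splits prod.splits)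
  qed (use y in measurable)
  also have "\<dots> = (LINT v|lborel. y v)\<^sup>2"
    using lborel_pair.integral_tensor(2)[OF y y] by (simp add: power2_eq_square)
  finally show ?thesis by (simp add: set_lebesgue_integral_def plane_completion)
qed

lemma frac_energy_borel_version:
  assumes x: "set_integrable (lebesgue :: (real \<times> real) measure) ({0..} \<times> {0..})
           (\<lambda>(u, v). \<bar>x u\<bar> * \<bar>x v\<bar> * \<bar>u - v\<bar> powr (2 * H - 2))"
    and [measurable]: "y \<in> borel_measurable borel" and eq: "AE v in lborel. indicator {0..} v * x v = y v"
  shows "frac_energy (H - 3/2) y < \<infinity>"
proof -
  let ?g = "\<lambda>z. \<bar>y (fst z)\<bar> * \<bar>y (snd z)\<bar> * \<bar>fst z - snd z\<bar> powr (2 * H - 2)"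
  have ae: "AE z in plane. indicator ({0..} \<times> {0..}) z *\<^sub>R
      (case z of (u, v) \<Rightarrow> \<bar>x u\<bar> * \<bar>x v\<bar> * \<bar>u - v\<bar> powr (2 * H - 2)) = ?g z"
    using AE_plane[OF eq]
    by eventually_elim (auto simp: indicator_def split: if_splits prod.splits)
  have "integrable (completion plane) (\<lambda>z. indicator ({0..} \<times> {0..}) z *\<^sub>R
      (case z of (u, v) \<Rightarrow> \<bar>x u\<bar> * \<bar>x v\<bar> * \<bar>u - v\<bar> powr (2 * H - 2)))"
    using x by (simp add: set_integrable_def plane_completion)
  then have int: "integrable plane ?g"
    by (subst (asm) completion_AE_eq(3)[OF _ ae]) auto
  have "frac_energy (H - 3/2) y = (\<integral>\<^sup>+z. ennreal (?g z) \<partial>plane)"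
    unfolding frac_energy_def by (subst lborel.nn_integral_fst[symmetric]) (auto simp: algebra_simps)
  also have "\<dots> < \<infinity>"
    using int by (auto simp: integrable_iff_bounded)
  finally show ?thesis .
qed

text \<open>\<open>quadratic_functional_chaos2_distance\<close> is applied on the time interval
  [0, T t] to the step function on the grid stretched by T, and then the plane is rescaled by T. The
  Jacobian T^2 and the squared normalisation combine to the square of T^(2 - 2H), and 2 - 2H is the
  exponent -1 - 2a of \<open>volterra_square_integral_rescaled\<close>.\<close>

lemma quadratic_functional_distance:
  assumes M: "two_sided_bm M B" and H: "3/4 < H" "H < 1"
    and X: "fractional_volterra_process M B H x X"
    and y [measurable]: "y \<in> borel_measurable borel" and eq: "AE v in lborel. indicator {0..} v * x v = y v"
    and energy: "frac_energy (H - 3/2) y < \<infinity>"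
    and T: "0 < T" and t: "0 \<le> t" and p: "strict_mono_on {..n} p"
  shows "(\<integral>\<^sup>+\<omega>. ennreal ((quadratic_functional M H X T t \<omega>
        - c / T * offdiag_step_integral B 2 n (\<lambda>i. T * p i) a \<omega>)\<^sup>2) \<partial>M) \<le>
      2 * (\<integral>\<^sup>+z. ennreal (((hermite_const 1 H)\<^sup>2 * (T powr (- 1 - 2 * (H - 3/2)) * (LINT s:{0..T * t}|lborel.
          volterra_kernel (H - 3/2) y s (T * fst z) * volterra_kernel (H - 3/2) y s (T * snd z)))
        - c * offdiag_step 2 n p a (plane_point z))\<^sup>2) \<partial>plane)"
    and "quadratic_functional M H X T t \<in> borel_measurable M"
proof -
  interpret two_sided_bm M B by fact
  let ?a = "H - 3/2" and ?c1 = "hermite_const 1 H"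
  have a: "-1 < ?a" "?a < -1/2" using H by auto
  define Q where "Q = restrict_space lborel {0..T * t}"
  have Qs: "space Q = {0..T * t}" by (simp add: Q_def space_restrict_space)
  have Q: "finite_measure Q"
    by (rule finite_measureI)
      (simp add: Q_def space_restrict_space emeasure_restrict_space emeasure_lborel_Icc_eq)
  have idQ [measurable]: "(\<lambda>s. s) \<in> measurable Q borel"
    unfolding Q_def by (rule measurable_restrict_space1) simp
  define k where "k s \<xi> = ?c1 * volterra_kernel ?a y s \<xi>" for s \<xi>
  have k: "case_prod k \<in> borel_measurable (Q \<Otimes>\<^sub>M lborel)"
    unfolding k_def case_prod_beta' by measurable
  have mX: "(\<lambda>(t, \<omega>). X t \<omega>) \<in> borel_measurable (restrict_space borel {0..} \<Otimes>\<^sub>M M)"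
    using X by (auto simp: fractional_volterra_process_def)
  have XQ: "case_prod X \<in> borel_measurable (Q \<Otimes>\<^sub>M M)"
  proof -
    have "(\<lambda>z. (fst z, snd z)) \<in> measurable (Q \<Otimes>\<^sub>M M) (restrict_space borel {0..} \<Otimes>\<^sub>M M)"
    proof (rule measurable_Pair)
      show "fst \<in> measurable (Q \<Otimes>\<^sub>M M) (restrict_space borel {0..})"
        by (rule measurable_restrict_space2) (auto simp: space_pair_measure Qs)
    qed simp
    from measurable_compose[OF this mX] show ?thesis by simp
  qed
  have W: "wiener (k s) (X s)" if s: "s \<in> space Q" for s
  proof -
    have "0 \<le> s" using s by (simp add: Qs)
    then have h: "has_hermite_integral M B 1 H (\<lambda>u. indicator {0..s} u * x (s - u)) (X s)"
      using X by (auto simp: fractional_volterra_process_def)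
    then have hi: "hermite_integrand H (\<lambda>u. indicator {0..s} u * x (s - u))"
      by (simp add: has_hermite_integral_def)
    have "wiener (\<lambda>\<xi>. hermite_kernel 1 H (\<lambda>u. indicator {0..s} u * x (s - u)) (line_point \<xi>)) (X s)"
      using h by (intro wiener_of_multiple_integral) (simp add: has_hermite_integral_def)
    then show ?thesis
      unfolding hermite_kernel_1_eq_volterra[OF hi y eq] k_def .
  qed
  \<comment> \<open>Finite by the energy condition, and a bound for the variances of X_s uniform in
    s.\<close>
  define C where "C = enn2real (ennreal (?c1\<^sup>2) * (ennreal (frac_const ?a) * frac_energy ?a y))"
  have C: "(LINT \<xi>|lborel. (k s \<xi>)\<^sup>2) \<le> C" if s: "s \<in> space Q" for s
  proof -
    have "(\<integral>\<^sup>+\<xi>. ennreal ((k s \<xi>)\<^sup>2) \<partial>lborel) = ennreal (?c1\<^sup>2) * (\<integral>\<^sup>+\<xi>. ennreal ((volterra_kernel ?a y s \<xi>)\<^sup>2) \<partial>lborel)"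
      unfolding k_def power_mult_distrib by (subst nn_integral_cmult[symmetric]) (auto simp: ennreal_mult)
    also have "\<dots> \<le> ennreal (?c1\<^sup>2) * (ennreal (frac_const ?a) * frac_energy ?a y)"
      by (intro mult_left_mono volterra_kernel_norm[OF a]) auto
    finally have "(\<integral>\<^sup>+\<xi>. ennreal ((k s \<xi>)\<^sup>2) \<partial>lborel) \<le> \<dots>" .
    moreover have "\<dots> < \<infinity>" using energy by (simp add: ennreal_mult_less_top)
    moreover have "(LINT \<xi>|lborel. (k s \<xi>)\<^sup>2) = enn2real (\<integral>\<^sup>+\<xi>. ennreal ((k s \<xi>)\<^sup>2) \<partial>lborel)"
      using wiener_measurable(1)[OF W[OF s]] by (intro integral_eq_nn_integral) auto
    ultimately show ?thesis unfolding C_def by (simp add: enn2real_mono)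
  qed
  let ?S = "offdiag_step 2 n (\<lambda>i. T * p i) a" and ?I = "offdiag_step_integral B 2 n (\<lambda>i. T * p i) a"
  let ?e = "T powr (2 * H - 1)"
  have e0: "0 < ?e" using T by simp
  define h where "h z = (LINT s|Q. k s (fst z) * k s (snd z))" for z
  let ?d = "\<lambda>z. h (T * fst z, T * snd z) - ?e * (c / T) * offdiag_step 2 n p a (plane_point z)"
  have Tp: "strict_mono_on {..n} (\<lambda>i. T * p i)" using p T by (simp add: strict_mono_on_def)
  define V where "V \<omega> = (LINT s|Q. (X s \<omega>)\<^sup>2 - expectation (\<lambda>\<omega>. (X s \<omega>)\<^sup>2))" for \<omega>
  \<comment> \<open>The coefficient carries T^(2H - 1) because V is the functional before
    normalisation.\<close>
  note dist = quadratic_functional_chaos2_distance[OF Q k XQ W C chaos2_offdiag_step[OF Tp, of "?e * (c / T)" a],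
      folded V_def h_def]
  have I [measurable]: "?I \<in> borel_measurable M"
    unfolding offdiag_step_integral_def[abs_def] by measurable
  have V [measurable]: "V \<in> borel_measurable M" and hm [measurable]: "h \<in> borel_measurable plane"
    using dist(1,2) by (simp_all add: V_def[abs_def] h_def[abs_def])
  have G: "quadratic_functional M H X T t \<omega> = V \<omega> / ?e" for \<omega>
    unfolding quadratic_functional_def V_def Q_def set_lebesgue_integral_def
    by (simp add: integral_restrict_space)
  show "quadratic_functional M H X T t \<in> borel_measurable M"
    unfolding G[abs_def] using V by measurable
  have hT: "h (T * fst z, T * snd z) = ?c1\<^sup>2 * (LINT s:{0..T * t}|lborel.
      volterra_kernel ?a y s (T * fst z) * volterra_kernel ?a y s (T * snd z))" for z
  proof -
    have "h (T * fst z, T * snd z) = (LINT s:{0..T * t}|lborel. k s (T * fst z) * k s (T * snd z))"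
      unfolding h_def Q_def set_lebesgue_integral_def by (simp add: integral_restrict_space)
    also have "\<dots> = (LINT s:{0..T * t}|lborel. ?c1\<^sup>2 *
        (volterra_kernel ?a y s (T * fst z) * volterra_kernel ?a y s (T * snd z)))"
      unfolding k_def by (simp add: power2_eq_square ac_simps)
    finally show ?thesis by simp
  qed
  have ST: "?S (plane_point (T * fst z, T * snd z)) = offdiag_step 2 n p a (plane_point z)" for z
    unfolding offdiag_step_plane_point using T by (simp add: indicator_def)
  have "(\<integral>\<^sup>+\<omega>. ennreal ((quadratic_functional M H X T t \<omega> - c / T * ?I \<omega>)\<^sup>2) \<partial>M) =
      (\<integral>\<^sup>+\<omega>. ennreal (1 / ?e\<^sup>2) * ennreal ((V \<omega> - ?e * (c / T) * ?I \<omega>)\<^sup>2) \<partial>M)"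
  proof (rule nn_integral_cong)
    fix \<omega>
    have "quadratic_functional M H X T t \<omega> - c / T * ?I \<omega> = (V \<omega> - ?e * (c / T) * ?I \<omega>) / ?e"
      using e0 by (simp add: G diff_divide_distrib)
    then show "ennreal ((quadratic_functional M H X T t \<omega> - c / T * ?I \<omega>)\<^sup>2) =
        ennreal (1 / ?e\<^sup>2) * ennreal ((V \<omega> - ?e * (c / T) * ?I \<omega>)\<^sup>2)"
      by (simp add: power_divide flip: ennreal_mult)
  qed
  also have "\<dots> = ennreal (1 / ?e\<^sup>2) * (\<integral>\<^sup>+\<omega>. ennreal ((V \<omega> - ?e * (c / T) * ?I \<omega>)\<^sup>2) \<partial>M)"
    by (rule nn_integral_cmult) measurable
  also have "\<dots> \<le> ennreal (1 / ?e\<^sup>2) * (2 * (\<integral>\<^sup>+z. ennreal ((h z - ?e * (c / T) * ?S (plane_point z))\<^sup>2) \<partial>plane))"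
    using dist(3) by (intro mult_left_mono) (simp_all add: V_def h_def)
  also have "(\<integral>\<^sup>+z. ennreal ((h z - ?e * (c / T) * ?S (plane_point z))\<^sup>2) \<partial>plane) =
      ennreal (T\<^sup>2) * (\<integral>\<^sup>+z. ennreal ((?d z)\<^sup>2) \<partial>plane)"
  proof -
    have [measurable]: "(\<lambda>z. ?S (plane_point z)) \<in> borel_measurable plane"
      by (rule measurable_compose[OF plane_point_measurable offdiag_step_measurable])
    show ?thesis
      by (subst nn_integral_plane_scale[OF T]) (simp_all only: ST, measurable)
  qed
  also have "ennreal (1 / ?e\<^sup>2) * (2 * (ennreal (T\<^sup>2) *
      (\<integral>\<^sup>+z. ennreal ((?d z)\<^sup>2) \<partial>plane))) =
    2 * (\<integral>\<^sup>+z. ennreal ((T / ?e)\<^sup>2) * ennreal ((?d z)\<^sup>2) \<partial>plane)"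
  proof -
    have [measurable]: "(\<lambda>z. offdiag_step 2 n p a (plane_point z)) \<in> borel_measurable plane"
      by (rule measurable_compose[OF plane_point_measurable offdiag_step_measurable])
    have e: "ennreal ((T / ?e)\<^sup>2) = ennreal (1 / ?e\<^sup>2) * ennreal (T\<^sup>2)"
      by (simp add: power_divide flip: ennreal_mult)
    have "(\<integral>\<^sup>+z. ennreal ((T / ?e)\<^sup>2) * ennreal ((?d z)\<^sup>2) \<partial>plane) =
      ennreal ((T / ?e)\<^sup>2) * (\<integral>\<^sup>+z. ennreal ((?d z)\<^sup>2) \<partial>plane)"
      by (rule nn_integral_cmult) measurable
    then show ?thesis
      unfolding e by (simp only: mult.left_commute mult.assoc)
  qed
  also have "(\<integral>\<^sup>+z. ennreal ((T / ?e)\<^sup>2) * ennreal ((?d z)\<^sup>2) \<partial>plane) =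
    (\<integral>\<^sup>+z. ennreal ((?c1\<^sup>2 * (T powr (- 1 - 2 * ?a) * (LINT s:{0..T * t}|lborel.
          volterra_kernel ?a y s (T * fst z) * volterra_kernel ?a y s (T * snd z)))
        - c * offdiag_step 2 n p a (plane_point z))\<^sup>2) \<partial>plane)"
  proof (rule nn_integral_cong)
    fix z
    let ?L = "LINT s:{0..T * t}|lborel. volterra_kernel ?a y s (T * fst z) * volterra_kernel ?a y s (T * snd z)"
    let ?s = "offdiag_step 2 n p a (plane_point z)"
    have Te: "T / ?e = T powr (- 1 - 2 * ?a)"
      using T powr_diff[of T 1 "2 * H - 1"] by simp
    have "(T / ?e) * (h (T * fst z, T * snd z) - ?e * (c / T) * ?s) =
        ?c1\<^sup>2 * ((T / ?e) * ?L) - c * ?s"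
      unfolding hT using T e0 by (simp add: right_diff_distrib)
    then have "((T / ?e) * (h (T * fst z, T * snd z) - ?e * (c / T) * ?s))\<^sup>2 =
        (?c1\<^sup>2 * (T powr (- 1 - 2 * ?a) * ?L) - c * ?s)\<^sup>2"
      unfolding Te by simp
    then show "ennreal ((T / ?e)\<^sup>2) * ennreal ((h (T * fst z, T * snd z) - ?e * (c / T) * ?s)\<^sup>2) =
        ennreal ((?c1\<^sup>2 * (T powr (- 1 - 2 * ?a) * ?L) - c * ?s)\<^sup>2)"
      by (simp only: ennreal_mult[symmetric] power_mult_distrib zero_le_power2)
  qed
  finally show "(\<integral>\<^sup>+\<omega>. ennreal ((quadratic_functional M H X T t \<omega> - c / T * ?I \<omega>)\<^sup>2) \<partial>M) \<le>
      2 * (\<integral>\<^sup>+z. ennreal ((?c1\<^sup>2 * (T powr (- 1 - 2 * ?a) * (LINT s:{0..T * t}|lborel.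
          volterra_kernel ?a y s (T * fst z) * volterra_kernel ?a y s (T * snd z)))
        - c * offdiag_step 2 n p a (plane_point z))\<^sup>2) \<partial>plane)" .
qed

section \<open>Combination of the L2 approximations and convergence in law\<close>

lemma tendsto_L2_triangle:
  fixes f g h :: "nat \<Rightarrow> 'a \<Rightarrow> real"
  assumes [measurable]: "\<And>n. f n \<in> borel_measurable M" "\<And>n. g n \<in> borel_measurable M" "\<And>n. h n \<in> borel_measurable M"
    and fg: "(\<lambda>n. \<integral>\<^sup>+x. ennreal ((f n x - g n x)\<^sup>2) \<partial>M) \<longlonglongrightarrow> 0"
    and gh: "(\<lambda>n. \<integral>\<^sup>+x. ennreal ((g n x - h n x)\<^sup>2) \<partial>M) \<longlonglongrightarrow> 0"
  shows "(\<lambda>n. \<integral>\<^sup>+x. ennreal ((f n x - h n x)\<^sup>2) \<partial>M) \<longlonglongrightarrow> 0"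
proof (rule tendsto_sandwich[OF _ _ tendsto_const])
  let ?u = "\<lambda>n. 2 * (\<integral>\<^sup>+x. ennreal ((f n x - g n x)\<^sup>2) \<partial>M) + 2 * (\<integral>\<^sup>+x. ennreal ((g n x - h n x)\<^sup>2) \<partial>M)"
  have "?u \<longlonglongrightarrow> 2 * 0 + 2 * 0"
    by (intro tendsto_add ennreal_tendsto_cmult fg gh) auto
  then show "?u \<longlonglongrightarrow> 0" by simp
  have "(\<integral>\<^sup>+x. ennreal ((f n x - h n x)\<^sup>2) \<partial>M) \<le> ?u n" for n
  proof -
    have "(\<integral>\<^sup>+x. ennreal ((f n x - h n x)\<^sup>2) \<partial>M) \<le>
        (\<integral>\<^sup>+x. 2 * ennreal ((f n x - g n x)\<^sup>2) + 2 * ennreal ((g n x - h n x)\<^sup>2) \<partial>M)"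
    proof (rule nn_integral_mono)
      show "ennreal ((f n x - h n x)\<^sup>2) \<le> 2 * ennreal ((f n x - g n x)\<^sup>2) + 2 * ennreal ((g n x - h n x)\<^sup>2)" for x
        using square_le_twice[of "f n x - g n x" "g n x - h n x"] by simp
    qed
    also have "\<dots> = ?u n" by (simp add: nn_integral_add nn_integral_cmult)
    finally show ?thesis .
  qed
  then show "\<forall>\<^sub>F n in sequentially. (\<integral>\<^sup>+x. ennreal ((f n x - h n x)\<^sup>2) \<partial>M) \<le> ?u n" by simp
qed auto

lemma tendsto_L2_scale:
  fixes f g :: "nat \<Rightarrow> 'a \<Rightarrow> real"
  assumes [measurable]: "\<And>n. f n \<in> borel_measurable M" "\<And>n. g n \<in> borel_measurable M"
    and fg: "(\<lambda>n. \<integral>\<^sup>+x. ennreal ((f n x - g n x)\<^sup>2) \<partial>M) \<longlonglongrightarrow> 0"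
  shows "(\<lambda>n. \<integral>\<^sup>+x. ennreal ((c * f n x - c * g n x)\<^sup>2) \<partial>M) \<longlonglongrightarrow> 0"
proof -
  have "(\<integral>\<^sup>+x. ennreal ((c * f n x - c * g n x)\<^sup>2) \<partial>M) =
      ennreal (c\<^sup>2) * (\<integral>\<^sup>+x. ennreal ((f n x - g n x)\<^sup>2) \<partial>M)" for n
    by (subst nn_integral_cmult[symmetric])
      (simp_all add: power_mult_distrib flip: right_diff_distrib ennreal_mult)
  moreover have "(\<lambda>n. ennreal (c\<^sup>2) * (\<integral>\<^sup>+x. ennreal ((f n x - g n x)\<^sup>2) \<partial>M)) \<longlonglongrightarrow> ennreal (c\<^sup>2) * 0"
    by (intro ennreal_tendsto_cmult fg) simp
  ultimately show ?thesis by simp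
qed

theorem theorem2p1p2:
  fixes H :: real and x :: "real \<Rightarrow> real"
    and M :: "'a measure" and B X :: "real \<Rightarrow> 'a \<Rightarrow> real"
    and N :: "'b measure" and W R :: "real \<Rightarrow> 'b \<Rightarrow> real"
  assumes "3 / 4 < H" and "H < 1"
    and "two_sided_brownian_motion M B"
    and "set_integrable lebesgue {0..} x"
    and "set_integrable (lebesgue :: (real \<times> real) measure) ({0..} \<times> {0..})
           (\<lambda>(u, v). \<bar>x u\<bar> * \<bar>x v\<bar> * \<bar>u - v\<bar> powr (2 * H - 2))"
    and "fractional_volterra_process M B H x X"
    and "two_sided_brownian_motion N W"
    and "rosenblatt_process N W (2 * H - 1) R"
  defines "b \<equiv> H * (2 * H - 1) / sqrt ((H - 1 / 2) * (4 * H - 3)) *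
             set_lebesgue_integral (lebesgue :: (real \<times> real) measure) ({0..} \<times> {0..})
               (\<lambda>(u, v). x u * x v)"
  shows "fdd_converges M (quadratic_functional M H X) N (\<lambda>t \<omega>. b * R t \<omega>) at_top"
proof -
  have M: "two_sided_bm M B" and N: "two_sided_bm N W"
    using assms(3,7)
    by (auto simp: two_sided_bm_def two_sided_bm_axioms_def two_sided_brownian_motion_def)
  interpret M: two_sided_bm M B by (rule M)
  interpret N: two_sided_bm N W by (rule N)
  define a where "a = H - 3 / 2"
  have a: "-3/4 < a" "a < -1/2" using assms(1,2) by (auto simp: a_def)
  let ?c1 = "hermite_const 1 H" and ?c2 = "hermite_const 2 (2 * H - 1)"
  obtain y :: "real \<Rightarrow> real" where y: "integrable lborel y" "\<forall>v<0. y v = 0"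
    and xy: "AE v in lborel. indicator {0..} v * x v = y v"
    using borel_version[OF assms(4)] .
  have ym: "y \<in> borel_measurable borel" using y by auto
  have energy: "frac_energy a y < \<infinity>"
    unfolding a_def by (rule frac_energy_borel_version[OF assms(5) ym xy])
  \<comment> \<open>Identifies the constant in the limit of the kernels of G_T with b times the
    constant of the Rosenblatt kernel.\<close>
  have b: "b * ?c2 = ?c1\<^sup>2 * (LINT v|lborel. y v)\<^sup>2"
    unfolding b_def integral_square_borel_version[OF y(1) xy] rosenblatt_constant[OF assms(1,2), symmetric]
    by (simp add: ac_simps)
  \<comment> \<open>\<open>fdd_converges\<close> demands measurability for every real T. For T <= 0
    the time interval is a null set and the functional is 0.\<close>
  have Gm: "quadratic_functional M H X T t \<in> borel_measurable M" if t: "0 \<le> t" for T t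
  proof (cases "0 < T")
    case True
    have "strict_mono_on {..(0::nat)} real" by (auto simp: strict_mono_on_def)
    from quadratic_functional_distance(2)[OF M assms(1,2,6) ym xy energy[unfolded a_def] True t this]
    show ?thesis .
  next
    case False
    then have "T * t \<le> 0" using t by (simp add: mult_nonpos_nonneg)
    then have "{0..T * t} \<subseteq> {0}" by auto
    then have "AE s in lborel. s \<notin> {0..T * t}"
      using AE_lborel_singleton[of "0::real"] by (auto elim!: eventually_mono)
    then have "(LINT s:{0..T * t}|lborel. (X s \<omega>)\<^sup>2 - (LINT \<omega>'|M. (X s \<omega>')\<^sup>2)) = 0" for \<omega>
      unfolding set_lebesgue_integral_def
      by (intro integral_eq_zero_AE) (auto elim!: eventually_mono)
    then have "quadratic_functional M H X T t = (\<lambda>\<omega>. 0)"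
      by (simp add: quadratic_functional_def fun_eq_iff)
    then show ?thesis by simp
  qed
  have R: "has_multiple_wiener_integral N W 2 (hermite_kernel 2 (2 * H - 1) (indicator {0..t})) (R t)"
    if "0 \<le> t" for t
    using assms(8) that by (auto simp: hermite_process_def has_hermite_integral_def)
  have Rm: "R t \<in> borel_measurable N" if "0 \<le> t" for t
    using R[OF that] by (simp add: has_multiple_wiener_integral_def)
  let ?r = "\<lambda>t z. ?c2 * enn2real (shifted_kernel a t 0 0 z)"
  \<comment> \<open>The step functions are those that the definition provides for \<open>R t\<close>
    as a version of its integral. Each t brings its own grids and coefficients.\<close>
  define approx where "approx t n p c \<longleftrightarrow> (\<forall>k. strict_mono_on {..n k} (p k)) \<and>
      (\<lambda>k. \<integral>\<^sup>+z. ennreal ((?r t z - offdiag_step 2 (n k) (p k) (c k) (plane_point z))\<^sup>2) \<partial>plane) \<longlonglongrightarrow> 0 \<and>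
      (\<lambda>k. \<integral>\<^sup>+\<omega>. ennreal ((R t \<omega> - offdiag_step_integral W 2 (n k) (p k) (c k) \<omega>)\<^sup>2) \<partial>N) \<longlonglongrightarrow> 0"
    for t n p c
  have "\<exists>n p c. approx t n p c" if t: "0 \<le> t" for t
  proof -
    let ?f = "hermite_kernel 2 (2 * H - 1) (indicator {0..t})"
    obtain n p c where f [measurable]: "?f \<in> borel_measurable (\<Pi>\<^sub>M j\<in>{..<2}. lborel)"
      and p: "\<forall>k. strict_mono_on {..n k} (p k)"
      and l1: "(\<lambda>k. \<integral>\<^sup>+\<xi>. ennreal ((?f \<xi> - offdiag_step 2 (n k) (p k) (c k) \<xi>)\<^sup>2)
                 \<partial>(\<Pi>\<^sub>M j\<in>{..<2}. lborel)) \<longlonglongrightarrow> 0"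
      and l2: "(\<lambda>k. \<integral>\<^sup>+\<omega>. ennreal ((R t \<omega> - offdiag_step_integral W 2 (n k) (p k) (c k) \<omega>)\<^sup>2) \<partial>N) \<longlonglongrightarrow> 0"
      using R[OF t] unfolding has_multiple_wiener_integral_def by (elim conjE exE)
    have e: "(\<integral>\<^sup>+\<xi>. ennreal ((?f \<xi> - offdiag_step 2 (n k) (p k) (c k) \<xi>)\<^sup>2) \<partial>(\<Pi>\<^sub>M j\<in>{..<2}. lborel)) =
        (\<integral>\<^sup>+z. ennreal ((?r t z - offdiag_step 2 (n k) (p k) (c k) (plane_point z))\<^sup>2) \<partial>plane)" for k
    proof -
      note [measurable] = offdiag_step_measurable[of 2 "n k" "p k" "c k"]
      have m: "(\<lambda>\<xi>. ennreal ((?f \<xi> - offdiag_step 2 (n k) (p k) (c k) \<xi>)\<^sup>2)) \<in>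
          borel_measurable (\<Pi>\<^sub>M j\<in>{..<2}. lborel)" by measurable
      show ?thesis
        unfolding nn_integral_plane_point[OF m] hermite_kernel_2_eq_shifted a_def ..
    qed
    show ?thesis
      unfolding approx_def by (intro exI conjI) (rule p, rule l1[unfolded e], rule l2)
  qed
  then obtain n p c where approx: "\<And>t. 0 \<le> t \<Longrightarrow> approx t (n t) (p t) (c t)" by metis
  have p: "strict_mono_on {..n t k} (p t k)"
    and lk: "(\<lambda>k. \<integral>\<^sup>+z. ennreal ((?r t z - offdiag_step 2 (n t k) (p t k) (c t k) (plane_point z))\<^sup>2) \<partial>plane) \<longlonglongrightarrow> 0"
    and lR: "(\<lambda>k. \<integral>\<^sup>+\<omega>. ennreal ((R t \<omega> - offdiag_step_integral W 2 (n t k) (p t k) (c t k) \<omega>)\<^sup>2) \<partial>N) \<longlonglongrightarrow> 0"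
    if "0 \<le> t" for t k
    using approx[OF that] by (auto simp only: approx_def)
  have Im: "offdiag_step_integral W 2 (n t k) (p t k) (c t k) \<in> borel_measurable N" for t k
    unfolding offdiag_step_integral_def[abs_def] by measurable
  have ImB: "offdiag_step_integral B 2 m q d \<in> borel_measurable M" for m q d
    unfolding offdiag_step_integral_def[abs_def] by measurable
  have Sm: "(\<lambda>z. offdiag_step 2 (n t k) (p t k) (c t k) (plane_point z)) \<in> borel_measurable plane" for t k
    by (rule measurable_compose[OF plane_point_measurable offdiag_step_measurable])
  \<comment> \<open>A finite second moment of the limit is what absorbs the quadratic term of the
    modulus of continuity.\<close>
  have bR2: "(\<integral>\<^sup>+\<omega>. ennreal ((b * R t \<omega>)\<^sup>2) \<partial>N) < \<infinity>" if t: "0 \<le> t" for t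
  proof -
    have "integrable N (\<lambda>\<omega>. (R t \<omega>)\<^sup>2)"
    proof (rule L2_limit(1)[OF Rm[OF t] Im _ lR[OF t]])
      fix k
      from N.chaos2_square_integrable[OF N.chaos2_offdiag_step[OF p[OF t], of 1 k "c t k"]]
      show "integrable N (\<lambda>\<omega>. (offdiag_step_integral W 2 (n t k) (p t k) (c t k) \<omega>)\<^sup>2)" by simp
    qed
    then have "integrable N (\<lambda>\<omega>. (b * R t \<omega>)\<^sup>2)" by (simp add: power_mult_distrib)
    then show ?thesis by (simp add: integrable_iff_bounded)
  qed
  have lbR: "(\<lambda>k. \<integral>\<^sup>+\<omega>. ennreal ((b * offdiag_step_integral W 2 (n t k) (p t k) (c t k) \<omega> - b * R t \<omega>)\<^sup>2) \<partial>N) \<longlonglongrightarrow> 0"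
    if t: "0 \<le> t" for t
    by (rule tendsto_L2_scale[OF Im Rm[OF t]]) (subst power2_commute, rule lR[OF t])
  \<comment> \<open>The kernel error is split at b times the Rosenblatt kernel. One part vanishes
    because T tends to infinity, the other because the step functions converge, so both can share
    the index k whatever their rates.\<close>
  have GZ: "(\<lambda>k. \<integral>\<^sup>+\<omega>. ennreal ((quadratic_functional M H X (T k) t \<omega> -
      b / T k * offdiag_step_integral B 2 (n t k) (\<lambda>i. T k * p t k i) (c t k) \<omega>)\<^sup>2) \<partial>M) \<longlonglongrightarrow> 0"
    if t: "0 \<le> t" and T: "filterlim T at_top sequentially" "\<And>k. 0 < T k" for t and T :: "nat \<Rightarrow> real"
  proof -
    define g where "g k z = T k powr (- 1 - 2 * a) * (LINT s:{0..T k * t}|lborel.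
        volterra_kernel a y s (T k * fst z) * volterra_kernel a y s (T k * snd z))" for k z
    have [measurable]: "g k \<in> borel_measurable plane" for k
    proof -
      note [measurable] = ym
      show ?thesis unfolding g_def[abs_def] set_lebesgue_integral_def by measurable
    qed
    have "(\<lambda>k. \<integral>\<^sup>+z. ennreal ((g k z - (LINT v|lborel. y v)\<^sup>2 * enn2real (shifted_kernel a t 0 0 z))\<^sup>2) \<partial>plane) \<longlonglongrightarrow> 0"
      unfolding g_def using y(2) by (intro rescaled_volterra_square_tendsto[OF a y(1) _ T]) auto
    then have lim1: "(\<lambda>k. \<integral>\<^sup>+z. ennreal ((?c1\<^sup>2 * g k z - ?c1\<^sup>2 * ((LINT v|lborel. y v)\<^sup>2 * enn2real (shifted_kernel a t 0 0 z)))\<^sup>2) \<partial>plane) \<longlonglongrightarrow> 0"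
      by (rule tendsto_L2_scale[rotated 2]) measurable
    have eq: "?c1\<^sup>2 * ((LINT v|lborel. y v)\<^sup>2 * enn2real (shifted_kernel a t 0 0 z)) = b * ?r t z" for z
      by (simp only: mult.assoc[symmetric] b)
    have 1: "(\<lambda>k. \<integral>\<^sup>+z. ennreal ((?c1\<^sup>2 * g k z - b * ?r t z)\<^sup>2) \<partial>plane) \<longlonglongrightarrow> 0"
      using lim1 unfolding eq .
    have m: "(\<lambda>z. b * offdiag_step 2 (n t k) (p t k) (c t k) (plane_point z)) \<in> borel_measurable plane" for k
      by (intro borel_measurable_times borel_measurable_const Sm)
    have 2: "(\<lambda>k. \<integral>\<^sup>+z. ennreal ((b * ?r t z - b * offdiag_step 2 (n t k) (p t k) (c t k) (plane_point z))\<^sup>2) \<partial>plane) \<longlonglongrightarrow> 0"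
      by (rule tendsto_L2_scale[OF _ Sm lk[OF t]]) measurable
    have "(\<lambda>k. \<integral>\<^sup>+z. ennreal ((?c1\<^sup>2 * g k z - b * offdiag_step 2 (n t k) (p t k) (c t k) (plane_point z))\<^sup>2) \<partial>plane) \<longlonglongrightarrow> 0"
      by (rule tendsto_L2_triangle[OF _ _ m 1 2]) measurable
    from ennreal_tendsto_cmult[OF _ this, of 2]
    have lim: "(\<lambda>k. 2 * (\<integral>\<^sup>+z. ennreal ((?c1\<^sup>2 * g k z - b * offdiag_step 2 (n t k) (p t k) (c t k) (plane_point z))\<^sup>2) \<partial>plane)) \<longlonglongrightarrow> 0"
      by simp
    show ?thesis
    proof (rule tendsto_sandwich[OF _ _ tendsto_const lim])
      show "\<forall>\<^sub>F k in sequentially. (\<integral>\<^sup>+\<omega>. ennreal ((quadratic_functional M H X (T k) t \<omega> -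
          b / T k * offdiag_step_integral B 2 (n t k) (\<lambda>i. T k * p t k i) (c t k) \<omega>)\<^sup>2) \<partial>M) \<le>
        2 * (\<integral>\<^sup>+z. ennreal ((?c1\<^sup>2 * g k z - b * offdiag_step 2 (n t k) (p t k) (c t k) (plane_point z))\<^sup>2) \<partial>plane)"
        unfolding g_def a_def
        by (intro always_eventually allI quadratic_functional_distance(1)[OF M assms(1,2,6) ym xy
              energy[unfolded a_def] T(2) t p[OF t]])
    qed auto
  qed
  show ?thesis
    unfolding fdd_converges_def
  proof (intro conjI allI impI)
    show "quadratic_functional M H X T t \<in> borel_measurable M" if "0 \<le> t" for T t by (rule Gm[OF that])
    show "(\<lambda>\<omega>. b * R t \<omega>) \<in> borel_measurable N" if "0 \<le> t" for t using Rm[OF that] by measurable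
  next
    fix J :: "real set" and \<phi> :: "(real \<Rightarrow> real) \<Rightarrow> real"
    assume asm: "finite J \<and> J \<subseteq> {0..} \<and> continuous_map (powertop_real J) euclideanreal \<phi> \<and> bounded (\<phi> ` (J \<rightarrow>\<^sub>E UNIV))"
    then have J: "finite J" and J0: "\<And>t. t \<in> J \<Longrightarrow> 0 \<le> t"
      and cont: "continuous_map (powertop_real J) euclideanreal \<phi>" and bdd: "bounded (\<phi> ` (J \<rightarrow>\<^sub>E UNIV))"
      by auto
    let ?E = "\<lambda>T. LINT \<omega>|M. \<phi> (\<lambda>t\<in>J. quadratic_functional M H X T t \<omega>)"
    let ?L = "LINT \<omega>|N. \<phi> (\<lambda>t\<in>J. b * R t \<omega>)"
    show "(?E \<longlongrightarrow> ?L) at_top"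
    proof (rule tendsto_at_topI_sequentially)
      fix T0 :: "nat \<Rightarrow> real" assume T0: "filterlim T0 at_top sequentially"
      \<comment> \<open>Positive for every k, as scaling requires, and eventually equal to
        \<open>T0\<close>.\<close>
      define T where "T k = max 1 (T0 k)" for k
      have ev: "eventually (\<lambda>k. T k = T0 k) sequentially"
        using T0[unfolded filterlim_at_top, rule_format, of 1]
        by eventually_elim (simp add: T_def)
      have T: "filterlim T at_top sequentially"
        by (rule filterlim_at_top_mono[OF T0]) (simp add: T_def)
      have Tpos: "0 < T k" for k by (simp add: T_def)
      have "(\<lambda>k. ?E (T k)) \<longlonglongrightarrow> ?L"
      proof (rule expectation_tendsto_of_equal_laws[OF M.prob_space_axioms N.prob_space_axioms J cont bdd,
            where Z = "\<lambda>k t \<omega>. b / T k * offdiag_step_integral B 2 (n t k) (\<lambda>i. T k * p t k i) (c t k) \<omega>"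
              and Z' = "\<lambda>k t \<omega>. b * offdiag_step_integral W 2 (n t k) (p t k) (c t k) \<omega>"])
        fix k :: nat and t assume "t \<in> J"
        note t = J0[OF this]
        show "quadratic_functional M H X (T k) t \<in> borel_measurable M" by (rule Gm[OF t])
        show "(\<lambda>\<omega>. b / T k * offdiag_step_integral B 2 (n t k) (\<lambda>i. T k * p t k i) (c t k) \<omega>) \<in> borel_measurable M"
          using ImB by measurable
        show "(\<lambda>\<omega>. b * offdiag_step_integral W 2 (n t k) (p t k) (c t k) \<omega>) \<in> borel_measurable N"
          using Im by measurable
      next
        fix t assume "t \<in> J"
        note t = J0[OF this]
        show "(\<lambda>\<omega>. b * R t \<omega>) \<in> borel_measurable N" using Rm[OF t] by measurable
        show "(\<integral>\<^sup>+\<omega>. ennreal ((b * R t \<omega>)\<^sup>2) \<partial>N) < \<infinity>" by (rule bR2[OF t])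
        show "(\<lambda>k. \<integral>\<^sup>+\<omega>. ennreal ((quadratic_functional M H X (T k) t \<omega> -
            b / T k * offdiag_step_integral B 2 (n t k) (\<lambda>i. T k * p t k i) (c t k) \<omega>)\<^sup>2) \<partial>M) \<longlonglongrightarrow> 0"
          by (rule GZ[OF t T Tpos])
        show "(\<lambda>k. \<integral>\<^sup>+\<omega>. ennreal ((b * offdiag_step_integral W 2 (n t k) (p t k) (c t k) \<omega> - b * R t \<omega>)\<^sup>2) \<partial>N) \<longlonglongrightarrow> 0"
          by (rule lbR[OF t])
      next
        fix k
        show "distr M (\<Pi>\<^sub>M t\<in>J. borel) (\<lambda>\<omega>. \<lambda>t\<in>J. b / T k * offdiag_step_integral B 2 (n t k) (\<lambda>i. T k * p t k i) (c t k) \<omega>) =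
            distr N (\<Pi>\<^sub>M t\<in>J. borel) (\<lambda>\<omega>. \<lambda>t\<in>J. b * offdiag_step_integral W 2 (n t k) (p t k) (c t k) \<omega>)"
          by (rule step_integral_scaling_law[OF M N J Tpos])
      qed
      moreover from ev have "eventually (\<lambda>k. ?E (T k) = ?E (T0 k)) sequentially"
        by eventually_elim simp
      ultimately show "(\<lambda>k. ?E (T0 k)) \<longlonglongrightarrow> ?L"
        by (rule Lim_transform_eventually)
    qed
  qed
qed

end
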